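(* Let $\varphi=\Phi I\in H^\infty$, where $I$ is inner and $\Phi$ is outer, and suppose that $|\varphi|$ is continuous but not constant on $\mathbb{T}$. Then $\varphi$ is saturated if and only if $L_\Phi^+(1)\cap\sigma(I)\neq\emptyset$.
   Context: $\mathbb{T}$ is the unit circle with normalized Lebesgue measure; $H^p$ ($1\le p\le\infty$) is the subspace of $L^p(\mathbb{T})$ of functions with Fourier coefficients supported on $\{0,1,2,\dots\}$, and $H^\infty_0$ is the subspace of $H^\infty$ of functions vanishing at the origin. A function $\varphi\in H^\infty$ is saturated if $\|\varphi\|_\infty = \inf_{f\in H^\infty_0}\|\varphi-\overline{f}\|_\infty$. Every $\varphi \in H^\infty$ factors as $\varphi=\Phi I$ with $I$ inner ($|I|=1$ a.e. on $\mathbb{T}$) and $\Phi$ outer, $|\Phi|=|\varphi|$ a.e. on $\mathbb{T}$. For a bounded function $\psi$ and $0\le\delta\le1$, the super-level set is $L_\psi^+(\delta)=\{e^{i\theta}\in\mathbb{T}: |\psi(e^{i\theta})|\ge \|\psi\|_\infty\delta\}$. Writing an inner function $I=BS$ with $B$ a Blaschke product and $S$ a singular inner function, the spectrum $\sigma(I)\subseteq\mathbb{T}$ is the union of the set of accumulation points of the zeros of $B$ and the support of the singular measure associated with $S$. *)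

theory Defs
  imports "HOL-Probability.Probability"
begin

definition circle_meas :: "complex measure" where
  "circle_meas = distr (density (restrict_space lborel {0..<2*pi}) (\<lambda>_. ennreal (1/(2*pi))))
                       borel cis"

definition Hinf :: "(complex \<Rightarrow> complex) set" where
  "Hinf = {f. f holomorphic_on ball 0 1 \<and> bounded (f ` ball 0 1)}"

definition Hinf0 :: "(complex \<Rightarrow> complex) set" where
  "Hinf0 = {f \<in> Hinf. f 0 = 0}"

definition bdry :: "(complex \<Rightarrow> complex) \<Rightarrow> complex \<Rightarrow> complex" where
  "bdry f \<zeta> = (if (\<exists>L. ((\<lambda>r::real. f (of_real r * \<zeta>)) \<longlongrightarrow> L) (at_left 1))
               then Lim (at_left 1) (\<lambda>r::real. f (of_real r * \<zeta>)) else 0)"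

definition linf :: "(complex \<Rightarrow> complex) \<Rightarrow> real" where
  "linf g = Inf {C. C \<ge> 0 \<and> (AE \<zeta> in circle_meas. cmod (g \<zeta>) \<le> C)}"

definition saturated :: "(complex \<Rightarrow> complex) \<Rightarrow> bool" where
  "saturated \<phi> \<longleftrightarrow>
     linf (bdry \<phi>) = (INF f\<in>Hinf0. linf (\<lambda>\<zeta>. bdry \<phi> \<zeta> - cnj (bdry f \<zeta>)))"

definition inner :: "(complex \<Rightarrow> complex) \<Rightarrow> bool" where
  "inner I \<longleftrightarrow> I \<in> Hinf \<and> (AE \<zeta> in circle_meas. cmod (bdry I \<zeta>) = 1)"

definition outer :: "(complex \<Rightarrow> complex) \<Rightarrow> bool" where
  "outer F \<longleftrightarrow> (\<exists>c k. cmod c = 1 \<and> (\<forall>\<zeta>. k \<zeta> > 0) \<and>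
      integrable circle_meas (\<lambda>\<zeta>. ln (k \<zeta>)) \<and>
      (\<forall>z\<in>ball 0 1. F z = c * exp (integral\<^sup>L circle_meas
            (\<lambda>\<zeta>. (\<zeta> + z) / (\<zeta> - z) * of_real (ln (k \<zeta>))))))"

definition blaschke_factor :: "complex \<Rightarrow> complex \<Rightarrow> complex" where
  "blaschke_factor a z = (of_real (cmod a) / a) * (a - z) / (1 - cnj a * z)"

definition blaschke :: "(complex \<Rightarrow> complex) \<Rightarrow> bool" where
  "blaschke B \<longleftrightarrow> (\<exists>(m::nat) (N::nat set) (a::nat \<Rightarrow> complex).
      (\<forall>n\<in>N. a n \<noteq> 0 \<and> cmod (a n) < 1) \<and>
      summable (\<lambda>n. if n \<in> N then 1 - cmod (a n) else 0) \<and>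
      (\<forall>z\<in>ball 0 1. B z = z ^ m * (\<Prod>n. if n \<in> N then blaschke_factor (a n) z else 1)))"

definition singular_measure :: "complex measure \<Rightarrow> bool" where
  "singular_measure \<mu> \<longleftrightarrow> finite_measure \<mu> \<and> sets \<mu> = sets borel \<and>
      emeasure \<mu> (- sphere 0 1) = 0 \<and>
      (\<exists>N\<in>sets borel. emeasure circle_meas N = 0 \<and> emeasure \<mu> (- N) = 0)"

definition singular_inner :: "complex measure \<Rightarrow> complex \<Rightarrow> complex" where
  "singular_inner \<mu> z = exp (- integral\<^sup>L \<mu> (\<lambda>\<zeta>. (\<zeta> + z) / (\<zeta> - z)))"

definition measure_support :: "complex measure \<Rightarrow> complex set" where
  "measure_support \<mu> = {\<zeta>. \<forall>e>0. emeasure \<mu> (ball \<zeta> e) > 0}"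

text \<open>Spectrum of an inner function I = c B S: accumulation points of the zeros
  (of B, i.e. of I) together with the support of the singular measure of S.\<close>
definition inner_spectrum :: "(complex \<Rightarrow> complex) \<Rightarrow> complex set" where
  "inner_spectrum I =
     {\<zeta>. cmod \<zeta> = 1 \<and> \<zeta> islimpt {z\<in>ball 0 1. I z = 0}} \<union>
     {\<zeta>. \<exists>c B \<mu>. cmod c = 1 \<and> blaschke B \<and> singular_measure \<mu> \<and>
          (\<forall>z\<in>ball 0 1. I z = c * B z * singular_inner \<mu> z) \<and> \<zeta> \<in> measure_support \<mu>}"

definition superlevel :: "(complex \<Rightarrow> complex) \<Rightarrow> real \<Rightarrow> complex set" where
  "superlevel \<psi> \<delta> = {\<zeta>\<in>sphere 0 1. cmod (\<psi> \<zeta>) \<ge> linf \<psi> * \<delta>}"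

end

theory Submission
  imports Defs "HOL-Complex_Analysis.Complex_Analysis"
begin

text \<open>
  Let \<open>K\<close> be the set where \<open>h\<close> attains its maximum \<open>M\<close>. For \<open>f\<close> in \<open>Hinf0\<close> one has
  \<open>\<bar>\<phi> - cnj f\<bar>\<^sup>2 = \<bar>\<phi>\<bar>\<^sup>2 - 2 Re (\<phi> f) + \<bar>f\<bar>\<^sup>2\<close> on the circle, so \<open>\<phi>\<close> fails to be saturated exactly when
  \<open>Re (\<phi> f)\<close> is bounded below by a positive constant near \<open>K\<close> for some such \<open>f\<close>: a small multiple of \<open>f\<close>
  then pushes the norm below \<open>M\<close>.

  If \<open>K\<close> meets the spectrum of \<open>I\<close> at \<open>\<zeta>\<close>, then no \<open>f\<close> works: a lower bound for \<open>Re (\<phi> f)\<close> on an arc around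
  \<open>\<zeta>\<close> propagates into the disc by the Poisson integral, whereas \<open>I\<close>, hence \<open>\<phi> f\<close>, has lower limit \<open>0\<close> at \<open>\<zeta>\<close>.

  If \<open>K\<close> misses the spectrum, the canonical factorization of \<open>I\<close> shows that \<open>I\<close> extends analytically
  and without zeros across \<open>K\<close>. So does \<open>\<Phi> \<Psi>\<close>, where \<open>\<Psi>\<close> is outer of modulus \<open>1 / max h (M/2)\<close>. Since \<open>K\<close> is a
  proper closed subset of the circle, \<open>cnj (\<Phi> \<Psi> I)\<close> can be approximated uniformly on \<open>K\<close> by analytic
  functions \<open>p\<close> with \<open>p 0 = 0\<close>, and \<open>f = \<Psi> p\<close> has the required property.
\<close>

section \<open>The circle measure\<close>

abbreviation angle_meas :: "real measure" where
  "angle_meas \<equiv> uniform_measure lborel {0..<2*pi}"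

lemma sets_circle_meas [measurable_cong, simp]: "sets circle_meas = sets borel"
  and space_circle_meas [simp]: "space circle_meas = UNIV"
  by (simp_all add: circle_meas_def)

lemma borel_measurable_cis [measurable]: "cis \<in> borel_measurable borel"
  by (intro borel_measurable_continuous_onI continuous_intros)

lemma angle_meas_eq_density: "angle_meas = density lborel (\<lambda>\<theta>. ennreal (indicator {0..<2*pi} \<theta> / (2*pi)))"
  unfolding uniform_measure_def
  by (intro density_cong) (auto simp: indicator_def divide_ennreal simp flip: ennreal_1)

lemma circle_meas_eq_distr: "circle_meas = distr angle_meas borel cis"
proof (rule measure_eqI)
  fix A assume "A \<in> sets circle_meas"
  then have A [measurable]: "A \<in> sets borel" by simp
  have cisA: "cis -` A \<in> sets borel"
    using measurable_sets[OF borel_measurable_cis A] by simp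
  have "emeasure circle_meas A =
      emeasure (density (restrict_space lborel {0..<2*pi}) (\<lambda>_. ennreal (1/(2*pi)))) (cis -` A \<inter> {0..<2*pi})"
    unfolding circle_meas_def
    by (subst emeasure_distr) (auto simp: space_restrict_space intro!: measurable_restrict_space1)
  also have "\<dots> = (\<integral>\<^sup>+x. ennreal (1/(2*pi)) * indicator (cis -` A \<inter> {0..<2*pi}) x \<partial>restrict_space lborel {0..<2*pi})"
    using cisA by (subst emeasure_density) (auto simp: sets_restrict_space)
  also have "\<dots> = (\<integral>\<^sup>+x. ennreal (indicator {0..<2*pi} x / (2*pi)) * indicator (cis -` A) x \<partial>lborel)"
    by (subst nn_integral_restrict_space) (auto intro!: nn_integral_cong simp: indicator_def)
  also have "\<dots> = emeasure (distr angle_meas borel cis) A"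
    unfolding angle_meas_eq_density using cisA by (simp add: emeasure_distr emeasure_density)
  finally show "emeasure circle_meas A = emeasure (distr angle_meas borel cis) A" .
qed simp

lemma prob_space_angle_meas: "prob_space angle_meas"
  by (rule prob_space_uniform_measure) auto

interpretation angle_meas: prob_space angle_meas
  by (rule prob_space_angle_meas)

interpretation circle_meas: prob_space circle_meas
  unfolding circle_meas_eq_distr by (rule angle_meas.prob_space_distr) simp

lemma AE_angle_meas: "AE \<theta> in angle_meas. \<theta> \<in> {0..<2*pi}"
  by (rule AE_uniform_measureI) auto

lemma AE_circle_meas_norm: "AE \<zeta> in circle_meas. cmod \<zeta> = 1"
  unfolding circle_meas_eq_distr by (subst AE_distr_iff) auto

lemma AE_circle_meas_sphere: "AE \<zeta> in circle_meas. \<zeta> \<in> sphere 0 1"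
  using AE_circle_meas_norm by simp

lemma circle_meas_integrable_bounded:
  fixes f :: "complex \<Rightarrow> 'a :: {banach, second_countable_topology}"
  assumes "f \<in> borel_measurable borel" "AE \<zeta> in circle_meas. norm (f \<zeta>) \<le> B"
  shows "integrable circle_meas f"
  by (rule circle_meas.integrable_const_bound[OF assms(2)]) (use assms in simp)

lemma compact_continuous_bounded:
  fixes f :: "'a::topological_space \<Rightarrow> 'b::real_normed_vector"
  assumes "compact S" "continuous_on S f"
  obtains B where "B > 0" "\<And>x. x \<in> S \<Longrightarrow> norm (f x) \<le> B"
  using compact_imp_bounded[OF compact_continuous_image[OF assms(2,1)]] unfolding bounded_pos by blast

lemma set_integrable_circle_continuous:
  fixes f :: "complex \<Rightarrow> 'a :: {banach, second_countable_topology}"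
  assumes "continuous_on (sphere 0 1) f"
  shows "set_integrable circle_meas (sphere 0 1) f"
  unfolding set_integrable_def
proof -
  obtain B where "\<And>x. x \<in> sphere 0 1 \<Longrightarrow> norm (f x) \<le> B"
    using compact_continuous_bounded[OF compact_sphere assms] by metis
  with AE_circle_meas_norm have "AE \<zeta> in circle_meas. norm (indicator (sphere 0 1) \<zeta> *\<^sub>R f \<zeta>) \<le> B"
    by (auto elim!: eventually_mono)
  moreover have "(\<lambda>\<zeta>. indicator (sphere 0 1) \<zeta> *\<^sub>R f \<zeta>) \<in> borel_measurable borel"
    by (intro borel_measurable_continuous_on_indicator assms) simp
  ultimately show "integrable circle_meas (\<lambda>\<zeta>. indicator (sphere 0 1) \<zeta> *\<^sub>R f \<zeta>)"
    by (intro circle_meas_integrable_bounded)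
qed

lemma has_integral_circle_meas:
  fixes f :: "complex \<Rightarrow> 'a :: euclidean_space"
  assumes f: "continuous_on (sphere 0 1) f"
  shows "((\<lambda>\<theta>. f (cis \<theta>)) has_integral (2*pi) *\<^sub>R (LINT \<zeta>:sphere 0 1|circle_meas. f \<zeta>)) {0..2*pi}"
proof -
  have cont: "continuous_on {0..2*pi} (\<lambda>\<theta>. f (cis \<theta>))"
    by (rule continuous_on_compose2[OF f]) (auto intro!: continuous_intros)
  have [measurable]: "(\<lambda>\<zeta>. indicator (sphere 0 1) \<zeta> *\<^sub>R f \<zeta>) \<in> borel_measurable borel"
    by (intro borel_measurable_continuous_on_indicator f) simp
  then have [measurable]: "(\<lambda>\<theta>. f (cis \<theta>)) \<in> borel_measurable borel"
    using measurable_compose[OF borel_measurable_cis, of "\<lambda>\<zeta>. indicator (sphere 0 1) \<zeta> *\<^sub>R f \<zeta>" borel]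
    by simp
  have "(LINT \<zeta>:sphere 0 1|circle_meas. f \<zeta>) = (\<integral>\<theta>. f (cis \<theta>) \<partial>angle_meas)"
    unfolding circle_meas_eq_distr set_lebesgue_integral_def by (subst integral_distr) auto
  also have "\<dots> = (\<integral>\<theta>. (1/(2*pi)) *\<^sub>R (indicator {0..<2*pi} \<theta> *\<^sub>R f (cis \<theta>)) \<partial>lborel)"
    unfolding angle_meas_eq_density by (subst integral_density) auto
  also have "\<dots> = (1/(2*pi)) *\<^sub>R (LINT \<theta>:{0..<2*pi}|lborel. f (cis \<theta>))"
    unfolding set_lebesgue_integral_def by (rule integral_scaleR_right)
  also have "(LINT \<theta>:{0..<2*pi}|lborel. f (cis \<theta>)) = (LINT \<theta>:{0..2*pi}|lborel. f (cis \<theta>))"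
    unfolding set_lebesgue_integral_def using AE_lborel_singleton[of "2*pi"]
    by (intro integral_cong_AE) (auto elim!: eventually_mono simp: indicator_def)
  also have "\<dots> = integral {0..2*pi} (\<lambda>\<theta>. f (cis \<theta>))"
    by (rule set_borel_integral_eq_integral(2))
       (rule borel_integrable_compact[OF _ cont, folded set_integrable_def], simp)
  finally show ?thesis
    using integrable_continuous_real[OF cont] by (simp add: has_integral_integral)
qed

section \<open>The Poisson kernel\<close>

definition poisson :: "complex \<Rightarrow> complex \<Rightarrow> real" where
  "poisson z \<zeta> = (1 - (cmod z)\<^sup>2) / (cmod (\<zeta> - z))\<^sup>2"

lemma poisson_zero [simp]: "cmod \<zeta> = 1 \<Longrightarrow> poisson 0 \<zeta> = 1"
  by (simp add: poisson_def)

lemma poisson_nonneg: "cmod z \<le> 1 \<Longrightarrow> poisson z \<zeta> \<ge> 0"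
  by (simp add: poisson_def power_le_one)

lemma borel_measurable_poisson [measurable (raw)]:
  assumes [measurable]: "f \<in> borel_measurable M" "g \<in> borel_measurable M"
  shows "(\<lambda>x. poisson (f x) (g x)) \<in> borel_measurable M"
  unfolding poisson_def by measurable

lemma norm_diff_ge: "cmod \<zeta> = 1 \<Longrightarrow> cmod (\<zeta> - z) \<ge> 1 - cmod z"
  using norm_triangle_ineq2[of \<zeta> z] by simp

lemma continuous_on_poisson: "cmod z < 1 \<Longrightarrow> continuous_on (sphere 0 1) (poisson z)"
  unfolding poisson_def by (intro continuous_intros) auto

lemma poisson_eq_Re:
  assumes "cmod \<zeta> = 1" "z \<noteq> \<zeta>"
  shows "poisson z \<zeta> = Re ((\<zeta> + z) / (\<zeta> - z))"
proof -
  have "(\<zeta> + z) / (\<zeta> - z) = (\<zeta> + z) * cnj (\<zeta> - z) / of_real ((cmod (\<zeta> - z))\<^sup>2)"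
    using complex_div_cnj[of "\<zeta> + z" "\<zeta> - z"] by (simp only: of_real_power)
  then have "Re ((\<zeta> + z) / (\<zeta> - z)) = Re ((\<zeta> + z) * cnj (\<zeta> - z)) / (cmod (\<zeta> - z))\<^sup>2"
    by (simp only: Re_divide_of_real)
  moreover have "Re ((\<zeta> + z) * cnj (\<zeta> - z)) = (cmod \<zeta>)\<^sup>2 - (cmod z)\<^sup>2"
    unfolding cmod_power2 by (simp add: power2_eq_square algebra_simps)
  ultimately show ?thesis using assms by (simp add: poisson_def)
qed

lemma one_minus_norm_sq_le: "1 - (cmod z)\<^sup>2 \<le> 2 * (1 - cmod z)"
  using sum_squares_bound[of 1 "cmod z"] by (simp add: algebra_simps)

lemma poisson_le:
  assumes "cmod \<zeta> = 1" "cmod z < 1"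
  shows "poisson z \<zeta> \<le> 2 / (1 - cmod z)"
proof -
  have "poisson z \<zeta> \<le> 2 * (1 - cmod z) / (1 - cmod z)\<^sup>2"
    unfolding poisson_def using assms
    by (intro frac_le one_minus_norm_sq_le power_mono norm_diff_ge) auto
  also have "\<dots> = 2 / (1 - cmod z)" using assms by (simp add: power2_eq_square divide_simps)
  finally show ?thesis .
qed

lemma poisson_le_far:
  assumes "d > 0" "cmod z \<le> 1" "d \<le> dist \<zeta> z"
  shows "poisson z \<zeta> \<le> (1 - (cmod z)\<^sup>2) / d\<^sup>2"
  unfolding poisson_def using assms by (intro frac_le power_mono) (auto simp: dist_norm power_le_one)

lemma poisson_symm:
  assumes "cmod \<zeta> = 1" "cmod \<xi> = 1"
  shows "poisson (of_real r * \<zeta>) \<xi> = poisson (of_real r * \<xi>) \<zeta>"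
proof -
  have unit: "(Re \<zeta>)\<^sup>2 + (Im \<zeta>)\<^sup>2 = 1" "(Re \<xi>)\<^sup>2 + (Im \<xi>)\<^sup>2 = 1"
    using assms by (simp_all add: cmod_power2[symmetric])
  have "(cmod (\<xi> - of_real r * \<zeta>))\<^sup>2 - (cmod (\<zeta> - of_real r * \<xi>))\<^sup>2 =
    (1 - r\<^sup>2) * (((Re \<xi>)\<^sup>2 + (Im \<xi>)\<^sup>2) - ((Re \<zeta>)\<^sup>2 + (Im \<zeta>)\<^sup>2))"
    unfolding cmod_power2 by (simp add: power2_eq_square algebra_simps)
  then have "(cmod (\<xi> - of_real r * \<zeta>))\<^sup>2 = (cmod (\<zeta> - of_real r * \<xi>))\<^sup>2" using unit by simp
  then show ?thesis using assms by (simp add: poisson_def norm_mult)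
qed

section \<open>Measures on the circle and their Poisson integrals\<close>

locale circle_measure = finite_measure \<mu> for \<mu> :: "complex measure" +
  assumes sets_eq_borel [simp, measurable_cong]: "sets \<mu> = sets borel"
    and AE_norm_eq_1: "AE \<zeta> in \<mu>. cmod \<zeta> = 1"
begin

lemma space_eq_UNIV [simp]: "space \<mu> = UNIV"
  using sets_eq_imp_space_eq[OF sets_eq_borel] by simp

end

lemma circle_measureI:
  assumes "emeasure \<mu> UNIV \<noteq> \<infinity>" "sets \<mu> = sets borel" "AE \<zeta> in \<mu>. cmod \<zeta> = 1"
  shows "circle_measure \<mu>"
  using assms sets_eq_imp_space_eq[OF assms(2)]
  by (intro circle_measure.intro circle_measure_axioms.intro finite_measureI) auto

lemma (in circle_measure) circle_measure_density:
  assumes g: "integrable \<mu> g" "\<And>\<zeta>. g \<zeta> \<ge> 0"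
  shows "circle_measure (density \<mu> g)" and "measure (density \<mu> g) UNIV = (\<integral>\<zeta>. g \<zeta> \<partial>\<mu>)"
proof -
  have [measurable]: "g \<in> borel_measurable \<mu>" using g(1) by auto
  have total: "emeasure (density \<mu> g) UNIV = ennreal (\<integral>\<zeta>. g \<zeta> \<partial>\<mu>)"
    using g by (simp add: emeasure_density nn_integral_eq_integral)
  show "circle_measure (density \<mu> g)"
  proof (rule circle_measureI)
    show "AE \<zeta> in density \<mu> g. cmod \<zeta> = 1" using AE_norm_eq_1 by (subst AE_density) auto
  qed (use total in simp_all)
  show "measure (density \<mu> g) UNIV = (\<integral>\<zeta>. g \<zeta> \<partial>\<mu>)" using total g(2) by (simp add: measure_def)
qed

interpretation circle_meas: circle_measure circle_meas
  by unfold_locales (simp_all add: AE_circle_meas_norm)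

definition poisson_integral ::
  "complex measure \<Rightarrow> (complex \<Rightarrow> 'a::{banach, second_countable_topology}) \<Rightarrow> complex \<Rightarrow> 'a" where
  "poisson_integral \<mu> w z = (\<integral>\<zeta>. poisson z \<zeta> *\<^sub>R w \<zeta> \<partial>\<mu>)"

context circle_measure
begin

lemma integrable_poisson:
  fixes w :: "complex \<Rightarrow> 'a::{banach, second_countable_topology}"
  assumes w: "integrable \<mu> w" and z: "cmod z < 1"
  shows "integrable \<mu> (\<lambda>\<zeta>. poisson z \<zeta> *\<^sub>R w \<zeta>)"
proof (rule Bochner_Integration.integrable_bound)
  show "integrable \<mu> (\<lambda>\<zeta>. (2 / (1 - cmod z)) *\<^sub>R w \<zeta>)" using w by auto
  have [measurable]: "w \<in> borel_measurable \<mu>" using w by auto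
  show "(\<lambda>\<zeta>. poisson z \<zeta> *\<^sub>R w \<zeta>) \<in> borel_measurable \<mu>" by measurable
  show "AE \<zeta> in \<mu>. norm (poisson z \<zeta> *\<^sub>R w \<zeta>) \<le> norm ((2 / (1 - cmod z)) *\<^sub>R w \<zeta>)"
    using AE_norm_eq_1
  proof eventually_elim
    case (elim \<zeta>)
    then show ?case using poisson_le[of \<zeta> z] poisson_nonneg[of z \<zeta>] z
      by (simp only: norm_scaleR) (intro mult_right_mono, auto)
  qed
qed

lemma integrable_poisson_kernel: "cmod z < 1 \<Longrightarrow> integrable \<mu> (poisson z)"
  using integrable_poisson[of "\<lambda>_. 1::real" z] by simp

lemma poisson_integral_diff:
  assumes "integrable \<mu> v" "integrable \<mu> w" "cmod z < 1"
  shows "poisson_integral \<mu> (\<lambda>\<zeta>. v \<zeta> - w \<zeta>) z = poisson_integral \<mu> v z - poisson_integral \<mu> w z"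
  unfolding poisson_integral_def scaleR_diff_right
  by (intro Bochner_Integration.integral_diff integrable_poisson assms)

lemma poisson_integral_mono:
  fixes v w :: "complex \<Rightarrow> real"
  assumes "integrable \<mu> v" "integrable \<mu> w" "cmod z < 1" "AE \<zeta> in \<mu>. v \<zeta> \<le> w \<zeta>"
  shows "poisson_integral \<mu> v z \<le> poisson_integral \<mu> w z"
  unfolding poisson_integral_def
proof (intro integral_mono_AE integrable_poisson assms(1-3))
  show "AE \<zeta> in \<mu>. poisson z \<zeta> *\<^sub>R v \<zeta> \<le> poisson z \<zeta> *\<^sub>R w \<zeta>"
    using assms(4) by eventually_elim (use assms(3) poisson_nonneg in \<open>auto intro!: mult_left_mono\<close>)
qed

lemma poisson_integral_nonneg:
  fixes w :: "complex \<Rightarrow> real"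
  assumes "cmod z < 1" "\<And>\<zeta>. w \<zeta> \<ge> 0" shows "poisson_integral \<mu> w z \<ge> 0"
  unfolding poisson_integral_def using assms by (simp add: poisson_nonneg)

lemma norm_poisson_integral_le:
  fixes w :: "complex \<Rightarrow> 'a::{banach, second_countable_topology}"
  assumes "cmod z < 1"
  shows "norm (poisson_integral \<mu> w z) \<le> poisson_integral \<mu> (\<lambda>\<zeta>. norm (w \<zeta>)) z"
proof -
  have "norm (poisson_integral \<mu> w z) \<le> (\<integral>\<zeta>. norm (poisson z \<zeta> *\<^sub>R w \<zeta>) \<partial>\<mu>)"
    unfolding poisson_integral_def by (rule integral_norm_bound)
  also have "\<dots> = poisson_integral \<mu> (\<lambda>\<zeta>. norm (w \<zeta>)) z"
    using assms by (simp add: poisson_integral_def poisson_nonneg)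
  finally show ?thesis .
qed

lemma Re_poisson_integral:
  assumes "integrable \<mu> w" "cmod z < 1"
  shows "Re (poisson_integral \<mu> w z) = poisson_integral \<mu> (\<lambda>\<zeta>. Re (w \<zeta>)) z"
  unfolding poisson_integral_def using integral_Re[OF integrable_poisson[OF assms]] by simp

lemma poisson_integral_Complex:
  assumes "integrable \<mu> v" "integrable \<mu> w" "cmod z < 1"
  shows "poisson_integral \<mu> (\<lambda>\<zeta>. Complex (v \<zeta>) (w \<zeta>)) z = Complex (poisson_integral \<mu> v z) (poisson_integral \<mu> w z)"
proof -
  have "integrable \<mu> (\<lambda>\<zeta>. Complex (v \<zeta>) (w \<zeta>))" using assms by (simp add: Complex_eq)
  note int = integrable_poisson[OF this assms(3)]
  show ?thesis
    unfolding poisson_integral_def using integral_Re[OF int] integral_Im[OF int] by (simp add: complex_eq_iff)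
qed

end

lemma poisson_integral_density:
  fixes w :: "complex \<Rightarrow> 'a::{banach, second_countable_topology}"
  assumes "g \<in> borel_measurable \<mu>" "w \<in> borel_measurable \<mu>" "sets \<mu> = sets borel" "AE \<zeta> in \<mu>. g \<zeta> \<ge> 0"
  shows "poisson_integral (density \<mu> g) w z = poisson_integral \<mu> (\<lambda>\<zeta>. g \<zeta> *\<^sub>R w \<zeta>) z"
proof -
  have [measurable_cong]: "sets \<mu> = sets borel" by fact
  have [measurable]: "w \<in> borel_measurable \<mu>" by fact
  show ?thesis unfolding poisson_integral_def
    using assms by (subst integral_density) (auto simp: mult.commute)
qed

section \<open>Poisson's formula\<close>

lemma cauchy_formula_circle_meas:
  assumes f: "f holomorphic_on ball 0 R" "R > 1" and z: "cmod z < 1"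
  shows "(LINT \<zeta>:sphere 0 1|circle_meas. \<zeta> / (\<zeta> - z) * f \<zeta>) = f z"
proof -
  have cont_f: "continuous_on (ball 0 R) f" using f holomorphic_on_imp_continuous_on by blast
  define F where "F = (\<lambda>\<zeta>. \<zeta> / (\<zeta> - z) * f \<zeta>)"
  have cont_F: "continuous_on (sphere 0 1) F" unfolding F_def
    by (intro continuous_intros continuous_on_subset[OF cont_f]) (use f z in auto)
  have "((\<lambda>\<zeta>. f \<zeta> / (\<zeta> - z)) has_contour_integral 2 * of_real pi * \<i> * f z) (circlepath 0 1)"
    by (rule Cauchy_integral_circlepath)
       (use f z in \<open>auto intro: continuous_on_subset[OF cont_f] holomorphic_on_subset[of f "ball 0 R"]\<close>)
  then have "((\<lambda>t. f (cis t) / (cis t - z) * \<i> * cis t) has_integral 2 * of_real pi * \<i> * f z) {0..2*pi}"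
    unfolding circlepath_def by (subst (asm) has_contour_integral_part_circlepath_iff) auto
  then have "((\<lambda>t. f (cis t) / (cis t - z) * \<i> * cis t * (-\<i>)) has_integral 2 * of_real pi * \<i> * f z * (-\<i>)) {0..2*pi}"
    by (rule has_integral_mult_left)
  then have "((\<lambda>t. F (cis t)) has_integral (2*pi) *\<^sub>R f z) {0..2*pi}"
    by (simp add: F_def scaleR_conv_of_real algebra_simps)
  from has_integral_unique[OF has_integral_circle_meas[OF cont_F] this]
  show ?thesis by (simp add: F_def)
qed

lemma poisson_eq_cauchy_kernels:
  assumes "cmod \<zeta> = 1" "cmod z < 1"
  shows "of_real (poisson z \<zeta>) = \<zeta> / (\<zeta> - z) + cnj z * \<zeta> / (1 - cnj z * \<zeta>)"
proof -
  have nz: "\<zeta> \<noteq> 0" "\<zeta> - z \<noteq> 0" using assms by auto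
  have "\<zeta> * cnj \<zeta> = 1" using assms complex_norm_square[of \<zeta>] by simp
  then have "1 - cnj z * \<zeta> = \<zeta> * cnj (\<zeta> - z)" by (simp add: algebra_simps)
  then have "cnj z * \<zeta> / (1 - cnj z * \<zeta>) = cnj z / cnj (\<zeta> - z)"
    using nz by simp
  moreover have "\<zeta> / (\<zeta> - z) + cnj z / cnj (\<zeta> - z) =
      (\<zeta> * cnj (\<zeta> - z) + cnj z * (\<zeta> - z)) / ((\<zeta> - z) * cnj (\<zeta> - z))"
    using nz by (simp add: field_simps)
  moreover have "\<zeta> * cnj (\<zeta> - z) + cnj z * (\<zeta> - z) = of_real (1 - (cmod z)\<^sup>2)"
    using assms complex_norm_square[of \<zeta>] complex_norm_square[of z] by (simp add: algebra_simps)
  moreover have "(\<zeta> - z) * cnj (\<zeta> - z) = of_real ((cmod (\<zeta> - z))\<^sup>2)"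
    by (metis complex_norm_square of_real_power)
  ultimately show ?thesis by (simp add: poisson_def)
qed

lemma one_minus_cnj_mult_neq_0:
  assumes "cmod a * cmod z < 1" shows "1 - cnj a * z \<noteq> 0"
proof
  assume "1 - cnj a * z = 0"
  then have "cmod (cnj a * z) = 1" by (metis eq_iff_diff_eq_0 norm_one)
  with assms show False by (simp add: norm_mult)
qed

theorem poisson_formula:
  assumes f: "f holomorphic_on ball 0 R" "R > 1" and z: "cmod z < 1"
  shows "(LINT \<zeta>:sphere 0 1|circle_meas. poisson z \<zeta> *\<^sub>R f \<zeta>) = f z"
proof -
  define R' where "R' = (if z = 0 then R else min R (1 / cmod z))"
  have R': "R' > 1" "R' \<le> R" using f z by (auto simp: R'_def field_simps)
  have nz: "1 - cnj z * \<zeta> \<noteq> 0" if "\<zeta> \<in> ball 0 R'" for \<zeta>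
    by (rule one_minus_cnj_mult_neq_0) (use that in \<open>auto simp: R'_def field_simps split: if_splits\<close>)
  define g where "g = (\<lambda>\<zeta>. cnj z * \<zeta> / (1 - cnj z * \<zeta>) * f \<zeta>)"
  have g: "g holomorphic_on ball 0 R'" unfolding g_def
    by (intro holomorphic_intros holomorphic_on_subset[OF f(1)]) (use nz R' in auto)
  have cont_g: "continuous_on (sphere 0 1) g"
    by (rule continuous_on_subset[OF holomorphic_on_imp_continuous_on[OF g]]) (use R' in auto)
  have cont_cauchy: "continuous_on (sphere 0 1) (\<lambda>\<zeta>. \<zeta> / (\<zeta> - z) * f \<zeta>)"
    by (intro continuous_intros continuous_on_subset[OF holomorphic_on_imp_continuous_on[OF f(1)]])
       (use f z in auto)
  have "(LINT \<zeta>:sphere 0 1|circle_meas. poisson z \<zeta> *\<^sub>R f \<zeta>) =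
      (LINT \<zeta>:sphere 0 1|circle_meas. \<zeta> / (\<zeta> - z) * f \<zeta> + g \<zeta>)"
    by (intro set_lebesgue_integral_cong)
       (auto simp: g_def poisson_eq_cauchy_kernels[OF _ z] scaleR_conv_of_real ring_distribs)
  also have "\<dots> = (LINT \<zeta>:sphere 0 1|circle_meas. \<zeta> / (\<zeta> - z) * f \<zeta>) + (LINT \<zeta>:sphere 0 1|circle_meas. g \<zeta>)"
    by (intro set_integral_add set_integrable_circle_continuous cont_g cont_cauchy)
  also have "(LINT \<zeta>:sphere 0 1|circle_meas. \<zeta> / (\<zeta> - z) * f \<zeta>) = f z"
    by (rule cauchy_formula_circle_meas[OF f z])
  also have "(LINT \<zeta>:sphere 0 1|circle_meas. g \<zeta>) = (LINT \<zeta>:sphere 0 1|circle_meas. \<zeta> / (\<zeta> - 0) * g \<zeta>)"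
    by (intro set_lebesgue_integral_cong) auto
  also have "\<dots> = 0"
    using cauchy_formula_circle_meas[OF g R'(1), of 0] by (simp add: g_def)
  finally show ?thesis by simp
qed

lemma integral_poisson:
  assumes "cmod z < 1" shows "(\<integral>\<zeta>. poisson z \<zeta> \<partial>circle_meas) = 1"
proof -
  have "complex_of_real (\<integral>\<zeta>. poisson z \<zeta> \<partial>circle_meas) =
      (\<integral>\<zeta>. complex_of_real (poisson z \<zeta>) \<partial>circle_meas)"
    by (rule integral_complex_of_real[symmetric])
  also have "\<dots> = (LINT \<zeta>:sphere 0 1|circle_meas. poisson z \<zeta> *\<^sub>R (1::complex))"
    unfolding set_lebesgue_integral_def
    by (rule integral_cong_AE, measurable)
       (use AE_circle_meas_norm in \<open>auto elim!: eventually_mono simp: scaleR_conv_of_real\<close>)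
  also have "\<dots> = 1"
    by (rule poisson_formula[of _ 2]) (use assms in auto)
  finally show ?thesis by (metis of_real_eq_1_iff)
qed

lemma poisson_integral_const [simp]:
  "cmod z < 1 \<Longrightarrow> poisson_integral circle_meas (\<lambda>_. c) z = c"
  using circle_meas.integrable_poisson_kernel[of z] by (simp add: poisson_integral_def integral_poisson)

lemma norm_poisson_integral_le_const:
  fixes w :: "complex \<Rightarrow> 'a::{banach, second_countable_topology}"
  assumes w: "integrable circle_meas w" and C: "AE \<zeta> in circle_meas. norm (w \<zeta>) \<le> C" and z: "cmod z < 1"
  shows "norm (poisson_integral circle_meas w z) \<le> C"
proof -
  have "norm (poisson_integral circle_meas w z) \<le> poisson_integral circle_meas (\<lambda>\<zeta>. norm (w \<zeta>)) z"
    by (rule circle_meas.norm_poisson_integral_le[OF z])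
  also have "\<dots> \<le> poisson_integral circle_meas (\<lambda>_. C) z"
    using w C z by (intro circle_meas.poisson_integral_mono) auto
  finally show ?thesis using z by simp
qed

section \<open>Boundary behaviour of Poisson integrals\<close>

lemma poisson_integral_ge_near:
  fixes g :: "complex \<Rightarrow> real"
  assumes g: "integrable circle_meas g" and d: "d > 0"
    and low: "AE \<zeta> in circle_meas. dist \<zeta> \<zeta>\<^sub>0 < d \<longrightarrow> c \<le> g \<zeta>"
    and z: "cmod z < 1" "dist z \<zeta>\<^sub>0 \<le> d / 2"
  shows "poisson_integral circle_meas g z \<ge> c - (1 - (cmod z)\<^sup>2) / (d / 2)\<^sup>2 * (\<integral>\<zeta>. \<bar>g \<zeta> - c\<bar> \<partial>circle_meas)"
proof -
  define e where "e = (1 - (cmod z)\<^sup>2) / (d / 2)\<^sup>2"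
  have "e \<ge> 0" unfolding e_def using z by (intro divide_nonneg_nonneg) (auto simp: power_le_one)
  have int: "integrable circle_meas (\<lambda>\<zeta>. poisson z \<zeta> * (g \<zeta> - c))"
    using circle_meas.integrable_poisson[of "\<lambda>\<zeta>. g \<zeta> - c" z] g z by simp
  have "- (e * (\<integral>\<zeta>. \<bar>g \<zeta> - c\<bar> \<partial>circle_meas)) = (\<integral>\<zeta>. - (e * \<bar>g \<zeta> - c\<bar>) \<partial>circle_meas)" by simp
  also have "\<dots> \<le> (\<integral>\<zeta>. poisson z \<zeta> * (g \<zeta> - c) \<partial>circle_meas)"
  proof (rule integral_mono_AE)
    show "AE \<zeta> in circle_meas. - (e * \<bar>g \<zeta> - c\<bar>) \<le> poisson z \<zeta> * (g \<zeta> - c)"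
      using low
    proof eventually_elim
      case (elim \<zeta>)
      have nonneg: "poisson z \<zeta> \<ge> 0" using poisson_nonneg z by simp
      show ?case
      proof (cases "dist \<zeta> \<zeta>\<^sub>0 < d")
        case True
        then have "0 \<le> poisson z \<zeta> * (g \<zeta> - c)" using elim nonneg by simp
        then show ?thesis using \<open>e \<ge> 0\<close> by (meson abs_ge_zero mult_nonneg_nonneg neg_le_0_iff_le order_trans)
      next
        case False
        then have "d / 2 \<le> dist \<zeta> z" using z dist_triangle[of \<zeta> \<zeta>\<^sub>0 z] by simp
        then have "poisson z \<zeta> \<le> e" unfolding e_def using d z by (intro poisson_le_far) auto
        then have "poisson z \<zeta> * \<bar>g \<zeta> - c\<bar> \<le> e * \<bar>g \<zeta> - c\<bar>" by (intro mult_right_mono) auto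
        moreover have "- (poisson z \<zeta> * \<bar>g \<zeta> - c\<bar>) \<le> poisson z \<zeta> * (g \<zeta> - c)"
          unfolding mult_minus_right[symmetric] using nonneg by (intro mult_left_mono) auto
        ultimately show ?thesis by linarith
      qed
    qed
  qed (use g int in auto)
  also have "\<dots> = poisson_integral circle_meas g z - c"
    using circle_meas.poisson_integral_diff[OF g, of "\<lambda>_. c" z] z(1)
    by (simp only: poisson_integral_const circle_meas.integrable_const) (simp add: poisson_integral_def)
  finally show ?thesis unfolding e_def by linarith
qed

lemma eventually_poisson_integral_gt:
  fixes g :: "complex \<Rightarrow> real"
  assumes g: "integrable circle_meas g" and d: "d > 0" and \<zeta>\<^sub>0: "cmod \<zeta>\<^sub>0 = 1"
    and low: "AE \<zeta> in circle_meas. dist \<zeta> \<zeta>\<^sub>0 < d \<longrightarrow> c \<le> g \<zeta>" and c': "c' < c"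
  shows "eventually (\<lambda>z. c' < poisson_integral circle_meas g z) (at \<zeta>\<^sub>0 within ball 0 1)"
proof -
  define low_bound where
    "low_bound z = c - (1 - (cmod z)\<^sup>2) / (d / 2)\<^sup>2 * (\<integral>\<zeta>. \<bar>g \<zeta> - c\<bar> \<partial>circle_meas)" for z
  have "(low_bound \<longlongrightarrow> low_bound \<zeta>\<^sub>0) (at \<zeta>\<^sub>0 within ball 0 1)"
    unfolding low_bound_def using d by (intro tendsto_intros) auto
  then have "eventually (\<lambda>z. c' < low_bound z) (at \<zeta>\<^sub>0 within ball 0 1)"
    by (rule order_tendstoD(1)) (use \<zeta>\<^sub>0 c' in \<open>simp add: low_bound_def\<close>)
  moreover have "eventually (\<lambda>z. dist z \<zeta>\<^sub>0 \<le> d / 2) (at \<zeta>\<^sub>0 within ball 0 1)"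
    unfolding eventually_at using d by (intro exI[of _ "d/2"]) auto
  moreover have "eventually (\<lambda>z. z \<in> ball 0 1) (at \<zeta>\<^sub>0 within ball 0 1)"
    by (simp add: eventually_at_filter)
  ultimately show ?thesis
  proof eventually_elim
    case (elim z)
    then show ?case using poisson_integral_ge_near[OF g d low, of z] by (simp add: low_bound_def)
  qed
qed

lemma poisson_integral_tendsto:
  fixes g :: "complex \<Rightarrow> real"
  assumes g: "integrable circle_meas g" and \<zeta>\<^sub>0: "cmod \<zeta>\<^sub>0 = 1" and cont: "isCont g \<zeta>\<^sub>0"
  shows "(poisson_integral circle_meas g \<longlongrightarrow> g \<zeta>\<^sub>0) (at \<zeta>\<^sub>0 within ball 0 1)"
proof -
  have gt: "eventually (\<lambda>z. a < poisson_integral circle_meas f z) (at \<zeta>\<^sub>0 within ball 0 1)"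
    if f: "integrable circle_meas f" "isCont f \<zeta>\<^sub>0" and a: "a < f \<zeta>\<^sub>0" for f :: "complex \<Rightarrow> real" and a
  proof -
    obtain b where b: "a < b" "b < f \<zeta>\<^sub>0" using a dense by blast
    then have "eventually (\<lambda>\<zeta>. b < f \<zeta>) (nhds \<zeta>\<^sub>0)"
      using order_tendstoD(1) f(2) continuous_at by (metis eventually_nhds_conv_at)
    then obtain d where d: "d > 0" "\<And>\<zeta>. dist \<zeta> \<zeta>\<^sub>0 < d \<Longrightarrow> b < f \<zeta>" by (auto simp: eventually_nhds_metric)
    then have "AE \<zeta> in circle_meas. dist \<zeta> \<zeta>\<^sub>0 < d \<longrightarrow> b \<le> f \<zeta>" by (intro AE_I2) (auto simp: less_imp_le)
    from eventually_poisson_integral_gt[OF f(1) d(1) \<zeta>\<^sub>0 this b(1)] show ?thesis .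
  qed
  show ?thesis
  proof (rule order_tendstoI)
    show "eventually (\<lambda>z. a < poisson_integral circle_meas g z) (at \<zeta>\<^sub>0 within ball 0 1)" if "a < g \<zeta>\<^sub>0" for a
      by (rule gt[OF g cont that])
    show "eventually (\<lambda>z. poisson_integral circle_meas g z < a) (at \<zeta>\<^sub>0 within ball 0 1)" if "g \<zeta>\<^sub>0 < a" for a
      using gt[of "\<lambda>\<zeta>. - g \<zeta>" "-a"] g cont that by (simp add: poisson_integral_def)
  qed
qed

abbreviation radial_limit :: "(complex \<Rightarrow> 'a::topological_space) \<Rightarrow> complex \<Rightarrow> 'a \<Rightarrow> bool" where
  "radial_limit f \<zeta> L \<equiv> ((\<lambda>r::real. f (of_real r * \<zeta>)) \<longlongrightarrow> L) (at_left 1)"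

lemma eventually_radius_in_disc:
  assumes "cmod \<zeta> = 1" shows "eventually (\<lambda>r. of_real r * \<zeta> \<in> ball 0 1) (at_left (1::real))"
proof -
  have "eventually (\<lambda>r. r \<in> {0<..<1}) (at_left (1::real))" by (rule eventually_at_left_real) simp
  then show ?thesis by eventually_elim (use assms in \<open>auto simp: norm_mult\<close>)
qed

lemma radial_limit_cong:
  assumes "cmod \<zeta> = 1" "\<And>z. z \<in> ball 0 1 \<Longrightarrow> f z = g z"
  shows "radial_limit f \<zeta> L \<longleftrightarrow> radial_limit g \<zeta> L"
  by (rule tendsto_cong) (use eventually_radius_in_disc[OF assms(1)] assms(2) in \<open>auto elim: eventually_mono\<close>)

lemma radial_limit_le:
  fixes f g :: "complex \<Rightarrow> real"
  assumes "radial_limit f \<zeta> L" "radial_limit g \<zeta> M" "cmod \<zeta> = 1" "\<And>z. z \<in> ball 0 1 \<Longrightarrow> f z \<le> g z"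
  shows "L \<le> M"
proof (rule tendsto_le[OF _ assms(2,1)])
  show "eventually (\<lambda>r. f (of_real r * \<zeta>) \<le> g (of_real r * \<zeta>)) (at_left 1)"
    using eventually_radius_in_disc[OF assms(3)] by eventually_elim (rule assms(4))
qed simp

lemma filterlim_radius:
  assumes "cmod \<zeta> = 1"
  shows "filterlim (\<lambda>r. of_real r * \<zeta>) (at \<zeta> within ball 0 1) (at_left (1::real))"
proof -
  have "radial_limit (\<lambda>z. z) \<zeta> (of_real 1 * \<zeta>)" by (intro tendsto_intros)
  moreover have "eventually (\<lambda>r. of_real r * \<zeta> \<in> ball 0 1 \<and> of_real r * \<zeta> \<noteq> \<zeta>) (at_left (1::real))"
    using eventually_radius_in_disc[OF assms] by eventually_elim (use assms in auto)
  ultimately show ?thesis by (auto simp: filterlim_at elim: eventually_mono)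
qed

lemma isCont_radial_limit:
  assumes "isCont f \<zeta>" shows "radial_limit f \<zeta> (f \<zeta>)"
proof -
  have "radial_limit (\<lambda>z. z) \<zeta> (of_real 1 * \<zeta>)" by (intro tendsto_intros)
  then show ?thesis using isCont_tendsto_compose[OF assms] by simp
qed

lemma poisson_integral_radial_limit_continuous:
  fixes g :: "complex \<Rightarrow> real"
  assumes "integrable circle_meas g" "cmod \<zeta> = 1" "isCont g \<zeta>"
  shows "radial_limit (poisson_integral circle_meas g) \<zeta> (g \<zeta>)"
  by (rule filterlim_compose[OF poisson_integral_tendsto[OF assms] filterlim_radius[OF assms(2)]])

lemma circle_meas_full_support:
  assumes "cmod \<zeta>\<^sub>0 = 1" "d > 0"
  shows "\<not> (AE \<zeta> in circle_meas. d \<le> dist \<zeta> \<zeta>\<^sub>0)"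
proof
  assume "AE \<zeta> in circle_meas. d \<le> dist \<zeta> \<zeta>\<^sub>0"
  then have far: "AE \<zeta> in circle_meas. dist \<zeta> \<zeta>\<^sub>0 < d \<longrightarrow> 1 \<le> (0::real)" by eventually_elim simp
  have "eventually (\<lambda>z. False) (at \<zeta>\<^sub>0 within ball 0 1)"
    using eventually_poisson_integral_gt[OF integrable_zero assms(2,1) far, of 0] by (simp add: poisson_integral_def)
  then have "eventually (\<lambda>r::real. False) (at_left 1)"
    by (rule eventually_compose_filterlim[OF _ filterlim_radius[OF assms(1)]])
  then show False by simp
qed

lemma circle_AE_le_imp_le:
  fixes h :: "complex \<Rightarrow> real"
  assumes h: "continuous_on (sphere 0 1) h" and le: "AE \<zeta> in circle_meas. h \<zeta> \<le> C" and \<zeta>\<^sub>0: "\<zeta>\<^sub>0 \<in> sphere 0 1"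
  shows "h \<zeta>\<^sub>0 \<le> C"
proof (rule ccontr)
  assume "\<not> ?thesis"
  then have "h \<zeta>\<^sub>0 - C > 0" by simp
  then obtain d where d: "d > 0" "\<And>\<zeta>. \<zeta> \<in> sphere 0 1 \<Longrightarrow> dist \<zeta> \<zeta>\<^sub>0 < d \<Longrightarrow> dist (h \<zeta>) (h \<zeta>\<^sub>0) < h \<zeta>\<^sub>0 - C"
    using h \<zeta>\<^sub>0 unfolding continuous_on_iff by blast
  have "AE \<zeta> in circle_meas. d \<le> dist \<zeta> \<zeta>\<^sub>0"
    using le AE_circle_meas_sphere
  proof eventually_elim
    case (elim \<zeta>)
    then show ?case using d(2)[of \<zeta>] by (force simp: dist_real_def)
  qed
  then show False using circle_meas_full_support[of \<zeta>\<^sub>0 d] \<zeta>\<^sub>0 d by simp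
qed

section \<open>The radial maximal function\<close>

lemma norm_diff_radius:
  assumes "cmod \<zeta> = 1" "r \<le> 1" shows "cmod (\<zeta> - of_real r * \<zeta>) = 1 - r"
proof -
  have "\<zeta> - of_real r * \<zeta> = of_real (1 - r) * \<zeta>" by (simp add: algebra_simps)
  then show ?thesis using assms by (simp only: norm_mult norm_of_real) simp
qed

lemma measure_circle_ball_le:
  assumes \<zeta>: "cmod \<zeta> = 1" and s: "s > 0"
  shows "measure circle_meas (ball \<zeta> s) \<le> 4 * s"
proof (cases "s < 1")
  case False
  then show ?thesis using circle_meas.prob_le_1[of "ball \<zeta> s"] by linarith
next
  case True
  define z where "z = of_real (1 - s) * \<zeta>"
  have norm_z: "cmod z = 1 - s" using True assms by (simp only: z_def norm_mult norm_of_real) simp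
  have low: "1 / (4 * s) \<le> poisson z \<xi>" if "\<xi> \<in> ball \<zeta> s" "cmod \<xi> = 1" for \<xi>
  proof -
    have "cmod (\<zeta> - z) = s" unfolding z_def using norm_diff_radius[of \<zeta> "1 - s"] assms by simp
    then have "cmod (\<xi> - z) \<le> 2 * s"
      using that norm_triangle_ineq[of "\<xi> - \<zeta>" "\<zeta> - z"] by (simp add: dist_norm norm_minus_commute)
    moreover have "0 < cmod (\<xi> - z)" using norm_diff_ge[of \<xi> z] that norm_z s by linarith
    moreover have "s \<le> 1 - (cmod z)\<^sup>2" unfolding norm_z using True s
      by (simp add: power2_eq_square algebra_simps)
    ultimately have "s / (2 * s)\<^sup>2 \<le> poisson z \<xi>"
      unfolding poisson_def using s by (intro frac_le power_mono) auto
    then show ?thesis using s by (simp add: power2_eq_square field_simps)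
  qed
  have "measure circle_meas (ball \<zeta> s) * (1 / (4 * s)) = (\<integral>\<xi>. indicator (ball \<zeta> s) \<xi> * (1 / (4 * s)) \<partial>circle_meas)"
    by simp
  also have "\<dots> \<le> (\<integral>\<xi>. poisson z \<xi> \<partial>circle_meas)"
  proof (rule integral_mono_AE)
    show "AE \<xi> in circle_meas. indicator (ball \<zeta> s) \<xi> * (1 / (4 * s)) \<le> poisson z \<xi>"
      using AE_circle_meas_norm
      by eventually_elim (use low poisson_nonneg[of z] norm_z s in \<open>auto simp: indicator_def\<close>)
    show "integrable circle_meas (\<lambda>\<xi>. indicator (ball \<zeta> s) \<xi> * (1 / (4 * s)))"
      by (intro integrable_mult_left integrable_real_indicator) (auto simp: circle_meas.emeasure_eq_measure)
  qed (use circle_meas.integrable_poisson_kernel[of z] norm_z s in auto)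
  also have "\<dots> = 1" using norm_z s by (intro integral_poisson) auto
  finally show ?thesis using s by (simp add: field_simps)
qed

lemma measure_UN_le_if_finite_UN_le:
  fixes \<mu> :: "'a::{second_countable_topology, complete_space} measure"
  assumes "finite_measure \<mu>" and sets: "sets \<mu> = sets borel" and U: "\<And>i. i \<in> C \<Longrightarrow> open (U i)"
    and le: "\<And>F. finite F \<Longrightarrow> F \<subseteq> C \<Longrightarrow> measure \<mu> (\<Union>i\<in>F. U i) \<le> L"
  shows "measure \<mu> (\<Union>i\<in>C. U i) \<le> L"
proof -
  interpret finite_measure \<mu> by fact
  note [simp] = sets
  have "open (\<Union>i\<in>C. U i)" using U by auto
  then have "emeasure \<mu> (\<Union>i\<in>C. U i) = (SUP A\<in>{A. A \<subseteq> (\<Union>i\<in>C. U i) \<and> compact A}. emeasure \<mu> A)"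
    by (intro inner_regular) auto
  also have "\<dots> \<le> ennreal L"
  proof (rule SUP_least)
    fix A assume "A \<in> {A. A \<subseteq> (\<Union>i\<in>C. U i) \<and> compact A}"
    then obtain F where F: "F \<subseteq> C" "finite F" "A \<subseteq> (\<Union>i\<in>F. U i)"
      using compactE_image[of A C U] U by auto
    then have "open (\<Union>i\<in>F. U i)" using U by auto
    then have "measure \<mu> A \<le> measure \<mu> (\<Union>i\<in>F. U i)"
      using F(3) by (intro finite_measure_mono) auto
    also have "\<dots> \<le> L" by (rule le[OF F(2,1)])
    finally show "emeasure \<mu> A \<le> ennreal L" by (simp add: emeasure_eq_measure ennreal_leI)
  qed
  finally show ?thesis using le[of "{}"] by (simp add: emeasure_eq_measure ennreal_le_iff)
qed

lemma Vitali_cover_measure_le: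
  fixes \<mu> \<nu> :: "'a::euclidean_space measure"
  assumes fin: "finite_measure \<mu>" "finite_measure \<nu>" and sets: "sets \<mu> = sets borel" "sets \<nu> = sets borel"
    and radius: "\<And>x r. (x, r) \<in> K \<Longrightarrow> 0 < r \<and> r \<le> B"
    and le: "\<And>x r. (x, r) \<in> K \<Longrightarrow> measure \<mu> (ball x (5 * r)) \<le> c * measure \<nu> (ball x r)" and c: "c \<ge> 0"
  obtains W where "open W" "(\<Union>(x, r)\<in>K. ball x r) \<subseteq> W" "measure \<mu> W \<le> c * measure \<nu> UNIV"
proof -
  interpret \<nu>: finite_measure \<nu> by fact
  note [simp] = sets
  have [simp]: "space \<nu> = UNIV" using sets_eq_imp_space_eq[OF sets(2)] by simp
  obtain C where C: "countable C" "C \<subseteq> K"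
     "pairwise (\<lambda>i j. disjnt (ball (fst i) (snd i)) (ball (fst j) (snd j))) C"
     "(\<Union>(x, r)\<in>K. ball x r) \<subseteq> (\<Union>i\<in>C. ball (fst i) (5 * snd i))"
    by (rule Vitali_covering_lemma_balls[of "\<Union>(x, r)\<in>K. ball x r" fst snd K B]) (use radius in auto)
  have finite_le: "measure \<mu> (\<Union>i\<in>F. ball (fst i) (5 * snd i)) \<le> c * measure \<nu> UNIV" if F: "finite F" "F \<subseteq> C" for F
  proof -
    have "measure \<mu> (\<Union>i\<in>F. ball (fst i) (5 * snd i)) \<le> (\<Sum>i\<in>F. measure \<mu> (ball (fst i) (5 * snd i)))"
      using F by (intro measure_UNION_le) auto
    also have "\<dots> \<le> (\<Sum>i\<in>F. c * measure \<nu> (ball (fst i) (snd i)))"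
      using F C(2) by (intro sum_mono le) auto
    also have "\<dots> = c * (\<Sum>i\<in>F. measure \<nu> (ball (fst i) (snd i)))"
      by (simp add: sum_distrib_left)
    also have "(\<Sum>i\<in>F. measure \<nu> (ball (fst i) (snd i))) = measure \<nu> (\<Union>i\<in>F. ball (fst i) (snd i))"
    proof (rule \<nu>.finite_measure_finite_Union[symmetric])
      show "disjoint_family_on (\<lambda>i. ball (fst i) (snd i)) F"
        using C(3) F(2) unfolding disjoint_family_on_def pairwise_def disjnt_def by blast
    qed (use F in auto)
    also have "c * \<dots> \<le> c * measure \<nu> UNIV"
      using \<nu>.bounded_measure by (intro mult_left_mono c) simp
    finally show ?thesis .
  qed
  show thesis
  proof (rule that[OF _ C(4)])
    show "measure \<mu> (\<Union>i\<in>C. ball (fst i) (5 * snd i)) \<le> c * measure \<nu> UNIV"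
      by (rule measure_UN_le_if_finite_UN_le[OF fin(1) sets(1) open_ball finite_le])
  qed (simp add: open_UN)
qed

lemma poisson_radius_le:
  assumes \<zeta>: "cmod \<zeta> = 1" "cmod \<xi> = 1" "\<zeta> \<noteq> \<xi>" and r: "0 \<le> r" "r < 1"
  shows "poisson (of_real r * \<zeta>) \<xi> \<le> 8 * (1 - r) / (dist \<zeta> \<xi>)\<^sup>2"
proof -
  have norm_r: "cmod (of_real r * \<zeta>) = r" using r \<zeta> by (simp add: norm_mult)
  have "cmod (\<zeta> - of_real r * \<zeta>) \<le> cmod (\<xi> - of_real r * \<zeta>)"
    using norm_diff_radius[OF \<zeta>(1)] norm_diff_ge[OF \<zeta>(2), of "of_real r * \<zeta>"] r norm_r by simp
  then have "dist \<zeta> \<xi> / 2 \<le> cmod (\<xi> - of_real r * \<zeta>)"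
    using norm_triangle_ineq4[of "\<zeta> - of_real r * \<zeta>" "\<xi> - of_real r * \<zeta>"] by (simp add: dist_norm)
  then have "poisson (of_real r * \<zeta>) \<xi> \<le> (1 - (cmod (of_real r * \<zeta>))\<^sup>2) / (dist \<zeta> \<xi> / 2)\<^sup>2"
    using r norm_r \<zeta> by (intro poisson_le_far) (auto simp: dist_norm norm_minus_commute)
  also have "\<dots> \<le> 2 * (1 - r) / (dist \<zeta> \<xi> / 2)\<^sup>2"
    using one_minus_norm_sq_le[of "of_real r * \<zeta>"] unfolding norm_r by (intro divide_right_mono) auto
  finally show ?thesis by (simp add: power_divide)
qed

lemma poisson_le_dyadic_sum:
  assumes \<zeta>: "cmod \<zeta> = 1" "cmod \<xi> = 1" and r: "0 \<le> r" "r < 1" and n: "2 < 2 ^ n * (1 - r)"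
  shows "poisson (of_real r * \<zeta>) \<xi> \<le> (\<Sum>k\<le>n. 32 / (4 ^ k * (1 - r)) * indicator (ball \<zeta> (2 ^ k * (1 - r))) \<xi>)"
    (is "_ \<le> sum ?t _")
proof -
  define k where "k = (LEAST k. dist \<zeta> \<xi> < 2 ^ k * (1 - r))"
  have "dist \<zeta> \<xi> \<le> 2" using norm_triangle_ineq4[of \<zeta> \<xi>] \<zeta> by (simp add: dist_norm)
  then have "dist \<zeta> \<xi> < 2 ^ n * (1 - r)" using n by simp
  then have k: "dist \<zeta> \<xi> < 2 ^ k * (1 - r)" "k \<le> n" unfolding k_def by (rule LeastI, rule Least_le)
  have "poisson (of_real r * \<zeta>) \<xi> \<le> 32 / (4 ^ k * (1 - r))"
  proof (cases k)
    case 0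
    have "poisson (of_real r * \<zeta>) \<xi> \<le> 2 / (1 - r)"
      using poisson_le[of \<xi> "of_real r * \<zeta>"] \<zeta> r by (simp add: norm_mult)
    also have "\<dots> \<le> 32 / (1 - r)" using r by (simp add: divide_right_mono)
    finally show ?thesis using 0 by simp
  next
    case (Suc j)
    then have far: "2 ^ j * (1 - r) \<le> dist \<zeta> \<xi>" unfolding k_def by (metis lessI not_less_Least not_less)
    moreover have pos: "0 < 2 ^ j * (1 - r)" using r by simp
    ultimately have "\<zeta> \<noteq> \<xi>" by auto
    then have "poisson (of_real r * \<zeta>) \<xi> \<le> 8 * (1 - r) / (dist \<zeta> \<xi>)\<^sup>2"
      by (intro poisson_radius_le \<zeta> r)
    also have "\<dots> \<le> 8 * (1 - r) / (2 ^ j * (1 - r))\<^sup>2"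
      using far pos r by (intro frac_le power_mono) auto
    also have "(2 ^ j * (1 - r))\<^sup>2 = 4 ^ j * (1 - r) * (1 - r)"
      by (simp add: power2_eq_square flip: power_mult_distrib)
    also have "8 * (1 - r) / (4 ^ j * (1 - r) * (1 - r)) = 32 / (4 ^ k * (1 - r))"
    proof -
      have "8 * \<delta> / (x * \<delta> * \<delta>) = 32 / (4 * x * \<delta>)" if "\<delta> > 0" for x \<delta> :: real
        using that by simp
      from this[of "1 - r" "4 ^ j"] show ?thesis using r by (simp add: Suc)
    qed
    finally show ?thesis .
  qed
  also have "\<dots> = ?t k" using k by (simp add: indicator_def)
  also have "\<dots> \<le> sum ?t {..n}"
    using k r by (intro member_le_sum) (auto intro!: mult_nonneg_nonneg divide_nonneg_nonneg)
  finally show ?thesis .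
qed

lemma (in circle_measure) poisson_integral_le_of_ball_measure_le:
  assumes \<zeta>: "cmod \<zeta> = 1" and r: "0 \<le> r" "r < 1"
    and ball: "\<And>s. s > 0 \<Longrightarrow> measure \<mu> (ball \<zeta> s) \<le> L * s"
  shows "poisson_integral \<mu> (\<lambda>_. 1) (of_real r * \<zeta>) \<le> 64 * L"
proof -
  have L: "L \<ge> 0" using ball[of 1] measure_nonneg[of \<mu> "ball \<zeta> 1"] by linarith
  obtain n where "2 / (1 - r) < 2 ^ n" using real_arch_pow[of 2 "2 / (1 - r)"] by auto
  then have n: "2 < 2 ^ n * (1 - r)" using r by (simp add: field_simps)
  have "poisson_integral \<mu> (\<lambda>_. 1) (of_real r * \<zeta>) = (\<integral>\<xi>. poisson (of_real r * \<zeta>) \<xi> \<partial>\<mu>)"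
    by (simp add: poisson_integral_def)
  also have "\<dots> \<le> (\<integral>\<xi>. (\<Sum>k\<le>n. 32 / (4 ^ k * (1 - r)) * indicator (ball \<zeta> (2 ^ k * (1 - r))) \<xi>) \<partial>\<mu>)"
  proof (rule integral_mono_AE)
    show "integrable \<mu> (poisson (of_real r * \<zeta>))"
      using r \<zeta> by (intro integrable_poisson_kernel) (simp add: norm_mult)
    show "AE \<xi> in \<mu>. poisson (of_real r * \<zeta>) \<xi> \<le>
        (\<Sum>k\<le>n. 32 / (4 ^ k * (1 - r)) * indicator (ball \<zeta> (2 ^ k * (1 - r))) \<xi>)"
      using AE_norm_eq_1 by eventually_elim (intro poisson_le_dyadic_sum \<zeta> r n)
  qed (auto simp: emeasure_eq_measure
      intro!: Bochner_Integration.integrable_sum integrable_mult_right integrable_real_indicator)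
  also have "\<dots> = (\<Sum>k\<le>n. 32 / (4 ^ k * (1 - r)) * measure \<mu> (ball \<zeta> (2 ^ k * (1 - r))))"
    by (subst Bochner_Integration.integral_sum)
       (auto simp: emeasure_eq_measure intro!: integrable_mult_right integrable_real_indicator)
  also have "\<dots> \<le> (\<Sum>k\<le>n. 32 / (4 ^ k * (1 - r)) * (L * (2 ^ k * (1 - r))))"
    using r by (intro sum_mono mult_left_mono ball) auto
  also have "\<dots> = (\<Sum>k\<le>n. 32 * L * (1/2) ^ k)"
  proof (rule sum.cong)
    fix k :: nat
    have "(4::real) ^ k = 2 ^ k * 2 ^ k" by (simp flip: power_mult_distrib)
    then show "32 / (4 ^ k * (1 - r)) * (L * (2 ^ k * (1 - r))) = 32 * L * (1/2) ^ k"
      using r by (simp add: field_simps)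
  qed simp
  also have "\<dots> \<le> 32 * L * (\<Sum>k. (1/2) ^ k)"
    unfolding sum_distrib_left[symmetric] using L by (intro mult_left_mono sum_le_suminf) auto
  finally show ?thesis by (simp add: suminf_geometric)
qed

text \<open>The constant is the product of the factors 4 of \<open>measure_circle_ball_le\<close>, 5 of the Vitali covering
  and 64 of the dyadic decomposition.\<close>
lemma poisson_maximal_weak_type:
  fixes g :: "complex \<Rightarrow> real"
  assumes g: "integrable circle_meas g" "\<And>\<zeta>. g \<zeta> \<ge> 0" and e: "e > 0"
  obtains W where "open W" "measure circle_meas W \<le> 1280 * (\<integral>\<zeta>. g \<zeta> \<partial>circle_meas) / e"
    "\<And>\<zeta> r. \<zeta> \<in> sphere 0 1 - W \<Longrightarrow> 0 \<le> r \<Longrightarrow> r < 1 \<Longrightarrow> poisson_integral circle_meas g (of_real r * \<zeta>) \<le> e"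
proof -
  define L where "L = e / 64"
  have L: "L > 0" using e by (simp add: L_def)
  have [measurable]: "g \<in> borel_measurable borel" using g(1) by auto
  define \<nu> where "\<nu> = density circle_meas g"
  interpret \<nu>: circle_measure \<nu> unfolding \<nu>_def by (rule circle_meas.circle_measure_density(1)[OF g])
  have total: "measure \<nu> UNIV = (\<integral>\<zeta>. g \<zeta> \<partial>circle_meas)"
    unfolding \<nu>_def by (rule circle_meas.circle_measure_density(2)[OF g])
  define K where "K = {(\<zeta>, s). cmod \<zeta> = 1 \<and> s > 0 \<and> measure \<nu> (ball \<zeta> s) > L * s}"
  obtain W where W: "open W" "(\<Union>(\<zeta>, s)\<in>K. ball \<zeta> s) \<subseteq> W" "measure circle_meas W \<le> 20 / L * measure \<nu> UNIV"
  proof (rule Vitali_cover_measure_le[of circle_meas \<nu> K "measure \<nu> UNIV / L" "20 / L"])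
    fix \<zeta> s assume K: "(\<zeta>, s) \<in> K"
    then have "L * s \<le> measure \<nu> UNIV" using \<nu>.bounded_measure[of "ball \<zeta> s"] by (auto simp: K_def)
    then show "0 < s \<and> s \<le> measure \<nu> UNIV / L" using K L by (auto simp: K_def field_simps)
    have "measure circle_meas (ball \<zeta> (5 * s)) \<le> 20 * s"
      using measure_circle_ball_le[of \<zeta> "5 * s"] K by (simp add: K_def)
    also have "\<dots> \<le> 20 / L * measure \<nu> (ball \<zeta> s)" using K L by (auto simp: K_def field_simps)
    finally show "measure circle_meas (ball \<zeta> (5 * s)) \<le> 20 / L * measure \<nu> (ball \<zeta> s)" .
  qed (use L \<nu>.finite_measure_axioms circle_meas.finite_measure_axioms in auto)
  have "poisson_integral circle_meas g (of_real r * \<zeta>) \<le> e" if \<zeta>: "\<zeta> \<in> sphere 0 1 - W" and r: "0 \<le> r" "r < 1" for \<zeta> r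
  proof -
    have "measure \<nu> (ball \<zeta> s) \<le> L * s" if s: "s > 0" for s
    proof (rule ccontr)
      assume "\<not> ?thesis"
      then have "(\<zeta>, s) \<in> K" using \<zeta> s by (simp add: K_def)
      then show False using W(2) \<zeta> s by force
    qed
    then have "poisson_integral \<nu> (\<lambda>_. 1) (of_real r * \<zeta>) \<le> 64 * L"
      using \<zeta> r by (intro \<nu>.poisson_integral_le_of_ball_measure_le) auto
    then show ?thesis unfolding \<nu>_def L_def using g by (subst (asm) poisson_integral_density) auto
  qed
  with W show thesis using total e by (intro that[of W]) (auto simp: L_def field_simps)
qed

section \<open>Fatou's theorem\<close>

lemma compact_open_continuous_indicator:
  fixes K U :: "'a::euclidean_space set"
  assumes "compact K" "open U" "K \<subseteq> U"
  obtains f :: "'a \<Rightarrow> real" where "continuous_on UNIV f" "\<And>x. f x \<in> {0..1}"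
    "\<And>x. x \<in> K \<Longrightarrow> f x = 1" "\<And>x. x \<notin> U \<Longrightarrow> f x = 0"
proof -
  obtain f :: "'a \<Rightarrow> real" where "continuous_on UNIV f" "\<And>x. f x \<in> closed_segment 1 0"
     "\<And>x. x \<in> K \<Longrightarrow> f x = 1" "\<And>x. x \<in> - U \<Longrightarrow> f x = 0"
    by (rule Urysohn[of K "- U" 1 0]) (use assms in \<open>auto intro: compact_imp_closed\<close>)
  then show thesis using that by (simp add: closed_segment_eq_real_ivl)
qed

lemma inner_compact_approx:
  fixes M :: "'a::{second_countable_topology, complete_space} measure"
  assumes "finite_measure M" and sets: "sets M = sets borel" and A: "A \<in> sets borel" and e: "e > 0"
  obtains K where "compact K" "K \<subseteq> A" "measure M (A - K) < e"
proof (cases "measure M A = 0")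
  case True
  then show thesis using that[of "{}"] e by simp
next
  case False
  interpret finite_measure M by fact
  have "ennreal (measure M A - e) < emeasure M A"
    unfolding emeasure_eq_measure using e False by (intro ennreal_lessI) (auto simp: zero_less_measure_iff)
  then obtain K where K: "K \<subseteq> A" "compact K" "ennreal (measure M A - e) < ennreal (measure M K)"
    using inner_regular[OF sets _ A] by (auto simp: less_SUP_iff emeasure_eq_measure)
  have "measure M (A - K) = measure M A - measure M K"
    using K A sets borel_compact[OF K(2)] by (intro finite_measure_Diff) auto
  then show thesis using that[of K] K ennreal_leI[of "measure M K" "measure M A - e"] by force
qed

lemma outer_open_approx:
  fixes M :: "'a::{second_countable_topology, complete_space} measure"
  assumes "finite_measure M" and sets: "sets M = sets borel" and A: "A \<in> sets borel" and e: "e > 0"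
  obtains U where "open U" "A \<subseteq> U" "measure M (U - A) < e"
proof -
  interpret finite_measure M by fact
  have "emeasure M A < emeasure M A + ennreal e"
    using e by (simp add: emeasure_eq_measure ennreal_less_iff flip: ennreal_plus)
  then obtain U where U: "A \<subseteq> U" "open U" "emeasure M U < emeasure M A + ennreal e"
    using outer_regular[OF sets _ A] by (auto simp: INF_less_iff)
  have "measure M (U - A) = measure M U - measure M A"
    using U A sets by (intro finite_measure_Diff) auto
  also have "\<dots> < e" using U(3) e by (simp add: emeasure_eq_measure ennreal_less_iff flip: ennreal_plus)
  finally show thesis using that U by blast
qed

lemma indicator_continuous_approx:
  fixes M :: "'a::euclidean_space measure"
  assumes fin: "finite_measure M" and sets: "sets M = sets borel" and A: "A \<in> sets borel" and e: "e > 0"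
  obtains f :: "'a \<Rightarrow> real" where "continuous_on UNIV f" "integrable M f" "(\<integral>x. \<bar>indicator A x - f x\<bar> \<partial>M) < e"
proof -
  interpret finite_measure M by (rule fin)
  have [measurable_cong]: "sets M = sets borel" by fact
  have "e/2 > 0" using e by simp
  obtain K where K: "compact K" "K \<subseteq> A" "measure M (A - K) < e/2"
    by (rule inner_compact_approx[OF fin sets A \<open>e/2 > 0\<close>])
  obtain U where U: "open U" "A \<subseteq> U" "measure M (U - A) < e/2"
    by (rule outer_open_approx[OF fin sets A \<open>e/2 > 0\<close>])
  obtain f :: "'a \<Rightarrow> real" where f: "continuous_on UNIV f" "\<And>x. f x \<in> {0..1}"
    "\<And>x. x \<in> K \<Longrightarrow> f x = 1" "\<And>x. x \<notin> U \<Longrightarrow> f x = 0"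
    using compact_open_continuous_indicator[of K U] K U by (metis order_trans)
  have [measurable]: "f \<in> borel_measurable borel" by (rule borel_measurable_continuous_onI[OF f(1)])
  have [measurable]: "K \<in> sets borel" "U \<in> sets borel" "A \<in> sets borel" using K U A by (auto intro: borel_compact)
  have f01: "0 \<le> f x" "f x \<le> 1" for x using f(2)[of x] by auto
  have int: "integrable M f" by (rule integrable_const_bound[where B=1]) (use f01 in auto)
  have "(\<integral>x. \<bar>indicator A x - f x\<bar> \<partial>M) \<le> (\<integral>x. indicator ((A - K) \<union> (U - A)) x \<partial>M)"
  proof (rule integral_mono)
    show "\<bar>indicator A x - f x\<bar> \<le> indicator ((A - K) \<union> (U - A)) x" for x
      using f(3,4)[of x] f01[of x] K U by (auto simp: indicator_def)
  qed (use int in \<open>auto simp: emeasure_eq_measure\<close>)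
  also have "\<dots> = measure M ((A - K) \<union> (U - A))" by simp
  also have "\<dots> \<le> measure M (A - K) + measure M (U - A)" by (intro measure_Un_le) auto
  also have "\<dots> < e" using K U by simp
  finally show thesis by (rule that[OF f(1) int])
qed

lemma integral_abs_add_le:
  fixes u v :: "'a \<Rightarrow> real"
  assumes "integrable M u" "integrable M v"
  shows "(\<integral>x. \<bar>u x + v x\<bar> \<partial>M) \<le> (\<integral>x. \<bar>u x\<bar> \<partial>M) + (\<integral>x. \<bar>v x\<bar> \<partial>M)"
proof -
  have "(\<integral>x. \<bar>u x + v x\<bar> \<partial>M) \<le> (\<integral>x. \<bar>u x\<bar> + \<bar>v x\<bar> \<partial>M)"
    using assms by (intro integral_mono) auto
  then show ?thesis using assms by simp
qed

lemma integral_abs_diff_tendsto_0: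
  fixes u :: "'a \<Rightarrow> real"
  assumes "integrable M u" "\<And>i. integrable M (s i)" "\<And>x. x \<in> space M \<Longrightarrow> (\<lambda>i. s i x) \<longlonglongrightarrow> u x"
    and "\<And>i x. x \<in> space M \<Longrightarrow> \<bar>s i x\<bar> \<le> 2 * \<bar>u x\<bar>"
  shows "(\<lambda>i. \<integral>x. \<bar>u x - s i x\<bar> \<partial>M) \<longlonglongrightarrow> 0"
proof -
  have "(\<lambda>i. \<integral>x. \<bar>u x - s i x\<bar> \<partial>M) \<longlonglongrightarrow> (\<integral>x. 0 \<partial>M)"
  proof (rule integral_dominated_convergence[where w="\<lambda>x. 3 * \<bar>u x\<bar>"])
    have "(\<lambda>i. u x - s i x) \<longlonglongrightarrow> 0" if "x \<in> space M" for x
      using tendsto_diff[OF tendsto_const assms(3)[OF that], of "u x"] by simp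
    then show "AE x in M. (\<lambda>i. \<bar>u x - s i x\<bar>) \<longlonglongrightarrow> 0"
      by (intro AE_I2 tendsto_rabs_zero)
    show "AE x in M. norm \<bar>u x - s i x\<bar> \<le> 3 * \<bar>u x\<bar>" for i
      by (rule AE_I2) (use assms(4)[of _ i] in \<open>fastforce simp: abs_le_iff\<close>)
  qed (use assms in auto)
  then show ?thesis by simp
qed

lemma integrable_continuous_approx:
  fixes M :: "'a::euclidean_space measure" and g :: "'a \<Rightarrow> real"
  assumes fin: "finite_measure M" and sets: "sets M = sets borel" and "integrable M g" "e > 0"
  shows "\<exists>f. continuous_on UNIV f \<and> integrable M f \<and> (\<integral>x. \<bar>g x - f x\<bar> \<partial>M) < e"
  using assms(3,4)
proof (induction arbitrary: e rule: integrable_induct)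
  case (base A a)
  have "e / (\<bar>a\<bar> + 1) > 0" using base by simp
  then obtain f :: "'a \<Rightarrow> real"
    where f: "continuous_on UNIV f" "integrable M f" "(\<integral>x. \<bar>indicator A x - f x\<bar> \<partial>M) < e / (\<bar>a\<bar> + 1)"
    using indicator_continuous_approx[OF fin sets, of A] base(1) sets by metis
  have "(\<integral>x. \<bar>indicator A x *\<^sub>R a - a * f x\<bar> \<partial>M) = \<bar>a\<bar> * (\<integral>x. \<bar>indicator A x - f x\<bar> \<partial>M)"
    by (simp add: abs_mult[symmetric] algebra_simps flip: integral_mult_right_zero)
  also have "\<dots> \<le> \<bar>a\<bar> * (e / (\<bar>a\<bar> + 1))" using f(3) by (intro mult_left_mono) auto
  also have "\<dots> < e" using base by (simp add: field_simps)
  finally show ?case using f by (intro exI[of _ "\<lambda>x. a * f x"]) (auto intro!: continuous_intros)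
next
  case (add u v)
  obtain f where f: "continuous_on UNIV f" "integrable M f" "(\<integral>x. \<bar>u x - f x\<bar> \<partial>M) < e/2"
    using add.IH(1)[of "e/2"] add.prems by auto
  obtain g where g: "continuous_on UNIV g" "integrable M g" "(\<integral>x. \<bar>v x - g x\<bar> \<partial>M) < e/2"
    using add.IH(2)[of "e/2"] add.prems by auto
  have "(\<integral>x. \<bar>(u x + v x) - (f x + g x)\<bar> \<partial>M) \<le> (\<integral>x. \<bar>u x - f x\<bar> \<partial>M) + (\<integral>x. \<bar>v x - g x\<bar> \<partial>M)"
    using integral_abs_add_le[of M "\<lambda>x. u x - f x" "\<lambda>x. v x - g x"] add f g by (simp add: algebra_simps)
  also have "\<dots> < e" using f g by simp
  finally show ?case using f g
    by (intro exI[of _ "\<lambda>x. f x + g x"]) (auto intro!: continuous_intros)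
next
  case (lim u s)
  have "(\<lambda>i. \<integral>x. \<bar>u x - s i x\<bar> \<partial>M) \<longlonglongrightarrow> 0"
    by (rule integral_abs_diff_tendsto_0) (use lim in auto)
  then have "eventually (\<lambda>i. (\<integral>x. \<bar>u x - s i x\<bar> \<partial>M) < e/2) sequentially"
    by (rule order_tendstoD(2)) (use lim in auto)
  then obtain i where i: "(\<integral>x. \<bar>u x - s i x\<bar> \<partial>M) < e/2" by (auto simp: eventually_sequentially)
  obtain f where f: "continuous_on UNIV f" "integrable M f" "(\<integral>x. \<bar>s i x - f x\<bar> \<partial>M) < e/2"
    using lim.IH[of "e/2" i] lim.prems by auto
  have "(\<integral>x. \<bar>u x - f x\<bar> \<partial>M) \<le> (\<integral>x. \<bar>u x - s i x\<bar> \<partial>M) + (\<integral>x. \<bar>s i x - f x\<bar> \<partial>M)"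
    using integral_abs_add_le[of M "\<lambda>x. u x - s i x" "\<lambda>x. s i x - f x"] lim f by simp
  also have "\<dots> < e" using f i by simp
  finally show ?case using f by blast
qed

lemma (in finite_measure) AE_if_small_exceptional_sets:
  assumes "\<And>\<eta>. \<eta> > 0 \<Longrightarrow> \<exists>W\<in>sets M. measure M W \<le> \<eta> \<and> (\<forall>x\<in>space M - W. P x)"
  shows "AE x in M. P x"
proof -
  have "\<exists>W. \<forall>n::nat. W n \<in> sets M \<and> measure M (W n) \<le> 1 / Suc n \<and> (\<forall>x\<in>space M - W n. P x)"
    by (rule choice) (use assms[of "1 / Suc _"] in auto)
  then obtain W where W: "\<And>n. W n \<in> sets M" "\<And>n. measure M (W n) \<le> 1 / Suc n"
    "\<And>n x. x \<in> space M - W n \<Longrightarrow> P x" by blast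
  have "measure M (\<Inter>n. W n) \<le> 1 / Suc n" for n
    by (rule order_trans[OF finite_measure_mono W(2)[of n]]) (use W(1) in auto)
  then have "measure M (\<Inter>n. W n) \<le> 0"
    using LIMSEQ_le_const[OF LIMSEQ_inverse_real_of_nat, of "measure M (\<Inter>n. W n)"]
    by (auto simp: inverse_eq_divide)
  then have "(\<Inter>n. W n) \<in> null_sets M"
    using W(1) by (auto simp: null_sets_def emeasure_eq_measure order_antisym)
  then have "AE x in M. x \<notin> (\<Inter>n. W n)" by (rule AE_not_in)
  then show ?thesis by (rule AE_mp) (use W(3) in auto)
qed

lemma eventually_poisson_integral_close:
  fixes f g :: "complex \<Rightarrow> real"
  assumes f: "integrable circle_meas f" "isCont f \<zeta>" and g: "integrable circle_meas g" and \<zeta>: "cmod \<zeta> = 1"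
    and e: "e > 0" and close: "\<bar>g \<zeta> - f \<zeta>\<bar> < e/3"
    and maximal: "\<And>r. 0 \<le> r \<Longrightarrow> r < 1 \<Longrightarrow>
      poisson_integral circle_meas (\<lambda>\<xi>. \<bar>g \<xi> - f \<xi>\<bar>) (of_real r * \<zeta>) \<le> e/3"
  shows "eventually (\<lambda>r. \<bar>poisson_integral circle_meas g (of_real r * \<zeta>) - g \<zeta>\<bar> < e) (at_left 1)"
proof -
  have "radial_limit (poisson_integral circle_meas f) \<zeta> (f \<zeta>)"
    by (rule poisson_integral_radial_limit_continuous[OF f(1) \<zeta> f(2)])
  then have "eventually (\<lambda>r. \<bar>poisson_integral circle_meas f (of_real r * \<zeta>) - f \<zeta>\<bar> < e/3) (at_left 1)"
    using e by (auto dest!: tendstoD[of _ _ _ "e/3"] simp: dist_real_def)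
  moreover have "eventually (\<lambda>r. r \<in> {0<..<1}) (at_left (1::real))" by (rule eventually_at_left_real) simp
  ultimately show ?thesis
  proof eventually_elim
    case (elim r)
    have z: "cmod (of_real r * \<zeta>) < 1" using elim \<zeta> by (simp add: norm_mult)
    have "\<bar>poisson_integral circle_meas g (of_real r * \<zeta>) - poisson_integral circle_meas f (of_real r * \<zeta>)\<bar> \<le> e/3"
      using circle_meas.norm_poisson_integral_le[OF z, of "\<lambda>\<xi>. g \<xi> - f \<xi>"]
        circle_meas.poisson_integral_diff[OF g f(1) z] maximal[of r] elim by simp
    then show ?case using elim(1) close by linarith
  qed
qed

lemma poisson_integral_eventually_close_off_small_set:
  fixes g :: "complex \<Rightarrow> real"
  assumes g: "integrable circle_meas g" and e: "e > 0" "\<eta> > 0"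
  shows "\<exists>W\<in>sets borel. measure circle_meas W \<le> \<eta> \<and> (\<forall>\<zeta>\<in>sphere 0 1 - W.
    eventually (\<lambda>r. \<bar>poisson_integral circle_meas g (of_real r * \<zeta>) - g \<zeta>\<bar> < e) (at_left 1))"
proof -
  define \<tau> where "\<tau> = \<eta> * (e/3) / 1281"
  have "\<tau> > 0" using e by (simp add: \<tau>_def)
  then obtain f where f: "continuous_on UNIV f" "integrable circle_meas f" "(\<integral>\<zeta>. \<bar>g \<zeta> - f \<zeta>\<bar> \<partial>circle_meas) < \<tau>"
    using integrable_continuous_approx[OF circle_meas.finite_measure_axioms sets_circle_meas g] by blast
  define D where "D = (\<lambda>\<zeta>. \<bar>g \<zeta> - f \<zeta>\<bar>)"
  have D: "integrable circle_meas D" "\<And>\<zeta>. D \<zeta> \<ge> 0" unfolding D_def using g f by auto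
  then have [measurable]: "D \<in> borel_measurable borel" by auto
  obtain V where V: "open V" "measure circle_meas V \<le> 1280 * (\<integral>\<zeta>. D \<zeta> \<partial>circle_meas) / (e/3)"
    "\<And>\<zeta> r. \<zeta> \<in> sphere 0 1 - V \<Longrightarrow> 0 \<le> r \<Longrightarrow> r < 1 \<Longrightarrow> poisson_integral circle_meas D (of_real r * \<zeta>) \<le> e/3"
    using poisson_maximal_weak_type[OF D, of "e/3"] e by auto
  define X where "X = {\<zeta>. e/3 \<le> D \<zeta>}"
  have X: "X \<in> sets borel" unfolding X_def by measurable
  have "measure circle_meas X \<le> (\<integral>\<zeta>. D \<zeta> \<partial>circle_meas) / (e/3)"
    using integral_Markov_inequality_measure[OF D(1), of UNIV "e/3"] D(2) e by (simp add: X_def)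
  moreover have "measure circle_meas (V \<union> X) \<le> measure circle_meas V + measure circle_meas X"
    using V(1) X by (intro measure_Un_le) auto
  ultimately have "measure circle_meas (V \<union> X) \<le> 1281 * (\<integral>\<zeta>. D \<zeta> \<partial>circle_meas) / (e/3)"
    using V(2) by linarith
  also have "\<dots> \<le> 1281 * \<tau> / (e/3)" using f(3) e by (intro divide_right_mono) (auto simp: D_def)
  also have "\<dots> = \<eta>" using e by (simp add: \<tau>_def)
  finally have small: "measure circle_meas (V \<union> X) \<le> \<eta>" .
  have "eventually (\<lambda>r. \<bar>poisson_integral circle_meas g (of_real r * \<zeta>) - g \<zeta>\<bar> < e) (at_left 1)"
    if \<zeta>: "\<zeta> \<in> sphere 0 1 - (V \<union> X)" for \<zeta>
  proof (rule eventually_poisson_integral_close[OF f(2) _ g])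
    show "isCont f \<zeta>" using f(1) by (simp add: continuous_on_eq_continuous_at)
    show "\<bar>g \<zeta> - f \<zeta>\<bar> < e/3" using \<zeta> by (simp add: X_def D_def)
  qed (use \<zeta> e V(3)[of \<zeta>] in \<open>auto simp: D_def\<close>)
  then show ?thesis using V(1) X small by (intro bexI[of _ "V \<union> X"]) auto
qed

theorem poisson_integral_radial_limit:
  fixes g :: "complex \<Rightarrow> real"
  assumes g: "integrable circle_meas g"
  shows "AE \<zeta> in circle_meas. radial_limit (poisson_integral circle_meas g) \<zeta> (g \<zeta>)"
proof -
  let ?close = "\<lambda>e \<zeta>. eventually (\<lambda>r. \<bar>poisson_integral circle_meas g (of_real r * \<zeta>) - g \<zeta>\<bar> < e) (at_left 1)"
  have "AE \<zeta> in circle_meas. ?close e \<zeta>" if e: "e > 0" for e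
  proof -
    have "AE \<zeta> in circle_meas. \<zeta> \<in> sphere 0 1 \<longrightarrow> ?close e \<zeta>"
      by (rule circle_meas.AE_if_small_exceptional_sets)
         (use poisson_integral_eventually_close_off_small_set[OF g e] in fastforce)
    with AE_circle_meas_sphere show ?thesis by eventually_elim blast
  qed
  then have "AE \<zeta> in circle_meas. \<forall>n::nat. ?close (1 / Suc n) \<zeta>"
    by (subst AE_all_countable) auto
  then show ?thesis
  proof eventually_elim
    case (elim \<zeta>)
    show ?case
    proof (rule tendstoI)
      fix e :: real assume "e > 0"
      then obtain n where n: "1 / Suc n < e" using nat_approx_posE by blast
      show "eventually (\<lambda>r. dist (poisson_integral circle_meas g (of_real r * \<zeta>)) (g \<zeta>) < e) (at_left 1)"
        using spec[OF elim, of n] by (rule eventually_mono) (use n in \<open>auto simp: dist_real_def\<close>)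
    qed
  qed
qed

section \<open>Cauchy transforms and Herglotz integrals\<close>

definition ess_support :: "complex measure \<Rightarrow> (complex \<Rightarrow> 'a::zero) \<Rightarrow> complex set" where
  "ess_support \<mu> w = {z. \<forall>d>0. \<not> (AE \<zeta> in \<mu>. dist \<zeta> z < d \<longrightarrow> w \<zeta> = 0)}"

lemma not_in_ess_support_iff: "z \<notin> ess_support \<mu> w \<longleftrightarrow> (\<exists>d>0. AE \<zeta> in \<mu>. dist \<zeta> z < d \<longrightarrow> w \<zeta> = 0)"
  by (auto simp: ess_support_def)

lemma closed_ess_support: "closed (ess_support \<mu> w)"
  unfolding closed_def open_contains_ball
proof
  fix z assume "z \<in> - ess_support \<mu> w"
  then obtain d where d: "d > 0" "AE \<zeta> in \<mu>. dist \<zeta> z < d \<longrightarrow> w \<zeta> = 0"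
    by (auto simp: not_in_ess_support_iff)
  have "y \<notin> ess_support \<mu> w" if y: "y \<in> ball z (d/2)" for y
  proof -
    have "dist \<zeta> z < d" if "dist \<zeta> y < d/2" for \<zeta>
      using that y dist_triangle[of \<zeta> z y] by (simp add: dist_commute)
    then have "AE \<zeta> in \<mu>. dist \<zeta> y < d/2 \<longrightarrow> w \<zeta> = 0"
      using d(2) by (auto elim: eventually_mono)
    then show ?thesis using d(1) unfolding not_in_ess_support_iff by (intro exI[of _ "d/2"]) simp
  qed
  then show "\<exists>e>0. ball z e \<subseteq> - ess_support \<mu> w" using d(1) by (intro exI[of _ "d/2"]) auto
qed

lemma ess_support_mono:
  assumes "\<And>\<zeta>. w \<zeta> = 0 \<Longrightarrow> v \<zeta> = 0" shows "ess_support \<mu> v \<subseteq> ess_support \<mu> w"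
proof (rule subsetI, rule ccontr)
  fix z assume z: "z \<in> ess_support \<mu> v" "z \<notin> ess_support \<mu> w"
  then obtain d where d: "d > 0" "AE \<zeta> in \<mu>. dist \<zeta> z < d \<longrightarrow> w \<zeta> = 0"
    by (auto simp: not_in_ess_support_iff)
  from d(2) have "AE \<zeta> in \<mu>. dist \<zeta> z < d \<longrightarrow> v \<zeta> = 0"
    by eventually_elim (use assms in blast)
  then show False using d(1) z(1) by (auto simp: ess_support_def)
qed

lemma (in circle_measure) disc_subset_ess_support_compl: "ball 0 1 \<subseteq> - ess_support \<mu> w"
proof
  fix z :: complex assume z: "z \<in> ball 0 1"
  have "AE \<zeta> in \<mu>. dist \<zeta> z < 1 - cmod z \<longrightarrow> w \<zeta> = 0"
    using AE_norm_eq_1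
  proof eventually_elim
    case (elim \<zeta>)
    then show ?case using norm_diff_ge[of \<zeta> z] by (simp add: dist_norm)
  qed
  then show "z \<in> - ess_support \<mu> w"
    using z unfolding Compl_iff not_in_ess_support_iff by (intro exI[of _ "1 - cmod z"]) simp
qed

lemma (in circle_measure) ess_support_const_eq_measure_support:
  "ess_support \<mu> (\<lambda>_. 1::'a::zero_neq_one) = measure_support \<mu>"
proof -
  have "(AE \<zeta> in \<mu>. dist \<zeta> z < d \<longrightarrow> (1::'a) = 0) \<longleftrightarrow> emeasure \<mu> (ball z d) = 0" for z d
    by (subst AE_iff_measurable[of "ball z d"]) (auto simp: dist_commute)
  then show ?thesis by (auto simp: ess_support_def measure_support_def zero_less_iff_neq_zero)
qed

definition cauchy_transform :: "complex measure \<Rightarrow> (complex \<Rightarrow> complex) \<Rightarrow> complex \<Rightarrow> complex" where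
  "cauchy_transform \<mu> w z = (\<integral>\<zeta>. 1 / (\<zeta> - z) * w \<zeta> \<partial>\<mu>)"

lemma integral_mult_bounded:
  fixes w k :: "'a \<Rightarrow> 'b::{real_normed_div_algebra, banach, second_countable_topology}"
  assumes w: "integrable \<mu> w" and k: "k \<in> borel_measurable \<mu>"
    and B: "AE \<zeta> in \<mu>. w \<zeta> = 0 \<or> norm (k \<zeta>) \<le> B" "B \<ge> 0"
  shows "integrable \<mu> (\<lambda>\<zeta>. k \<zeta> * w \<zeta>)"
    and "norm (\<integral>\<zeta>. k \<zeta> * w \<zeta> \<partial>\<mu>) \<le> B * (\<integral>\<zeta>. norm (w \<zeta>) \<partial>\<mu>)"
proof -
  have le: "AE \<zeta> in \<mu>. norm (k \<zeta> * w \<zeta>) \<le> B * norm (w \<zeta>)"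
    using B(1) by eventually_elim (auto simp: norm_mult intro: mult_right_mono)
  have int_bound: "integrable \<mu> (\<lambda>\<zeta>. B * norm (w \<zeta>))" by (intro integrable_mult_right integrable_norm w)
  show int: "integrable \<mu> (\<lambda>\<zeta>. k \<zeta> * w \<zeta>)"
  proof (rule Bochner_Integration.integrable_bound[OF int_bound])
    show "(\<lambda>\<zeta>. k \<zeta> * w \<zeta>) \<in> borel_measurable \<mu>" using w k by measurable
    show "AE \<zeta> in \<mu>. norm (k \<zeta> * w \<zeta>) \<le> norm (B * norm (w \<zeta>))" using le B(2) by simp
  qed
  have "norm (\<integral>\<zeta>. k \<zeta> * w \<zeta> \<partial>\<mu>) \<le> (\<integral>\<zeta>. B * norm (w \<zeta>) \<partial>\<mu>)"
    by (rule order_trans[OF integral_norm_bound integral_mono_AE[OF integrable_norm[OF int] int_bound le]])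
  then show "norm (\<integral>\<zeta>. k \<zeta> * w \<zeta> \<partial>\<mu>) \<le> B * (\<integral>\<zeta>. norm (w \<zeta>) \<partial>\<mu>)"
    by (simp only: integral_mult_right_zero)
qed

lemma integrable_cauchy_kernel_power:
  assumes w: "integrable \<mu> w" and "sets \<mu> = sets borel" and z: "z \<notin> ess_support \<mu> w"
  shows "integrable \<mu> (\<lambda>\<zeta>. 1 / (\<zeta> - z) ^ n * w \<zeta>)"
proof -
  have [measurable_cong]: "sets \<mu> = sets borel" by fact
  obtain d where d: "d > 0" "AE \<zeta> in \<mu>. dist \<zeta> z < d \<longrightarrow> w \<zeta> = 0"
    using z by (auto simp: not_in_ess_support_iff)
  show ?thesis
  proof (rule integral_mult_bounded(1)[OF w])
    show "AE \<zeta> in \<mu>. w \<zeta> = 0 \<or> cmod (1 / (\<zeta> - z) ^ n) \<le> 1 / d ^ n"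
      using d(2)
    proof eventually_elim
      case (elim \<zeta>)
      then show ?case
        using d(1) by (auto simp: norm_divide norm_power dist_norm not_less intro!: frac_le power_mono)
    qed
  qed (use d in auto)
qed

lemma cauchy_kernel_difference_quotient:
  fixes \<zeta> z h :: complex
  assumes d: "d > 0" "d \<le> cmod (\<zeta> - z)" and h: "h \<noteq> 0" "cmod h \<le> d / 2"
  shows "cmod ((1 / (\<zeta> - (z + h)) - 1 / (\<zeta> - z)) / h - 1 / (\<zeta> - z)\<^sup>2) \<le> cmod h * (2 / d ^ 3)"
proof -
  define p where "p = \<zeta> - z"
  have p: "d \<le> cmod p" "d / 2 \<le> cmod (p - h)"
    using d h norm_triangle_ineq2[of p h] by (simp_all add: p_def)
  then have nz: "p \<noteq> 0" "p - h \<noteq> 0" using d by auto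
  have "(1 / (p - h) - 1 / p) / h - 1 / p\<^sup>2 = h / ((p - h) * p\<^sup>2)"
    using nz h by (simp add: field_simps power2_eq_square)
  then have "cmod ((1 / (p - h) - 1 / p) / h - 1 / p\<^sup>2) = cmod h / (cmod (p - h) * (cmod p)\<^sup>2)"
    by (simp add: norm_divide norm_mult norm_power)
  also have "\<dots> \<le> cmod h / (d / 2 * d\<^sup>2)"
    using p d by (intro divide_left_mono mult_mono power_mono mult_pos_pos) auto
  also have "\<dots> = cmod h * (2 / d ^ 3)" by (simp add: power2_eq_square power3_eq_cube)
  finally show ?thesis by (simp add: p_def diff_diff_eq)
qed

lemma cauchy_transform_difference_quotient_le:
  assumes w: "integrable \<mu> w" and sets: "sets \<mu> = sets borel"
    and z: "z \<notin> ess_support \<mu> w" "z + h \<notin> ess_support \<mu> w"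
    and d: "d > 0" "AE \<zeta> in \<mu>. dist \<zeta> z < d \<longrightarrow> w \<zeta> = 0" and h: "h \<noteq> 0" "cmod h \<le> d / 2"
  shows "cmod ((cauchy_transform \<mu> w (z + h) - cauchy_transform \<mu> w z) / h - (\<integral>\<zeta>. 1 / (\<zeta> - z)\<^sup>2 * w \<zeta> \<partial>\<mu>))
    \<le> cmod h * (2 / d ^ 3) * (\<integral>\<zeta>. cmod (w \<zeta>) \<partial>\<mu>)" (is "cmod ?D \<le> _")
proof -
  have [measurable_cong]: "sets \<mu> = sets borel" by fact
  have [measurable]: "w \<in> borel_measurable \<mu>" using w by auto
  let ?k = "\<lambda>\<zeta>. (1 / (\<zeta> - (z + h)) - 1 / (\<zeta> - z)) / h - 1 / (\<zeta> - z)\<^sup>2"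
  note int = integrable_cauchy_kernel_power[OF w sets z(2), of 1]
    integrable_cauchy_kernel_power[OF w sets z(1), of 1] integrable_cauchy_kernel_power[OF w sets z(1), of 2]
  have "?D = (\<integral>\<zeta>. (1 / (\<zeta> - (z + h)) * w \<zeta> - 1 / (\<zeta> - z) * w \<zeta>) / h - 1 / (\<zeta> - z)\<^sup>2 * w \<zeta> \<partial>\<mu>)"
    unfolding cauchy_transform_def using int by simp
  also have "\<dots> = (\<integral>\<zeta>. ?k \<zeta> * w \<zeta> \<partial>\<mu>)"
    by (simp add: left_diff_distrib diff_divide_distrib)
  finally have eq: "?D = (\<integral>\<zeta>. ?k \<zeta> * w \<zeta> \<partial>\<mu>)" .
  show ?thesis unfolding eq
  proof (rule integral_mult_bounded(2)[OF w])
    show "AE \<zeta> in \<mu>. w \<zeta> = 0 \<or> cmod (?k \<zeta>) \<le> cmod h * (2 / d ^ 3)"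
      using d(2)
    proof eventually_elim
      case (elim \<zeta>)
      then show ?case using cauchy_kernel_difference_quotient[of d \<zeta> z h] d(1) h by (auto simp: dist_norm)
    qed
  qed (use d in auto)
qed

lemma cauchy_transform_has_field_derivative:
  assumes w: "integrable \<mu> w" and sets: "sets \<mu> = sets borel" and z: "z \<notin> ess_support \<mu> w"
  shows "(cauchy_transform \<mu> w has_field_derivative (\<integral>\<zeta>. 1 / (\<zeta> - z)\<^sup>2 * w \<zeta> \<partial>\<mu>)) (at z)"
proof -
  obtain d where d: "d > 0" "AE \<zeta> in \<mu>. dist \<zeta> z < d \<longrightarrow> w \<zeta> = 0"
    using z by (auto simp: not_in_ess_support_iff)
  obtain e where e: "e > 0" "ball z e \<subseteq> - ess_support \<mu> w"
    using closed_ess_support z unfolding closed_def by (meson ComplI open_contains_ball)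
  define D where "D = (\<integral>\<zeta>. 1 / (\<zeta> - z)\<^sup>2 * w \<zeta> \<partial>\<mu>)"
  define Q where "Q h = (cauchy_transform \<mu> w (z + h) - cauchy_transform \<mu> w z) / h" for h
  have bound: "cmod (Q h - D) \<le> cmod h * (2 / d ^ 3) * (\<integral>\<zeta>. cmod (w \<zeta>) \<partial>\<mu>)"
    if h: "h \<noteq> 0" "cmod h < min e (d/2)" for h
    unfolding Q_def D_def
  proof (rule cauchy_transform_difference_quotient_le[OF w sets z _ d])
    show "z + h \<notin> ess_support \<mu> w" using h e(2) by (auto simp: dist_norm subset_iff)
  qed (use h in auto)
  have "((\<lambda>h. Q h - D) \<longlongrightarrow> 0) (at 0)"
  proof (rule Lim_null_comparison)
    show "eventually (\<lambda>h. cmod (Q h - D) \<le> cmod h * (2 / d ^ 3) * (\<integral>\<zeta>. cmod (w \<zeta>) \<partial>\<mu>)) (at 0)"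
      unfolding eventually_at using d(1) e(1) bound by (intro exI[of _ "min e (d/2)"]) auto
    have "((\<lambda>h. cmod h * (2 / d ^ 3) * (\<integral>\<zeta>. cmod (w \<zeta>) \<partial>\<mu>)) \<longlongrightarrow>
        cmod 0 * (2 / d ^ 3) * (\<integral>\<zeta>. cmod (w \<zeta>) \<partial>\<mu>)) (at (0::complex))"
      by (intro tendsto_mult tendsto_norm tendsto_const tendsto_ident_at)
    then show "((\<lambda>h. cmod h * (2 / d ^ 3) * (\<integral>\<zeta>. cmod (w \<zeta>) \<partial>\<mu>)) \<longlongrightarrow> 0) (at (0::complex))" by simp
  qed
  then show ?thesis unfolding DERIV_def Q_def D_def by (simp add: LIM_zero_iff)
qed

definition herglotz_integral :: "complex measure \<Rightarrow> (complex \<Rightarrow> real) \<Rightarrow> complex \<Rightarrow> complex" where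
  "herglotz_integral \<mu> w z = (\<integral>\<zeta>. (\<zeta> + z) / (\<zeta> - z) * of_real (w \<zeta>) \<partial>\<mu>)"

lemma singular_inner_eq_exp_herglotz: "singular_inner \<mu> z = exp (- herglotz_integral \<mu> (\<lambda>_. 1) z)"
  by (simp add: singular_inner_def herglotz_integral_def)

lemma Re_mult_of_real: "Re (x * of_real c) = Re x * c"
  by simp

context circle_measure
begin

lemma integrable_herglotz_kernel:
  assumes w: "integrable \<mu> w" and z: "z \<notin> ess_support \<mu> w"
  shows "integrable \<mu> (\<lambda>\<zeta>. (\<zeta> + z) / (\<zeta> - z) * complex_of_real (w \<zeta>))"
proof -
  obtain d where d: "d > 0" "AE \<zeta> in \<mu>. dist \<zeta> z < d \<longrightarrow> w \<zeta> = 0"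
    using z by (auto simp: not_in_ess_support_iff)
  have "AE \<zeta> in \<mu>. complex_of_real (w \<zeta>) = 0 \<or> cmod ((\<zeta> + z) / (\<zeta> - z)) \<le> (1 + cmod z) / d"
    using d(2) AE_norm_eq_1
  proof eventually_elim
    case (elim \<zeta>)
    have "cmod ((\<zeta> + z) / (\<zeta> - z)) \<le> (1 + cmod z) / d" if "d \<le> dist \<zeta> z"
      unfolding norm_divide using that d(1) elim(2) norm_triangle_ineq[of \<zeta> z]
      by (intro frac_le) (auto simp: dist_norm)
    then show ?case using elim(1) by force
  qed
  then show ?thesis
    by (intro integral_mult_bounded(1)) (use w d in \<open>measurable, auto\<close>)
qed

lemma herglotz_integral_eq_cauchy_transform:
  assumes w: "integrable \<mu> w" and z: "z \<notin> ess_support \<mu> w"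
  shows "herglotz_integral \<mu> w z =
    2 * cauchy_transform \<mu> (\<lambda>\<zeta>. \<zeta> * of_real (w \<zeta>)) z - of_real (\<integral>\<zeta>. w \<zeta> \<partial>\<mu>)"
proof -
  obtain d where d: "d > 0" "AE \<zeta> in \<mu>. dist \<zeta> z < d \<longrightarrow> w \<zeta> = 0"
    using z by (auto simp: not_in_ess_support_iff)
  have "2 * cauchy_transform \<mu> (\<lambda>\<zeta>. \<zeta> * of_real (w \<zeta>)) z =
      (\<integral>\<zeta>. (\<zeta> + z) / (\<zeta> - z) * of_real (w \<zeta>) + of_real (w \<zeta>) \<partial>\<mu>)"
    unfolding cauchy_transform_def integral_mult_right_zero[symmetric]
  proof (rule integral_cong_AE)
    show "AE \<zeta> in \<mu>. 2 * (1 / (\<zeta> - z) * (\<zeta> * complex_of_real (w \<zeta>))) =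
        (\<zeta> + z) / (\<zeta> - z) * of_real (w \<zeta>) + of_real (w \<zeta>)"
      using d(2)
    proof eventually_elim
      case (elim \<zeta>)
      show ?case
      proof (cases "\<zeta> = z")
        case False
        then have "(\<zeta> + z) / (\<zeta> - z) + 1 = 2 * \<zeta> / (\<zeta> - z)" by (simp add: field_simps)
        then have "(\<zeta> + z) / (\<zeta> - z) * of_real (w \<zeta>) + of_real (w \<zeta>) = 2 * \<zeta> / (\<zeta> - z) * of_real (w \<zeta>)"
          by (metis distrib_right mult_1)
        then show ?thesis by simp
      qed (use elim d in simp)
    qed
  qed (use w in measurable)
  also have "\<dots> = herglotz_integral \<mu> w z + of_real (\<integral>\<zeta>. w \<zeta> \<partial>\<mu>)"
    unfolding herglotz_integral_def integral_complex_of_real[symmetric]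
    by (intro Bochner_Integration.integral_add integrable_herglotz_kernel assms) (use w in auto)
  finally show ?thesis by simp
qed

theorem herglotz_integral_holomorphic:
  assumes w: "integrable \<mu> w"
  shows "herglotz_integral \<mu> w holomorphic_on - ess_support \<mu> w"
proof -
  let ?v = "\<lambda>\<zeta>. \<zeta> * complex_of_real (w \<zeta>)"
  have v: "integrable \<mu> ?v"
    by (rule integral_mult_bounded(1)[where B=1]) (use w AE_norm_eq_1 in \<open>auto elim: eventually_mono\<close>)
  have "ess_support \<mu> ?v \<subseteq> ess_support \<mu> w" by (rule ess_support_mono) simp
  then have "cauchy_transform \<mu> ?v holomorphic_on - ess_support \<mu> w"
    using cauchy_transform_has_field_derivative[OF v sets_eq_borel]
    by (subst holomorphic_on_open[OF open_Compl[OF closed_ess_support]]) blast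
  then have "(\<lambda>z. 2 * cauchy_transform \<mu> ?v z - of_real (\<integral>\<zeta>. w \<zeta> \<partial>\<mu>)) holomorphic_on - ess_support \<mu> w"
    by (intro holomorphic_intros)
  then show ?thesis
    by (rule holomorphic_transform) (use w in \<open>simp add: herglotz_integral_eq_cauchy_transform\<close>)
qed

corollary herglotz_integral_holomorphic_disc:
  "integrable \<mu> w \<Longrightarrow> herglotz_integral \<mu> w holomorphic_on ball 0 1"
  by (rule holomorphic_on_subset[OF herglotz_integral_holomorphic disc_subset_ess_support_compl])

lemma herglotz_integral_add:
  assumes "integrable \<mu> v" "integrable \<mu> w" "cmod z < 1"
  shows "herglotz_integral \<mu> (\<lambda>\<zeta>. v \<zeta> + w \<zeta>) z = herglotz_integral \<mu> v z + herglotz_integral \<mu> w z"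
proof -
  have "z \<notin> ess_support \<mu> v" "z \<notin> ess_support \<mu> w"
    using assms(3) subsetD[OF disc_subset_ess_support_compl] by auto
  then show ?thesis
    unfolding herglotz_integral_def of_real_add distrib_left
    by (intro Bochner_Integration.integral_add integrable_herglotz_kernel assms)
qed

lemma Re_herglotz_integral:
  assumes w: "integrable \<mu> w" and z: "cmod z < 1"
  shows "Re (herglotz_integral \<mu> w z) = poisson_integral \<mu> w z"
proof -
  have "z \<notin> ess_support \<mu> w" using z subsetD[OF disc_subset_ess_support_compl] by auto
  then have "Re (herglotz_integral \<mu> w z) = (\<integral>\<zeta>. Re ((\<zeta> + z) / (\<zeta> - z) * of_real (w \<zeta>)) \<partial>\<mu>)"
    unfolding herglotz_integral_def by (intro integral_Re[symmetric] integrable_herglotz_kernel w)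
  also have "\<dots> = poisson_integral \<mu> w z"
    unfolding poisson_integral_def
  proof (rule integral_cong_AE)
    show "AE \<zeta> in \<mu>. Re ((\<zeta> + z) / (\<zeta> - z) * of_real (w \<zeta>)) = poisson z \<zeta> *\<^sub>R w \<zeta>"
      using AE_norm_eq_1
    proof eventually_elim
      case (elim \<zeta>)
      then have "z \<noteq> \<zeta>" using z by auto
      then have "Re ((\<zeta> + z) / (\<zeta> - z)) = poisson z \<zeta>" using poisson_eq_Re[OF elim] by simp
      then show ?case by (simp only: Re_mult_of_real real_scaleR_def)
    qed
  qed (use w in measurable)
  finally show ?thesis .
qed

text \<open>This holds even where the kernel is not integrable, since the integral is then \<open>0\<close> by convention.\<close>
lemma Re_herglotz_integral_circle:
  assumes z: "cmod z = 1"
  shows "Re (herglotz_integral \<mu> w z) = 0"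
proof (cases "integrable \<mu> (\<lambda>\<zeta>. (\<zeta> + z) / (\<zeta> - z) * complex_of_real (w \<zeta>))")
  case True
  have "(\<integral>\<zeta>. Re ((\<zeta> + z) / (\<zeta> - z) * of_real (w \<zeta>)) \<partial>\<mu>) = 0"
  proof (rule integral_eq_zero_AE)
    show "AE \<zeta> in \<mu>. Re ((\<zeta> + z) / (\<zeta> - z) * of_real (w \<zeta>)) = 0"
      using AE_norm_eq_1
    proof eventually_elim
      case (elim \<zeta>)
      have "Re ((\<zeta> + z) / (\<zeta> - z)) = 0"
        using poisson_eq_Re[OF elim, of z] z by (cases "\<zeta> = z") (auto simp: poisson_def)
      then show ?case by (simp only: Re_mult_of_real mult_zero_left)
    qed
  qed
  then show ?thesis unfolding herglotz_integral_def using integral_Re[OF True] by simp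
qed (simp add: herglotz_integral_def not_integrable_integral_eq)

end

section \<open>The Herglotz representation\<close>

lemma real_distributions_on_interval_weak_limit:
  fixes \<nu> :: "nat \<Rightarrow> real measure"
  assumes "\<And>n. real_distribution (\<nu> n)" and AE: "\<And>n. AE x in \<nu> n. x \<in> {a<..b}" and "a < b"
  obtains s M where "strict_mono (s :: nat \<Rightarrow> nat)" "real_distribution M" "weak_conv_m (\<lambda>n. \<nu> (s n)) M"
proof -
  interpret \<nu>: real_distribution "\<nu> n" for n by fact
  have "measure (\<nu> n) {a<..b} = 1" for n
    using AE[of n] by (subst \<nu>.prob_eq_1) auto
  then have "\<exists>a b. a < b \<and> (\<forall>n. measure (\<nu> n) {a<..b} > 1 - \<epsilon>)" if "\<epsilon> > 0" for \<epsilon>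
    using \<open>a < b\<close> that by (intro exI[of _ a] exI[of _ b]) simp
  then have "tight \<nu>" unfolding tight_def using assms(1) by blast
  from tight_imp_convergent_subsubsequence[OF this strict_mono_id] show thesis
    using that by (auto simp: o_def)
qed

lemma circle_measure_distr_cis:
  assumes "real_distribution M" shows "circle_measure (distr M borel cis)"
proof -
  interpret real_distribution M by fact
  interpret distr: prob_space "distr M borel cis" by (rule prob_space_distr) simp
  show ?thesis
  proof (rule circle_measureI)
    show "emeasure (distr M borel cis) UNIV \<noteq> \<infinity>" using distr.emeasure_finite by simp
    show "AE \<zeta> in distr M borel cis. cmod \<zeta> = 1" by (subst AE_distr_iff) auto
  qed simp
qed

lemma real_distribution_density_angle_meas:
  fixes u :: "complex \<Rightarrow> real"
  assumes u: "integrable circle_meas u" "\<And>\<zeta>. u \<zeta> \<ge> 0" and mass: "(\<integral>\<zeta>. u \<zeta> \<partial>circle_meas) = 1"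
  shows "real_distribution (density angle_meas (\<lambda>\<theta>. ennreal (u (cis \<theta>))))" (is "real_distribution ?\<nu>")
proof -
  have [measurable]: "u \<in> borel_measurable borel" using u(1) by auto
  have "emeasure ?\<nu> (space ?\<nu>) = (\<integral>\<^sup>+\<zeta>. ennreal (u \<zeta>) \<partial>circle_meas)"
    by (simp add: emeasure_density circle_meas_eq_distr nn_integral_distr)
  also have "\<dots> = 1" using nn_integral_eq_integral[OF u(1)] u(2) mass by simp
  finally show ?thesis
    by (auto simp: real_distribution_def real_distribution_axioms_def intro: prob_spaceI)
qed

lemma circle_densities_weak_limit:
  fixes u :: "nat \<Rightarrow> complex \<Rightarrow> real"
  assumes u: "\<And>n. integrable circle_meas (u n)" "\<And>n \<zeta>. u n \<zeta> \<ge> 0"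
    and mass: "\<And>n. (\<integral>\<zeta>. u n \<zeta> \<partial>circle_meas) = 1"
  obtains \<mu> s where "circle_measure \<mu>" "strict_mono (s :: nat \<Rightarrow> nat)"
    "\<And>g :: complex \<Rightarrow> real. continuous_on (sphere 0 1) g \<Longrightarrow> g \<in> borel_measurable borel \<Longrightarrow>
      (\<lambda>n. \<integral>\<zeta>. g \<zeta> * u (s n) \<zeta> \<partial>circle_meas) \<longlonglongrightarrow> (\<integral>\<zeta>. g \<zeta> \<partial>\<mu>)"
proof -
  have [measurable]: "u n \<in> borel_measurable borel" for n using u(1)[of n] by auto
  define \<nu> where "\<nu> n = density angle_meas (\<lambda>\<theta>. ennreal (u n (cis \<theta>)))" for n
  have \<nu>: "real_distribution (\<nu> n)" for n
    unfolding \<nu>_def by (rule real_distribution_density_angle_meas[OF u mass])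
  have "AE \<theta> in \<nu> n. \<theta> \<in> {-1<..2*pi}" for n
    unfolding \<nu>_def using AE_angle_meas by (subst AE_density) (auto elim: eventually_mono)
  then obtain s M where s: "strict_mono (s :: nat \<Rightarrow> nat)"
    and M: "real_distribution M" and weak: "weak_conv_m (\<lambda>n. \<nu> (s n)) M"
    by (rule real_distributions_on_interval_weak_limit[OF \<nu>]) (auto intro: order_less_trans[of _ 0])
  interpret M: real_distribution M by fact
  have lim: "(\<lambda>n. \<integral>\<zeta>. g \<zeta> * u (s n) \<zeta> \<partial>circle_meas) \<longlonglongrightarrow> (\<integral>\<zeta>. g \<zeta> \<partial>distr M borel cis)"
    if g: "continuous_on (sphere 0 1) g" and [measurable]: "g \<in> borel_measurable borel" for g :: "complex \<Rightarrow> real"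
  proof -
    obtain B where B: "\<And>\<zeta>. \<zeta> \<in> sphere 0 1 \<Longrightarrow> norm (g \<zeta>) \<le> B"
      using compact_continuous_bounded[OF compact_sphere g] by metis
    have "isCont (\<lambda>\<theta>. g (cis \<theta>)) \<theta>" for \<theta>
      using continuous_on_compose2[OF g, of UNIV cis]
      by (simp add: continuous_on_cis continuous_on_eq_continuous_at image_subset_iff)
    then have "(\<lambda>n. \<integral>\<theta>. g (cis \<theta>) \<partial>\<nu> (s n)) \<longlonglongrightarrow> (\<integral>\<theta>. g (cis \<theta>) \<partial>M)"
      using B \<nu> weak M by (intro weak_conv_imp_integral_bdd_continuous_conv[where B=B]) auto
    moreover have "(\<integral>\<theta>. g (cis \<theta>) \<partial>\<nu> n) = (\<integral>\<zeta>. g \<zeta> * u n \<zeta> \<partial>circle_meas)" for n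
      unfolding \<nu>_def circle_meas_eq_distr using u(2)
      by (simp add: integral_density integral_distr mult.commute)
    ultimately show ?thesis by (simp add: integral_distr)
  qed
  show thesis by (rule that[OF circle_measure_distr_cis[OF M] s lim])
qed

lemma continuous_on_dilate_circle:
  assumes "f holomorphic_on ball 0 1" "0 \<le> r" "r < 1"
  shows "continuous_on (sphere 0 1) (\<lambda>\<zeta>. f (of_real r * \<zeta>))"
  by (rule continuous_on_compose2[OF holomorphic_on_imp_continuous_on[OF assms(1)]])
     (use assms in \<open>auto intro!: continuous_intros simp: norm_mult\<close>)

lemma poisson_formula_dilate:
  assumes f: "f holomorphic_on ball 0 1" and r: "0 < r" "r < 1" and z: "cmod z < 1"
  shows "poisson_integral circle_meas (\<lambda>\<zeta>. indicator (sphere 0 1) \<zeta> * Re (f (of_real r * \<zeta>))) z =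
    Re (f (of_real r * z))"
proof -
  define F where "F = (\<lambda>\<zeta>. f (of_real r * \<zeta>))"
  have F: "F holomorphic_on ball 0 (1/r)"
    unfolding F_def using r
    by (intro holomorphic_on_compose_gen[OF _ f, unfolded o_def])
       (auto intro!: holomorphic_intros simp: norm_mult field_simps)
  have "set_integrable circle_meas (sphere 0 1) F"
    unfolding F_def by (rule set_integrable_circle_continuous[OF continuous_on_dilate_circle[OF f]]) (use r in auto)
  then have int: "integrable circle_meas (\<lambda>\<zeta>. indicator (sphere 0 1) \<zeta> *\<^sub>R F \<zeta>)"
    by (simp add: set_integrable_def)
  have "poisson_integral circle_meas (\<lambda>\<zeta>. indicator (sphere 0 1) \<zeta> *\<^sub>R F \<zeta>) z =
      (LINT \<zeta>:sphere 0 1|circle_meas. poisson z \<zeta> *\<^sub>R F \<zeta>)"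
    by (simp add: poisson_integral_def set_lebesgue_integral_def mult.commute)
  also have "\<dots> = F z"
    by (rule poisson_formula[OF F _ z]) (use r in \<open>auto simp: field_simps\<close>)
  finally show ?thesis
    using circle_meas.Re_poisson_integral[OF int z] by (simp add: F_def)
qed

lemma Re_eq_0_if_nonneg_and_zero_at_0:
  assumes f: "f holomorphic_on ball 0 1" and nonneg: "\<And>z. z \<in> ball 0 1 \<Longrightarrow> Re (f z) \<ge> 0"
    and zero: "Re (f 0) = 0" and z: "z \<in> ball 0 1"
  shows "Re (f z) = 0"
proof -
  have "(\<lambda>z. exp (- f z)) constant_on ball 0 1"
    by (rule maximum_modulus_principle[of _ _ "ball 0 1" 0])
       (use f nonneg zero in \<open>auto intro!: holomorphic_intros simp: norm_exp_eq_Re\<close>)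
  then have "exp (- f z) = exp (- f 0)"
    using z unfolding constant_on_def by (metis centre_in_ball zero_less_one)
  then show ?thesis using zero by (metis exp_inj_iff norm_exp_eq_Re neg_equal_iff_equal uminus_complex.sel(1))
qed

lemma herglotz_representation_normalized:
  assumes f: "f holomorphic_on ball 0 1" and nonneg: "\<And>z. z \<in> ball 0 1 \<Longrightarrow> Re (f z) \<ge> 0" and normalized: "Re (f 0) = 1"
  obtains \<mu> where "circle_measure \<mu>" "\<And>z. z \<in> ball 0 1 \<Longrightarrow> Re (f z) = poisson_integral \<mu> (\<lambda>_. 1) z"
proof -
  define r where "r n = real (Suc n) / real (Suc (Suc n))" for n
  have r: "0 < r n" "r n < 1" for n by (auto simp: r_def)
  have r_lim: "r \<longlonglongrightarrow> 1"
    unfolding r_def using LIMSEQ_Suc[OF LIMSEQ_n_over_Suc_n[where 'a=real]] .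
  define u where "u n \<zeta> = indicator (sphere 0 1) \<zeta> * Re (f (of_real (r n) * \<zeta>))" for n \<zeta>
  have "continuous_on (sphere 0 1) (\<lambda>\<zeta>. Re (f (of_real (r n) * \<zeta>)))" for n
    by (intro continuous_intros continuous_on_dilate_circle f) (use r[of n] in auto)
  then have int: "integrable circle_meas (u n)" for n
    unfolding u_def using set_integrable_circle_continuous[unfolded set_integrable_def] by fastforce
  have u: "(\<integral>\<zeta>. poisson z \<zeta> * u n \<zeta> \<partial>circle_meas) = Re (f (of_real (r n) * z))" if "z \<in> ball 0 1" for n z
    using poisson_formula_dilate[OF f r, of z n] that by (simp add: poisson_integral_def u_def)
  have u_nonneg: "u n \<zeta> \<ge> 0" for n \<zeta>
    unfolding u_def using r[of n] nonneg[of "of_real (r n) * \<zeta>"] by (auto simp: indicator_def norm_mult)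
  have mass: "(\<integral>\<zeta>. u n \<zeta> \<partial>circle_meas) = 1" for n
  proof -
    have "(\<integral>\<zeta>. u n \<zeta> \<partial>circle_meas) = (\<integral>\<zeta>. poisson 0 \<zeta> * u n \<zeta> \<partial>circle_meas)"
      by (intro Bochner_Integration.integral_cong) (auto simp: u_def indicator_def)
    then show ?thesis using u[of 0 n] normalized by simp
  qed
  obtain \<mu> s where \<mu>: "circle_measure \<mu>" and s: "strict_mono (s :: nat \<Rightarrow> nat)"
    and lim: "\<And>g :: complex \<Rightarrow> real. continuous_on (sphere 0 1) g \<Longrightarrow> g \<in> borel_measurable borel \<Longrightarrow>
      (\<lambda>n. \<integral>\<zeta>. g \<zeta> * u (s n) \<zeta> \<partial>circle_meas) \<longlonglongrightarrow> (\<integral>\<zeta>. g \<zeta> \<partial>\<mu>)"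
    by (rule circle_densities_weak_limit[OF int u_nonneg mass]) (rule that)
  show thesis
  proof (rule that[OF \<mu>])
    fix z :: complex assume z: "z \<in> ball 0 1"
    have "isCont f z" using f z by (metis continuous_on_eq_continuous_at holomorphic_on_imp_continuous_on open_ball)
    moreover have "(\<lambda>n. of_real (r (s n)) * z) \<longlonglongrightarrow> of_real 1 * z"
      by (intro tendsto_intros LIMSEQ_subseq_LIMSEQ[OF r_lim s, unfolded o_def])
    ultimately have "(\<lambda>n. Re (f (of_real (r (s n)) * z))) \<longlonglongrightarrow> Re (f z)"
      by (intro tendsto_intros isCont_tendsto_compose[of _ f]) auto
    moreover have "(\<lambda>n. Re (f (of_real (r (s n)) * z))) \<longlonglongrightarrow> (\<integral>\<zeta>. poisson z \<zeta> \<partial>\<mu>)"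
      using lim[OF continuous_on_poisson, of z] z by (simp add: u)
    ultimately have "Re (f z) = (\<integral>\<zeta>. poisson z \<zeta> \<partial>\<mu>)" by (rule LIMSEQ_unique)
    then show "Re (f z) = poisson_integral \<mu> (\<lambda>_. 1) z" by (simp add: poisson_integral_def)
  qed
qed

theorem herglotz_representation:
  assumes f: "f holomorphic_on ball 0 1" and nonneg: "\<And>z. z \<in> ball 0 1 \<Longrightarrow> Re (f z) \<ge> 0"
  obtains \<mu> where "circle_measure \<mu>" "\<And>z. z \<in> ball 0 1 \<Longrightarrow> Re (f z) = poisson_integral \<mu> (\<lambda>_. 1) z"
proof (cases "Re (f 0) = 0")
  case True
  have "circle_measure (null_measure borel)"
    by (rule circle_measureI) (auto intro: AE_I[of _ _ UNIV])
  moreover have "Re (f z) = 0" if "z \<in> ball 0 1" for z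
    by (rule Re_eq_0_if_nonneg_and_zero_at_0[OF f nonneg True that])
  ultimately show thesis
    using that[of "null_measure borel"] by (simp add: poisson_integral_def integral_null_measure)
next
  case False
  define A where "A = Re (f 0)"
  have A: "A > 0" using False nonneg[of 0] by (simp add: A_def)
  obtain \<mu> where \<mu>: "circle_measure \<mu>" "\<And>z. z \<in> ball 0 1 \<Longrightarrow> Re (f z / of_real A) = poisson_integral \<mu> (\<lambda>_. 1) z"
  proof (rule herglotz_representation_normalized)
    show "(\<lambda>z. f z / of_real A) holomorphic_on ball 0 1" using A by (intro holomorphic_intros f) auto
    show "Re (f z / of_real A) \<ge> 0" if "z \<in> ball 0 1" for z using nonneg[OF that] A by simp
    show "Re (f 0 / of_real A) = 1" using A by (simp add: A_def)
  qed (rule that)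
  interpret \<mu>: circle_measure \<mu> by fact
  show thesis
  proof (rule that)
    show "circle_measure (density \<mu> (\<lambda>_. A))" using A by (intro \<mu>.circle_measure_density) auto
    show "Re (f z) = poisson_integral (density \<mu> (\<lambda>_. A)) (\<lambda>_. 1) z" if "z \<in> ball 0 1" for z
      using \<mu>(2)[OF that] A by (simp add: poisson_integral_density) (simp add: poisson_integral_def field_simps)
  qed
qed

section \<open>Measures with locally bounded Poisson integral\<close>

context circle_measure
begin

lemma integrable_poisson_pair:
  fixes g :: "complex \<Rightarrow> real"
  assumes [measurable]: "g \<in> borel_measurable borel" and B: "\<And>\<zeta>. \<bar>g \<zeta>\<bar> \<le> B" and r: "0 \<le> r" "r < 1"
  shows "integrable (circle_meas \<Otimes>\<^sub>M \<mu>) (\<lambda>(\<zeta>, \<xi>). poisson (of_real r * \<xi>) \<zeta> * g \<zeta>)"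
proof -
  interpret pair_sigma_finite circle_meas \<mu> by unfold_locales
  have [measurable]: "(\<lambda>\<xi>. \<xi>) \<in> borel_measurable \<mu>" "(\<lambda>\<xi>. \<xi>) \<in> borel_measurable circle_meas"
    by (simp_all cong: measurable_cong_sets)
  interpret pair: finite_measure "circle_meas \<Otimes>\<^sub>M \<mu>"
    by (rule finite_measure_pair_measure[OF finite_measure_axioms circle_meas.finite_measure_axioms])
  have "AE p in circle_meas \<Otimes>\<^sub>M \<mu>. cmod (fst p) = 1 \<and> cmod (snd p) = 1"
  proof (rule AE_pair_measure)
    show "AE \<zeta> in circle_meas. AE \<xi> in \<mu>. cmod (fst (\<zeta>, \<xi>)) = 1 \<and> cmod (snd (\<zeta>, \<xi>)) = 1"
      using AE_circle_meas_norm by eventually_elim (use AE_norm_eq_1 in simp)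
  qed measurable
  then have "AE p in circle_meas \<Otimes>\<^sub>M \<mu>.
      norm (case p of (\<zeta>, \<xi>) \<Rightarrow> poisson (of_real r * \<xi>) \<zeta> * g \<zeta>) \<le> 2 / (1 - r) * B"
  proof eventually_elim
    case (elim p)
    obtain \<zeta> \<xi> where p: "p = (\<zeta>, \<xi>)" by (cases p)
    have "cmod (of_real r * \<xi>) = r" using elim r p by (simp add: norm_mult)
    then have "\<bar>poisson (of_real r * \<xi>) \<zeta>\<bar> \<le> 2 / (1 - r)"
      using poisson_le[of \<zeta> "of_real r * \<xi>"] poisson_nonneg[of "of_real r * \<xi>" \<zeta>] elim r p by simp
    then have "\<bar>poisson (of_real r * \<xi>) \<zeta>\<bar> * \<bar>g \<zeta>\<bar> \<le> 2 / (1 - r) * B"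
      using B[of \<zeta>] r by (intro mult_mono) auto
    then show ?case unfolding p by (simp add: abs_mult)
  qed
  then show ?thesis by (rule pair.integrable_const_bound) measurable
qed

lemma poisson_integral_swap:
  fixes g :: "complex \<Rightarrow> real"
  assumes [measurable]: "g \<in> borel_measurable borel" and "\<And>\<zeta>. \<bar>g \<zeta>\<bar> \<le> B" and "0 \<le> r" "r < 1"
  shows "(\<integral>\<xi>. poisson_integral circle_meas g (of_real r * \<xi>) \<partial>\<mu>) =
    (\<integral>\<zeta>. g \<zeta> * poisson_integral \<mu> (\<lambda>_. 1) (of_real r * \<zeta>) \<partial>circle_meas)"
proof -
  interpret pair_sigma_finite circle_meas \<mu> by unfold_locales
  have [measurable]: "(\<lambda>\<xi>. \<xi>) \<in> borel_measurable \<mu>" "(\<lambda>\<xi>. \<xi>) \<in> borel_measurable circle_meas"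
    by (simp_all cong: measurable_cong_sets)
  have "(\<integral>\<xi>. poisson_integral circle_meas g (of_real r * \<xi>) \<partial>\<mu>) =
      (\<integral>\<zeta>. (\<integral>\<xi>. poisson (of_real r * \<xi>) \<zeta> * g \<zeta> \<partial>\<mu>) \<partial>circle_meas)"
    unfolding poisson_integral_def real_scaleR_def by (rule Fubini_integral[OF integrable_poisson_pair[OF assms]])
  also have "\<dots> = (\<integral>\<zeta>. (\<integral>\<xi>. poisson (of_real r * \<zeta>) \<xi> * g \<zeta> \<partial>\<mu>) \<partial>circle_meas)"
  proof (intro integral_cong_AE)
    show "AE \<zeta> in circle_meas. (\<integral>\<xi>. poisson (of_real r * \<xi>) \<zeta> * g \<zeta> \<partial>\<mu>) =
        (\<integral>\<xi>. poisson (of_real r * \<zeta>) \<xi> * g \<zeta> \<partial>\<mu>)"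
      using AE_circle_meas_norm
    proof eventually_elim
      case (elim \<zeta>)
      have "AE \<xi> in \<mu>. poisson (of_real r * \<xi>) \<zeta> * g \<zeta> = poisson (of_real r * \<zeta>) \<xi> * g \<zeta>"
        using AE_norm_eq_1 by eventually_elim (simp add: poisson_symm elim)
      then show ?case by (intro integral_cong_AE) auto
    qed
  qed measurable
  finally show ?thesis by (simp add: poisson_integral_def mult.commute)
qed

lemma poisson_integral_weak_limit:
  fixes g :: "complex \<Rightarrow> real"
  assumes g: "continuous_on UNIV g" and B: "\<And>\<zeta>. \<bar>g \<zeta>\<bar> \<le> B"
  shows "((\<lambda>r. \<integral>\<zeta>. g \<zeta> * poisson_integral \<mu> (\<lambda>_. 1) (of_real r * \<zeta>) \<partial>circle_meas) \<longlongrightarrow> (\<integral>\<zeta>. g \<zeta> \<partial>\<mu>)) (at_left 1)"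
proof (rule tendsto_at_left_sequentially[of 0])
  have [measurable]: "g \<in> borel_measurable borel" by (rule borel_measurable_continuous_onI[OF g])
  have int: "integrable circle_meas g" by (rule circle_meas_integrable_bounded[where B=B]) (use B in auto)
  have le_B: "norm (poisson_integral circle_meas g z) \<le> B" if "cmod z < 1" for z
    by (rule norm_poisson_integral_le_const[OF int _ that]) (use B in simp)
  fix r :: "nat \<Rightarrow> real" assume r: "\<And>n. r n < 1" "\<And>n. 0 < r n" "r \<longlonglongrightarrow> 1"
  have "(\<lambda>n. \<integral>\<xi>. poisson_integral circle_meas g (of_real (r n) * \<xi>) \<partial>\<mu>) \<longlonglongrightarrow> (\<integral>\<xi>. g \<xi> \<partial>\<mu>)"
  proof (rule integral_dominated_convergence[where w="\<lambda>_. B"])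
    have [measurable]: "(\<lambda>\<xi>. \<xi>) \<in> borel_measurable \<mu>"
      by (simp cong: measurable_cong_sets)
    show "(\<lambda>\<xi>. poisson_integral circle_meas g (of_real (r n) * \<xi>)) \<in> borel_measurable \<mu>" for n
      unfolding poisson_integral_def by measurable
    have radius: "filterlim r (at_left 1) sequentially"
      using r by (auto simp: filterlim_at less_imp_neq)
    show "AE \<xi> in \<mu>. (\<lambda>n. poisson_integral circle_meas g (of_real (r n) * \<xi>)) \<longlonglongrightarrow> g \<xi>"
      using AE_norm_eq_1
    proof eventually_elim
      case (elim \<xi>)
      have "radial_limit (poisson_integral circle_meas g) \<xi> (g \<xi>)"
        using g by (intro poisson_integral_radial_limit_continuous int elim) (simp add: continuous_on_eq_continuous_at)
      then show ?case by (rule filterlim_compose[OF _ radius])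
    qed
    show "AE \<xi> in \<mu>. norm (poisson_integral circle_meas g (of_real (r n) * \<xi>)) \<le> B" for n
      using AE_norm_eq_1
      by eventually_elim (rule le_B, use r(1,2)[of n] in \<open>simp add: norm_mult\<close>)
  qed auto
  moreover have "(\<integral>\<xi>. poisson_integral circle_meas g (of_real (r n) * \<xi>) \<partial>\<mu>) =
      (\<integral>\<zeta>. g \<zeta> * poisson_integral \<mu> (\<lambda>_. 1) (of_real (r n) * \<zeta>) \<partial>circle_meas)" for n
    by (rule poisson_integral_swap) (use r(1,2)[of n] B in auto)
  ultimately show "(\<lambda>n. \<integral>\<zeta>. g \<zeta> * poisson_integral \<mu> (\<lambda>_. 1) (of_real (r n) * \<zeta>) \<partial>circle_meas) \<longlonglongrightarrow> (\<integral>\<zeta>. g \<zeta> \<partial>\<mu>)"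
    by simp
qed simp

lemma integral_le_of_poisson_integral_le:
  fixes g :: "complex \<Rightarrow> real"
  assumes e: "e > 0"
    and le: "\<And>z x. z \<in> ball 0 1 \<Longrightarrow> x \<in> V \<Longrightarrow> dist x z < e \<Longrightarrow> poisson_integral \<mu> (\<lambda>_. 1) z \<le> M"
    and g: "continuous_on UNIV g" "\<And>\<zeta>. g \<zeta> \<in> {0..1}" "\<And>\<zeta>. \<zeta> \<notin> V \<Longrightarrow> g \<zeta> = 0"
  shows "(\<integral>\<zeta>. g \<zeta> \<partial>\<mu>) \<le> M * (\<integral>\<zeta>. g \<zeta> \<partial>circle_meas)"
proof (rule tendsto_upperbound)
  have g01: "0 \<le> g \<zeta>" "g \<zeta> \<le> 1" for \<zeta> using g(2)[of \<zeta>] by auto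
  show "((\<lambda>r. \<integral>\<zeta>. g \<zeta> * poisson_integral \<mu> (\<lambda>_. 1) (of_real r * \<zeta>) \<partial>circle_meas) \<longlongrightarrow> (\<integral>\<zeta>. g \<zeta> \<partial>\<mu>)) (at_left 1)"
    by (rule poisson_integral_weak_limit[OF g(1), of 1]) (use g01 in auto)
  have [measurable]: "g \<in> borel_measurable borel" by (rule borel_measurable_continuous_onI[OF g(1)])
  have int: "integrable circle_meas g" by (rule circle_meas_integrable_bounded[where B=1]) (use g01 in auto)
  have "eventually (\<lambda>r. r \<in> {max 0 (1 - e)<..<1}) (at_left (1::real))"
    using e by (intro eventually_at_left_real) simp
  then show "eventually (\<lambda>r. (\<integral>\<zeta>. g \<zeta> * poisson_integral \<mu> (\<lambda>_. 1) (of_real r * \<zeta>) \<partial>circle_meas)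
      \<le> M * (\<integral>\<zeta>. g \<zeta> \<partial>circle_meas)) (at_left 1)"
  proof eventually_elim
    case (elim r)
    have "AE \<zeta> in circle_meas. 0 \<le> g \<zeta> * M \<and> g \<zeta> * poisson_integral \<mu> (\<lambda>_. 1) (of_real r * \<zeta>) \<le> g \<zeta> * M"
      using AE_circle_meas_norm
    proof eventually_elim
      case (elim \<zeta>)
      show ?case
      proof (cases "\<zeta> \<in> V")
        case True
        have "of_real r * \<zeta> \<in> ball 0 1" "dist \<zeta> (of_real r * \<zeta>) < e"
          using elim \<open>r \<in> _\<close> norm_diff_radius[of \<zeta> r] by (auto simp: norm_mult dist_norm)
        then have "0 \<le> poisson_integral \<mu> (\<lambda>_. 1::real) (of_real r * \<zeta>)"
          "poisson_integral \<mu> (\<lambda>_. 1) (of_real r * \<zeta>) \<le> M"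
          using le[of "of_real r * \<zeta>" \<zeta>] True poisson_integral_nonneg[of "of_real r * \<zeta>" "\<lambda>_. 1"] by auto
        then show ?thesis using g01[of \<zeta>] by (auto intro!: mult_left_mono)
      qed (simp add: g(3))
    qed
    then have "(\<integral>\<zeta>. g \<zeta> * poisson_integral \<mu> (\<lambda>_. 1) (of_real r * \<zeta>) \<partial>circle_meas) \<le> (\<integral>\<zeta>. g \<zeta> * M \<partial>circle_meas)"
      using int by (intro integral_mono_AE') (auto elim: eventually_mono)
    then show ?case by (simp add: mult.commute)
  qed
qed simp

lemma measure_compact_le_of_poisson_integral_le:
  assumes V: "open V" and e: "e > 0" and M: "M \<ge> 0"
    and le: "\<And>z x. z \<in> ball 0 1 \<Longrightarrow> x \<in> V \<Longrightarrow> dist x z < e \<Longrightarrow> poisson_integral \<mu> (\<lambda>_. 1) z \<le> M"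
    and K: "compact K" "K \<subseteq> U" "K \<subseteq> V" and U: "open U"
  shows "measure \<mu> K \<le> M * measure circle_meas U"
proof -
  have [measurable]: "K \<in> sets borel" "U \<in> sets borel" using K U by (auto intro: borel_compact)
  obtain g :: "complex \<Rightarrow> real" where g: "continuous_on UNIV g" "\<And>x. g x \<in> {0..1}"
    "\<And>x. x \<in> K \<Longrightarrow> g x = 1" "\<And>x. x \<notin> U \<inter> V \<Longrightarrow> g x = 0"
    by (rule compact_open_continuous_indicator[of K "U \<inter> V"]) (use K U V in auto)
  have g01: "0 \<le> g x" "g x \<le> 1" for x using g(2)[of x] by auto
  have [measurable]: "g \<in> borel_measurable borel" by (rule borel_measurable_continuous_onI[OF g(1)])
  have int: "integrable \<mu> g" "integrable circle_meas g"
    by (auto intro!: integrable_const_bound[where B=1] circle_meas.integrable_const_bound[where B=1] simp: g01)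
  have "measure \<mu> K = (\<integral>x. indicator K x \<partial>\<mu>)" by simp
  also have "\<dots> \<le> (\<integral>x. g x \<partial>\<mu>)"
    by (rule integral_mono) (use int g(3) g01 in \<open>auto simp: emeasure_eq_measure split: split_indicator\<close>)
  also have "\<dots> \<le> M * (\<integral>x. g x \<partial>circle_meas)"
    by (rule integral_le_of_poisson_integral_le[OF e le g(1,2)]) (use g(4) in auto)
  also have "(\<integral>x. g x \<partial>circle_meas) \<le> (\<integral>x. indicator U x \<partial>circle_meas)"
    by (rule integral_mono)
       (use int g(4) g01 in \<open>auto simp: circle_meas.emeasure_eq_measure split: split_indicator\<close>)
  finally show ?thesis using M by (simp add: mult_left_mono)
qed

lemma measure_le_of_poisson_integral_le:
  assumes V: "open V" and e: "e > 0" and M: "M \<ge> 0"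
    and le: "\<And>z x. z \<in> ball 0 1 \<Longrightarrow> x \<in> V \<Longrightarrow> dist x z < e \<Longrightarrow> poisson_integral \<mu> (\<lambda>_. 1) z \<le> M"
    and A: "A \<in> sets borel" "A \<subseteq> V"
  shows "measure \<mu> A \<le> M * measure circle_meas A"
proof (rule field_le_epsilon)
  fix \<epsilon> :: real assume "\<epsilon> > 0"
  then have \<eta>: "\<epsilon> / (M + 1) > 0" using M by simp
  obtain K where K: "compact K" "K \<subseteq> A" "measure \<mu> (A - K) < \<epsilon> / (M + 1)"
    by (rule inner_compact_approx[OF finite_measure_axioms sets_eq_borel A(1) \<eta>])
  obtain U where U: "open U" "A \<subseteq> U" "measure circle_meas (U - A) < \<epsilon> / (M + 1)"
    by (rule outer_open_approx[OF circle_meas.finite_measure_axioms sets_circle_meas A(1) \<eta>])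
  have [measurable]: "K \<in> sets borel" "U \<in> sets borel" using K U by (auto intro: borel_compact)
  have "measure \<mu> K \<le> M * measure circle_meas U"
    by (rule measure_compact_le_of_poisson_integral_le[OF V e M le K(1)]) (use K U A in auto)
  also have "measure circle_meas U = measure circle_meas A + measure circle_meas (U - A)"
    using circle_meas.finite_measure_Diff[of U A] U A by simp
  also have "M * \<dots> \<le> M * (measure circle_meas A + \<epsilon> / (M + 1))" using U(3) M by (intro mult_left_mono) auto
  finally have "measure \<mu> K \<le> M * measure circle_meas A + M * (\<epsilon> / (M + 1))" by (simp add: distrib_left)
  moreover have "measure \<mu> A = measure \<mu> K + measure \<mu> (A - K)"
    using finite_measure_Diff[of A K] K A by simp
  moreover have "M * (\<epsilon> / (M + 1)) + \<epsilon> / (M + 1) = (M + 1) * (\<epsilon> / (M + 1))" by (simp only: distrib_right mult_1)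
  moreover have "\<dots> = \<epsilon>" using M by simp
  ultimately show "measure \<mu> A \<le> M * measure circle_meas A + \<epsilon>" using K(3) by linarith
qed

end

lemma (in sigma_finite_measure) real_density_of_absolutely_continuous:
  assumes N: "finite_measure N" and ac: "absolutely_continuous M N" "sets N = sets M"
  obtains g where "integrable M g" "\<And>x. g x \<ge> 0" "N = density M (\<lambda>x. ennreal (g x))"
proof -
  interpret N: finite_measure N by fact
  obtain g where g: "g \<in> borel_measurable M" "AE x in M. RN_deriv M N x = ennreal (g x)" "\<And>x. 0 \<le> g x"
    using real_RN_deriv[OF N ac] by metis
  have eq: "N = density M (\<lambda>x. ennreal (g x))"
    using density_RN_deriv[OF ac] density_cong[OF borel_measurable_RN_deriv _ g(2)] g(1) by simp
  have "(\<integral>\<^sup>+x. ennreal (g x) \<partial>M) = emeasure N (space N)"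
    unfolding eq using g(1) by (simp add: emeasure_density cong: nn_integral_cong)
  then have "integrable M g"
    using g by (intro integrableI_nonneg) (auto simp: N.emeasure_eq_measure)
  with g(3) eq show thesis using that by blast
qed

section \<open>Bounded analytic functions\<close>

lemma HinfI: "f holomorphic_on ball 0 1 \<Longrightarrow> (\<And>z. z \<in> ball 0 1 \<Longrightarrow> cmod (f z) \<le> C) \<Longrightarrow> f \<in> Hinf"
  unfolding Hinf_def bounded_iff by blast

lemma Hinf_holomorphic: "f \<in> Hinf \<Longrightarrow> f holomorphic_on ball 0 1"
  by (simp add: Hinf_def)

lemma Hinf_boundedE:
  assumes "f \<in> Hinf" obtains C where "C \<ge> 0" "\<And>z. z \<in> ball 0 1 \<Longrightarrow> cmod (f z) \<le> C"
proof -
  obtain C where "\<And>z. z \<in> ball 0 1 \<Longrightarrow> cmod (f z) \<le> C"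
    using assms unfolding Hinf_def bounded_iff by blast
  moreover from this[of 0] have "C \<ge> 0" using norm_ge_zero[of "f 0"] by (simp del: norm_ge_zero)
  ultimately show thesis using that by blast
qed

lemma Hinf_const [simp]: "(\<lambda>_. c) \<in> Hinf"
  by (rule HinfI) auto

lemma Hinf_mult:
  assumes "f \<in> Hinf" "g \<in> Hinf" shows "(\<lambda>z. f z * g z) \<in> Hinf"
proof -
  obtain B where B: "\<And>z. z \<in> ball 0 1 \<Longrightarrow> cmod (f z) \<le> B" by (rule Hinf_boundedE[OF assms(1)]) (rule that)
  obtain C where C: "\<And>z. z \<in> ball 0 1 \<Longrightarrow> cmod (g z) \<le> C" by (rule Hinf_boundedE[OF assms(2)]) (rule that)
  show ?thesis
  proof (rule HinfI)
    show "(\<lambda>z. f z * g z) holomorphic_on ball 0 1" by (intro holomorphic_intros Hinf_holomorphic assms)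
    show "cmod (f z * g z) \<le> B * C" if "z \<in> ball 0 1" for z
      unfolding norm_mult by (intro mult_mono' B C that norm_ge_zero)
  qed
qed

lemma Hinf_Re_poisson:
  assumes f: "f \<in> Hinf"
  obtains g :: "complex \<Rightarrow> real" where "integrable circle_meas g"
    "\<And>z. z \<in> ball 0 1 \<Longrightarrow> Re (f z) = poisson_integral circle_meas g z"
proof -
  obtain C where C: "C \<ge> 0" "\<And>z. z \<in> ball 0 1 \<Longrightarrow> cmod (f z) \<le> C" using Hinf_boundedE[OF f] by blast
  have Re: "- C \<le> Re (f z)" "Re (f z) \<le> C" if "z \<in> ball 0 1" for z
    using C(2)[OF that] abs_Re_le_cmod[of "f z"] by auto
  obtain \<mu> where \<mu>: "circle_measure \<mu>"
    "\<And>z. z \<in> ball 0 1 \<Longrightarrow> Re (f z + of_real C) = poisson_integral \<mu> (\<lambda>_. 1) z"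
  proof (rule herglotz_representation)
    show "(\<lambda>z. f z + of_real C) holomorphic_on ball 0 1" by (intro holomorphic_intros Hinf_holomorphic f)
    show "Re (f z + of_real C) \<ge> 0" if "z \<in> ball 0 1" for z using Re(1)[OF that] by simp
  qed (rule that)
  interpret \<mu>: circle_measure \<mu> by fact
  have le: "poisson_integral \<mu> (\<lambda>_. 1) z \<le> 2 * C" if "z \<in> ball 0 1" for z
    using \<mu>(2)[OF that] Re(2)[OF that] by simp
  have "measure \<mu> A \<le> 2 * C * measure circle_meas A" if "A \<in> sets borel" for A
    by (rule \<mu>.measure_le_of_poisson_integral_le[of UNIV 1]) (use le C(1) that in auto)
  then have "absolutely_continuous circle_meas \<mu>"
    unfolding absolutely_continuous_def null_sets_def
    by (force simp: \<mu>.emeasure_eq_measure circle_meas.emeasure_eq_measure measure_le_0_iff)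
  then obtain g where g: "integrable circle_meas g" "\<And>\<zeta>. g \<zeta> \<ge> 0" "\<mu> = density circle_meas (\<lambda>\<zeta>. ennreal (g \<zeta>))"
    using circle_meas.real_density_of_absolutely_continuous[OF \<mu>.finite_measure_axioms] by auto
  show thesis
  proof (rule that[of "\<lambda>\<zeta>. g \<zeta> - C"])
    show "integrable circle_meas (\<lambda>\<zeta>. g \<zeta> - C)" using g(1) by auto
    fix z :: complex assume z: "z \<in> ball 0 1"
    have "Re (f z) + C = poisson_integral \<mu> (\<lambda>_. 1) z" using \<mu>(2)[OF z] by simp
    also have "\<dots> = poisson_integral circle_meas g z"
      unfolding g(3) using g by (subst poisson_integral_density) auto
    finally show "Re (f z) = poisson_integral circle_meas (\<lambda>\<zeta>. g \<zeta> - C) z"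
      using circle_meas.poisson_integral_diff[OF g(1), of "\<lambda>_. C" z] z by simp
  qed
qed

theorem Hinf_poisson_representation:
  assumes f: "f \<in> Hinf"
  obtains g :: "complex \<Rightarrow> complex" where "integrable circle_meas g"
    "\<And>z. z \<in> ball 0 1 \<Longrightarrow> f z = poisson_integral circle_meas g z"
    "AE \<zeta> in circle_meas. radial_limit f \<zeta> (g \<zeta>)"
proof -
  obtain u :: "complex \<Rightarrow> real" where u: "integrable circle_meas u"
    "\<And>z. z \<in> ball 0 1 \<Longrightarrow> Re (f z) = poisson_integral circle_meas u z"
    using Hinf_Re_poisson[OF f] by blast
  have "(\<lambda>z. - \<i> * f z) \<in> Hinf" by (intro Hinf_mult Hinf_const f)
  then obtain v :: "complex \<Rightarrow> real" where v: "integrable circle_meas v"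
    "\<And>z. z \<in> ball 0 1 \<Longrightarrow> Re (- \<i> * f z) = poisson_integral circle_meas v z"
    using Hinf_Re_poisson by blast
  have f_eq: "f z = Complex (poisson_integral circle_meas u z) (poisson_integral circle_meas v z)"
    if "z \<in> ball 0 1" for z
    using u(2)[OF that] v(2)[OF that] by (simp add: complex_eq_iff)
  show thesis
  proof (rule that)
    show "integrable circle_meas (\<lambda>\<zeta>. Complex (u \<zeta>) (v \<zeta>))" using u(1) v(1) by (simp add: Complex_eq)
    show "f z = poisson_integral circle_meas (\<lambda>\<zeta>. Complex (u \<zeta>) (v \<zeta>)) z" if "z \<in> ball 0 1" for z
      using f_eq[OF that] circle_meas.poisson_integral_Complex[OF u(1) v(1)] that by simp
    show "AE \<zeta> in circle_meas. radial_limit f \<zeta> (Complex (u \<zeta>) (v \<zeta>))"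
      using poisson_integral_radial_limit[OF u(1)] poisson_integral_radial_limit[OF v(1)] AE_circle_meas_norm
    proof eventually_elim
      case (elim \<zeta>)
      have "radial_limit (\<lambda>z. Complex (poisson_integral circle_meas u z) (poisson_integral circle_meas v z)) \<zeta>
          (Complex (u \<zeta>) (v \<zeta>))"
        by (intro tendsto_Complex elim)
      then show ?case using radial_limit_cong[of \<zeta> f, OF elim(3) f_eq] by simp
    qed
  qed
qed

lemma bdry_eqI:
  assumes "radial_limit f \<zeta> L"
  shows "bdry f \<zeta> = L"
proof -
  have "\<exists>L. radial_limit f \<zeta> L" using assms by blast
  moreover have "Lim (at_left 1) (\<lambda>r::real. f (of_real r * \<zeta>)) = L"
    by (rule tendsto_Lim[OF _ assms]) simp
  ultimately show ?thesis by (simp only: bdry_def if_True)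
qed

corollary Hinf_radial_limit:
  assumes "f \<in> Hinf"
  shows "AE \<zeta> in circle_meas. radial_limit f \<zeta> (bdry f \<zeta>)"
proof -
  obtain g where "AE \<zeta> in circle_meas. radial_limit f \<zeta> (g \<zeta>)"
    using Hinf_poisson_representation[OF assms] by blast
  then show ?thesis by eventually_elim (simp add: bdry_eqI)
qed

lemma bdry_mult:
  assumes "f \<in> Hinf" "g \<in> Hinf"
  shows "AE \<zeta> in circle_meas. bdry (\<lambda>z. f z * g z) \<zeta> = bdry f \<zeta> * bdry g \<zeta>"
  using Hinf_radial_limit[OF assms(1)] Hinf_radial_limit[OF assms(2)]
  by eventually_elim (rule bdry_eqI, rule tendsto_mult)

lemma norm_bdry_le:
  assumes f: "f \<in> Hinf" and C: "\<And>z. z \<in> ball 0 1 \<Longrightarrow> cmod (f z) \<le> C"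
  shows "AE \<zeta> in circle_meas. cmod (bdry f \<zeta>) \<le> C"
  using Hinf_radial_limit[OF f] AE_circle_meas_norm
proof eventually_elim
  case (elim \<zeta>)
  show ?case
    by (rule radial_limit_le[OF tendsto_norm[OF elim(1)] tendsto_const elim(2)]) (rule C)
qed

lemma Hinf_norm_le:
  assumes f: "f \<in> Hinf" and C: "AE \<zeta> in circle_meas. cmod (bdry f \<zeta>) \<le> C" and z: "z \<in> ball 0 1"
  shows "cmod (f z) \<le> C"
proof -
  obtain g where g: "integrable circle_meas g" "\<And>z. z \<in> ball 0 1 \<Longrightarrow> f z = poisson_integral circle_meas g z"
    "AE \<zeta> in circle_meas. radial_limit f \<zeta> (g \<zeta>)"
    using Hinf_poisson_representation[OF f] by blast
  from g(3) C have le: "AE \<zeta> in circle_meas. cmod (g \<zeta>) \<le> C"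
    by eventually_elim (simp add: bdry_eqI)
  show ?thesis
    unfolding g(2)[OF z] by (rule norm_poisson_integral_le_const[OF g(1) le]) (use z in simp)
qed

section \<open>Schur functions and their zeros\<close>

abbreviation moebius :: "complex \<Rightarrow> complex \<Rightarrow> complex" where
  "moebius a \<equiv> Moebius_function 0 a"

lemma moebius_zero [simp]: "moebius 0 = (\<lambda>z. z)"
  by (simp add: fun_eq_iff Moebius_function_simple)

lemma one_minus_cnj_mult_neq_0_disc:
  assumes "cmod a < 1" "cmod z \<le> 1" shows "1 - cnj a * z \<noteq> 0"
proof (rule one_minus_cnj_mult_neq_0)
  have "cmod a * cmod z \<le> cmod a * 1" using assms by (intro mult_left_mono) auto
  then show "cmod a * cmod z < 1" using assms by simp
qed

lemma one_minus_norm_moebius_sq: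
  assumes "1 - cnj a * z \<noteq> 0"
  shows "1 - (cmod (moebius a z))\<^sup>2 = (1 - (cmod a)\<^sup>2) * (1 - (cmod z)\<^sup>2) / (cmod (1 - cnj a * z))\<^sup>2"
proof -
  have "(cmod (1 - cnj a * z))\<^sup>2 - (cmod (z - a))\<^sup>2 = (1 - (cmod a)\<^sup>2) * (1 - (cmod z)\<^sup>2)"
    unfolding cmod_power2 by (simp add: power2_eq_square algebra_simps)
  moreover have "(cmod (1 - cnj a * z))\<^sup>2 \<noteq> 0" using assms by simp
  ultimately show ?thesis
    by (simp add: Moebius_function_simple norm_divide power_divide diff_divide_distrib[symmetric] divide_simps)
qed

lemma norm_moebius_le_1:
  assumes "cmod a < 1" "cmod z \<le> 1" shows "cmod (moebius a z) \<le> 1"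
proof -
  have "0 \<le> (1 - (cmod a)\<^sup>2) * (1 - (cmod z)\<^sup>2) / (cmod (1 - cnj a * z))\<^sup>2"
    using assms by (intro divide_nonneg_nonneg mult_nonneg_nonneg) (auto simp: power_le_one)
  then have "(cmod (moebius a z))\<^sup>2 \<le> 1\<^sup>2"
    using one_minus_norm_moebius_sq[OF one_minus_cnj_mult_neq_0_disc[OF assms]] by simp
  then show ?thesis by (rule power2_le_imp_le) simp
qed

lemma norm_moebius_eq_1:
  assumes "cmod a < 1" "cmod z = 1" shows "cmod (moebius a z) = 1"
proof -
  have "(cmod (moebius a z))\<^sup>2 = 1"
    using one_minus_norm_moebius_sq[OF one_minus_cnj_mult_neq_0_disc[of a z]] assms by simp
  then show ?thesis by (metis norm_ge_zero power2_eq_1_iff neg_0_le_iff_le not_one_le_zero)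
qed

lemma moebius_eq_0_iff: "cmod a < 1 \<Longrightarrow> cmod z \<le> 1 \<Longrightarrow> moebius a z = 0 \<longleftrightarrow> a = z"
  using one_minus_cnj_mult_neq_0_disc[of a z] by (auto simp: Moebius_function_simple)

lemma holomorphic_disc_imp_analytic:
  "f holomorphic_on ball 0 1 \<Longrightarrow> z \<in> ball 0 1 \<Longrightarrow> f analytic_on {z}"
  unfolding analytic_at by (intro exI[of _ "ball 0 1"]) auto

lemma holomorphic_disc_imp_isCont:
  "f holomorphic_on ball 0 1 \<Longrightarrow> z \<in> ball 0 1 \<Longrightarrow> isCont f z"
  by (rule analytic_at_imp_isCont[OF holomorphic_disc_imp_analytic])

lemma zorder_moebius:
  assumes "cmod a < 1" "cmod w < 1"
  shows "zorder (moebius a) w = (if a = w then 1 else 0)"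
proof (cases "a = w")
  case True
  have nz: "1 - cnj a * z \<noteq> 0" if "z \<in> ball 0 1" for z using one_minus_cnj_mult_neq_0_disc assms that by auto
  have "zorder (moebius a) w = 1"
  proof (rule zorder_eqI[of "ball 0 1" _ "\<lambda>z. 1 / (1 - cnj a * z)"])
    show "(\<lambda>z. 1 / (1 - cnj a * z)) holomorphic_on ball 0 1" using nz by (intro holomorphic_intros) auto
  qed (use assms nz True in \<open>auto simp: Moebius_function_simple\<close>)
  then show ?thesis using True by simp
next
  case False
  then show ?thesis using assms
    by (simp add: zorder_eq_0I holomorphic_disc_imp_analytic Moebius_function_holomorphic moebius_eq_0_iff)
qed

definition schur :: "(complex \<Rightarrow> complex) \<Rightarrow> bool" where
  "schur f \<longleftrightarrow> f holomorphic_on ball 0 1 \<and> (\<forall>z\<in>ball 0 1. cmod (f z) \<le> 1)"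

lemma schurD:
  assumes "schur f"
  shows "f holomorphic_on ball 0 1" "z \<in> ball 0 1 \<Longrightarrow> cmod (f z) \<le> 1"
  using assms by (auto simp: schur_def)

lemma schur_norm_le_moebius:
  assumes f: "schur f" and a: "cmod a < 1" "f a = 0" and z: "z \<in> ball 0 1"
  shows "cmod (f z) \<le> cmod (moebius a z)"
proof (cases "f constant_on ball 0 1")
  case True
  then have "f z = f a" using a z by (auto simp: constant_on_def)
  then show ?thesis using a by simp
next
  case False
  have norm_less: "cmod (f w) < 1" if "w \<in> ball 0 1" for w
  proof (rule ccontr)
    assume "\<not> ?thesis"
    then have "cmod (f v) \<le> cmod (f w)" if "v \<in> ball 0 1" for v using schurD(2)[OF f that] by simp
    then have "f constant_on ball 0 1"
      using \<open>w \<in> ball 0 1\<close> by (intro maximum_modulus_principle[OF schurD(1)[OF f], of "ball 0 1" w]) auto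
    with False show False by simp
  qed
  have norm_moebius_less: "cmod (moebius a z) < 1" using Moebius_function_norm_lt_1[of a z 0] a z by simp
  define F where "F = f \<circ> moebius (- a)"
  have "cmod (F (moebius a z)) \<le> cmod (moebius a z)"
  proof (rule Schwarz_Lemma(1))
    show "F holomorphic_on ball 0 1"
      unfolding F_def using a Moebius_function_norm_lt_1
      by (intro holomorphic_on_compose_gen[OF Moebius_function_holomorphic schurD(1)[OF f]]) auto
    show "F 0 = 0" using a by (simp add: F_def Moebius_function_of_zero)
    show "cmod (F w) < 1" if "cmod w < 1" for w
      unfolding F_def o_def using a that by (intro norm_less) (simp add: Moebius_function_norm_lt_1)
  qed (rule norm_moebius_less)
  then show ?thesis
    using Moebius_function_compose[of "- a" a z] a z by (simp add: F_def)
qed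

lemma isCont_norm_le:
  fixes g :: "complex \<Rightarrow> complex"
  assumes "isCont g w" "eventually (\<lambda>z. cmod (g z) \<le> C) (at w)"
  shows "cmod (g w) \<le> C"
proof (rule tendsto_upperbound)
  show "((\<lambda>z. cmod (g z)) \<longlongrightarrow> cmod (g w)) (at w)" using assms(1) by (intro tendsto_norm) (simp add: isCont_def)
qed (use assms(2) in auto)

lemma schur_divide_moebius:
  assumes f: "schur f" and a: "cmod a < 1" "f a = 0"
  obtains g where "schur g" "\<And>z. z \<in> ball 0 1 \<Longrightarrow> f z = moebius a z * g z"
proof -
  define q where "q z = (if z = a then deriv f a else f z / (z - a))" for z
  have q: "q holomorphic_on ball 0 1"
  proof -
    have "(\<lambda>z. if z = a then deriv f a else f z / (z - a) - f a / (z - a)) holomorphic_on ball 0 1"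
      by (rule pole_theorem_open[OF schurD(1)[OF f]]) auto
    then show ?thesis using a(2) by (simp add: q_def[abs_def] cong: if_cong)
  qed
  define g where "g z = (1 - cnj a * z) * q z" for z
  have g: "g holomorphic_on ball 0 1" unfolding g_def by (intro holomorphic_intros q)
  have fg: "f z = moebius a z * g z" if "z \<in> ball 0 1" for z
    using one_minus_cnj_mult_neq_0_disc[of a z] a that by (auto simp: g_def q_def Moebius_function_simple)
  have off: "cmod (g z) \<le> 1" if "z \<in> ball 0 1" "z \<noteq> a" for z
  proof -
    have "cmod (moebius a z) * cmod (g z) \<le> cmod (moebius a z) * 1"
      using schur_norm_le_moebius[OF f a that(1)] fg[OF that(1)] by (simp add: norm_mult)
    moreover have "moebius a z \<noteq> 0" using that a by (simp add: moebius_eq_0_iff)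
    ultimately show ?thesis by simp
  qed
  have "cmod (g a) \<le> 1"
  proof (rule isCont_norm_le[of a g])
    show "isCont g a" using a by (intro holomorphic_disc_imp_isCont g) simp
    have "eventually (\<lambda>z. z \<in> ball 0 1 - {a}) (at a)" using a by (intro eventually_at_in_open) auto
    then show "eventually (\<lambda>z. cmod (g z) \<le> 1) (at a)" by eventually_elim (use off in auto)
  qed
  with off g have "schur g" unfolding schur_def by blast
  then show thesis using that fg by blast
qed

lemma zorder_disc_cases:
  assumes "f holomorphic_on ball 0 1" "z\<^sub>0 \<in> ball 0 1" "f z\<^sub>0 \<noteq> 0" "w \<in> ball 0 1"
  shows "zorder f w \<ge> 0" "f w = 0 \<longleftrightarrow> zorder f w > 0"
  using zorder_exist_zero[OF assms(1) open_ball connected_ball assms(4)] assms(2,3)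
  by (metis (mono_tags, lifting) less_imp_le order_refl order_less_irrefl)+

lemma eventually_nonzero_disc:
  assumes "f holomorphic_on ball 0 1" "z\<^sub>0 \<in> ball 0 1" "f z\<^sub>0 \<noteq> 0" "w \<in> ball 0 1"
  shows "eventually (\<lambda>z. f z \<noteq> 0 \<and> z \<in> ball 0 1) (at w)"
  by (rule non_zero_neighbour_alt[OF assms(1) open_ball connected_ball assms(4,2,3)])

lemma zorder_disc_mult:
  assumes "f holomorphic_on ball 0 1" "g holomorphic_on ball 0 1" and eq: "\<And>z. z \<in> ball 0 1 \<Longrightarrow> k z = f z * g z"
    and k: "z\<^sub>0 \<in> ball 0 1" "k z\<^sub>0 \<noteq> 0" and w: "w \<in> ball 0 1"
  shows "zorder k w = zorder f w + zorder g w"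
proof -
  have "(\<lambda>z. f z * g z) holomorphic_on ball 0 1" by (intro holomorphic_intros assms)
  then have ev: "eventually (\<lambda>z. f z * g z \<noteq> 0 \<and> z \<in> ball 0 1) (at w)"
    by (rule eventually_nonzero_disc[OF _ k(1) _ w]) (use eq k in auto)
  then have "zorder k w = zorder (\<lambda>z. f z * g z) w"
    by (intro zorder_cong) (auto elim!: eventually_mono simp: eq)
  also have "\<dots> = zorder f w + zorder g w"
    using ev by (intro zorder_times_analytic holomorphic_disc_imp_analytic assms w) (auto elim: eventually_mono)
  finally show ?thesis .
qed

lemma schur_norm_le_prod_moebius:
  assumes "finite F" "schur f" "z\<^sub>0 \<in> ball 0 1" "f z\<^sub>0 \<noteq> 0" "\<And>i. i \<in> F \<Longrightarrow> cmod (a i) < 1"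
    and "\<And>w. w \<in> ball 0 1 \<Longrightarrow> int (card {i\<in>F. a i = w}) \<le> zorder f w" and z: "z \<in> ball 0 1"
  shows "cmod (f z) \<le> (\<Prod>i\<in>F. cmod (moebius (a i) z))"
  using assms(1-6)
proof (induction F arbitrary: f rule: finite_induct)
  case empty
  then show ?case using schurD(2) z by simp
next
  case (insert j F)
  note f = insert.prems(1-3)
  have aj: "cmod (a j) < 1" using insert.prems by simp
  have card: "card {i\<in>insert j F. a i = w} = (if a j = w then 1 else 0) + card {i\<in>F. a i = w}" for w
  proof (cases "a j = w")
    case True
    then have "{i\<in>insert j F. a i = w} = insert j {i\<in>F. a i = w}" by auto
    then show ?thesis using insert.hyps True by simp
  next
    case False
    then have "{i\<in>insert j F. a i = w} = {i\<in>F. a i = w}" by auto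
    then show ?thesis using False by simp
  qed
  then have "zorder f (a j) > 0" using insert.prems(5)[of "a j"] aj by simp
  then have "f (a j) = 0" using zorder_disc_cases(2)[OF schurD(1)[OF f(1)] f(2,3)] aj by simp
  then obtain g where g: "schur g" "\<And>z. z \<in> ball 0 1 \<Longrightarrow> f z = moebius (a j) z * g z"
    using schur_divide_moebius[OF f(1) aj] by blast
  have "cmod (g z) \<le> (\<Prod>i\<in>F. cmod (moebius (a i) z))"
  proof (rule insert.IH[OF g(1) f(2)])
    show "g z\<^sub>0 \<noteq> 0" using f(2,3) g(2) by auto
    fix w :: complex assume w: "w \<in> ball 0 1"
    have "zorder f w = zorder (moebius (a j)) w + zorder g w"
      by (rule zorder_disc_mult[OF Moebius_function_holomorphic[OF aj] schurD(1)[OF g(1)] g(2) f(2,3) w])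
    then show "int (card {i\<in>F. a i = w}) \<le> zorder g w"
      using insert.prems(5)[OF w] card[of w] zorder_moebius[OF aj, of w] w by (simp split: if_splits)
  qed (use insert.prems in auto)
  then show ?case
    using insert.hyps g(2)[OF z] by (simp add: norm_mult mult_left_mono)
qed

text \<open>Indexing by a subset \<open>N\<close> of the naturals also covers functions with finitely many zeros.\<close>
definition enumerates_zeros :: "(complex \<Rightarrow> complex) \<Rightarrow> nat set \<Rightarrow> (nat \<Rightarrow> complex) \<Rightarrow> bool" where
  "enumerates_zeros f N a \<longleftrightarrow> (\<forall>n\<in>N. cmod (a n) < 1) \<and>
    (\<forall>w\<in>ball 0 1. finite {n\<in>N. a n = w} \<and> int (card {n\<in>N. a n = w}) = zorder f w)"

lemma enumerates_zerosD:
  assumes "enumerates_zeros f N a"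
  shows "n \<in> N \<Longrightarrow> cmod (a n) < 1" "w \<in> ball 0 1 \<Longrightarrow> finite {n\<in>N. a n = w}"
    "w \<in> ball 0 1 \<Longrightarrow> int (card {n\<in>N. a n = w}) = zorder f w"
  using assms unfolding enumerates_zeros_def by blast+

lemma countable_zeros_disc:
  assumes f: "f holomorphic_on ball 0 1" "z\<^sub>0 \<in> ball 0 1" "f z\<^sub>0 \<noteq> 0"
  shows "countable {z\<in>ball 0 1. f z = 0}"
proof (cases "f constant_on ball 0 1")
  case True
  then have "{z\<in>ball 0 1. f z = 0} = {}" using f by (auto simp: constant_on_def)
  then show ?thesis by (simp only: countable_empty)
next
  case False
  obtain C :: "nat \<Rightarrow> complex set" where C: "\<And>n. compact (C n)" "\<And>n. C n \<subseteq> ball 0 1" "(\<Union>n. C n) = ball 0 1"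
    using open_Union_compact_subsets[of "ball (0::complex) 1"] by (metis open_ball)
  have "finite {z\<in>C n. f z = 0}" for n
    by (rule holomorphic_compact_finite_zeros[OF f(1)]) (use C False in auto)
  then have "countable (\<Union>n. {z\<in>C n. f z = 0})" by (intro countable_UN) (auto intro: countable_finite)
  moreover have "{z\<in>ball 0 1. f z = 0} = (\<Union>n. {z\<in>C n. f z = 0})" using C(3) by auto
  ultimately show ?thesis by simp
qed

lemma enumerates_zeros_exists:
  assumes f: "f holomorphic_on ball 0 1" "z\<^sub>0 \<in> ball 0 1" "f z\<^sub>0 \<noteq> 0"
  obtains N a where "enumerates_zeros f N a"
proof -
  define P where "P = (SIGMA w:{z\<in>ball 0 1. f z = 0}. {..<nat (zorder f w)})"
  have "countable P" unfolding P_def using countable_zeros_disc[OF f] by (intro countable_SIGMA) auto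
  define N where "N = to_nat_on P ` P"
  define a where "a n = fst (from_nat_into P n)" for n
  have a: "a (to_nat_on P p) = fst p" if "p \<in> P" for p using that \<open>countable P\<close> by (simp add: a_def)
  have "finite {n\<in>N. a n = w} \<and> int (card {n\<in>N. a n = w}) = zorder f w" if w: "w \<in> ball 0 1" for w
  proof -
    have "{p\<in>P. fst p = w} = Pair w ` {..<nat (zorder f w)}"
      using zorder_disc_cases[OF f w] w by (auto simp: P_def)
    moreover have "{n\<in>N. a n = w} = to_nat_on P ` {p\<in>P. fst p = w}" using a by (auto simp: N_def)
    moreover have "inj_on (to_nat_on P) {p\<in>P. fst p = w}"
      using inj_on_to_nat_on[OF \<open>countable P\<close>] by (rule inj_on_subset) auto
    ultimately show ?thesis
      using zorder_disc_cases(1)[OF f w] by (simp add: card_image inj_on_def)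
  qed
  moreover have "cmod (a n) < 1" if "n \<in> N" for n
    using that a by (auto simp: N_def P_def)
  ultimately show thesis using that[of N a] by (simp add: enumerates_zeros_def)
qed

lemma enumerates_zeros_eq_0_iff:
  assumes f: "f holomorphic_on ball 0 1" "z\<^sub>0 \<in> ball 0 1" "f z\<^sub>0 \<noteq> 0" and N: "enumerates_zeros f N a"
    and w: "w \<in> ball 0 1"
  shows "f w = 0 \<longleftrightarrow> (\<exists>n\<in>N. a n = w)"
proof -
  note enumerates_zerosD(2,3)[OF N w]
  then have "zorder f w > 0 \<longleftrightarrow> {n\<in>N. a n = w} \<noteq> {}" by (metis card_gt_0_iff of_nat_0_less_iff)
  then show ?thesis using zorder_disc_cases(2)[OF f w] by blast
qed

lemma schur_norm_le_prod_zeros: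
  assumes f: "schur f" "z\<^sub>0 \<in> ball 0 1" "f z\<^sub>0 \<noteq> 0" and N: "enumerates_zeros f N a"
    and F: "finite F" "F \<subseteq> N" and z: "z \<in> ball 0 1"
  shows "cmod (f z) \<le> (\<Prod>i\<in>F. cmod (moebius (a i) z))"
proof (rule schur_norm_le_prod_moebius[OF F(1) f _ _ z])
  show "cmod (a i) < 1" if "i \<in> F" for i using enumerates_zerosD(1)[OF N] F that by blast
  fix w :: complex assume w: "w \<in> ball 0 1"
  have "card {i\<in>F. a i = w} \<le> card {n\<in>N. a n = w}"
    using F by (intro card_mono enumerates_zerosD(2)[OF N w]) auto
  then show "int (card {i\<in>F. a i = w}) \<le> zorder f w" using enumerates_zerosD(3)[OF N w] by simp
qed

lemma one_minus_norm_le_ln_moebius: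
  assumes a: "cmod a < 1" and z: "cmod z < 1" and nz: "moebius a z \<noteq> 0"
  shows "(1 - (cmod z)\<^sup>2) / 4 * (1 - cmod a) \<le> - 2 * ln (cmod (moebius a z))"
proof -
  have denominator_nz: "1 - cnj a * z \<noteq> 0" using one_minus_cnj_mult_neq_0_disc a z by simp
  have "cmod (cnj a * z) \<le> 1 * 1" unfolding norm_mult using a z by (intro mult_mono) auto
  then have "cmod (1 - cnj a * z) \<le> 2" using norm_triangle_ineq4[of 1 "cnj a * z"] by simp
  then have "(cmod (1 - cnj a * z))\<^sup>2 \<le> 2\<^sup>2" by (intro power_mono) auto
  moreover have "(cmod a)\<^sup>2 \<le> cmod a" using a by (simp add: power2_eq_square mult_left_le)
  moreover have "0 \<le> 1 - (cmod z)\<^sup>2" using z by (simp add: power_le_one)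
  ultimately have "(1 - cmod a) * (1 - (cmod z)\<^sup>2) / 2\<^sup>2 \<le>
      (1 - (cmod a)\<^sup>2) * (1 - (cmod z)\<^sup>2) / (cmod (1 - cnj a * z))\<^sup>2"
    using a denominator_nz by (intro frac_le mult_right_mono) auto
  also have "\<dots> = 1 - (cmod (moebius a z))\<^sup>2" using one_minus_norm_moebius_sq[OF denominator_nz] by simp
  also have "\<dots> \<le> - ln ((cmod (moebius a z))\<^sup>2)"
    using ln_le_minus_one[of "(cmod (moebius a z))\<^sup>2"] nz by simp
  also have "\<dots> = - 2 * ln (cmod (moebius a z))" using nz by (simp add: ln_realpow)
  finally show ?thesis by (simp add: mult.commute)
qed

theorem blaschke_condition:
  assumes f: "schur f" "z\<^sub>0 \<in> ball 0 1" "f z\<^sub>0 \<noteq> 0" and N: "enumerates_zeros f N a"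
  shows "summable (\<lambda>n. if n \<in> N then 1 - cmod (a n) else 0)"
proof (rule summableI_nonneg_bounded)
  show "0 \<le> (if n \<in> N then 1 - cmod (a n) else 0)" for n
    using enumerates_zerosD(1)[OF N, of n] by (simp add: less_imp_le)
  define \<kappa> where "\<kappa> = (1 - (cmod z\<^sub>0)\<^sup>2) / 4"
  have \<kappa>: "\<kappa> > 0" using f(2) by (simp add: \<kappa>_def power_less_one_iff abs_square_less_1)
  fix n
  define F where "F = {..<n} \<inter> N"
  have F: "finite F" "F \<subseteq> N" by (auto simp: F_def)
  have le: "cmod (f z\<^sub>0) \<le> (\<Prod>i\<in>F. cmod (moebius (a i) z\<^sub>0))" by (rule schur_norm_le_prod_zeros[OF f N F f(2)])
  then have pos: "(\<Prod>i\<in>F. cmod (moebius (a i) z\<^sub>0)) > 0" using f(3) by (meson order_less_le_trans zero_less_norm_iff)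
  then have nz: "moebius (a i) z\<^sub>0 \<noteq> 0" if "i \<in> F" for i using that F(1) by (metis less_irrefl norm_zero prod_zero)
  have "(\<Sum>i\<in>F. \<kappa> * (1 - cmod (a i))) \<le> (\<Sum>i\<in>F. - 2 * ln (cmod (moebius (a i) z\<^sub>0)))"
    unfolding \<kappa>_def using enumerates_zerosD(1)[OF N] F f(2) nz
    by (intro sum_mono one_minus_norm_le_ln_moebius) auto
  also have "\<dots> = - 2 * ln (\<Prod>i\<in>F. cmod (moebius (a i) z\<^sub>0))"
    using nz F(1) by (subst ln_prod) (auto simp: sum_distrib_left)
  also have "\<dots> \<le> - 2 * ln (cmod (f z\<^sub>0))" using le pos f(3) by simp
  finally have "\<kappa> * (\<Sum>i\<in>F. 1 - cmod (a i)) \<le> - 2 * ln (cmod (f z\<^sub>0))" by (simp add: sum_distrib_left)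
  moreover have "(\<Sum>i<n. if i \<in> N then 1 - cmod (a i) else 0) = (\<Sum>i\<in>F. 1 - cmod (a i))"
    unfolding F_def by (simp add: sum.inter_restrict)
  ultimately show "(\<Sum>i<n. if i \<in> N then 1 - cmod (a i) else 0) \<le> - 2 * ln (cmod (f z\<^sub>0)) / \<kappa>"
    using \<kappa> by (simp add: field_simps)
qed

section \<open>Blaschke products\<close>

lemma blaschke_factor_eq_moebius: "blaschke_factor a z = - (of_real (cmod a) / a) * moebius a z"
  by (simp add: blaschke_factor_def Moebius_function_simple divide_inverse algebra_simps)

lemma norm_blaschke_factor: "a \<noteq> 0 \<Longrightarrow> cmod (blaschke_factor a z) = cmod (moebius a z)"
  by (simp add: blaschke_factor_eq_moebius norm_mult norm_divide)

lemma blaschke_factor_minus_1_le: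
  assumes b: "b \<noteq> 0" "cmod b < 1" and e: "e > 0" "e \<le> cmod (1 - cnj b * w)"
  shows "cmod (blaschke_factor b w - 1) \<le> (1 + cmod w) / e * (1 - cmod b)"
proof -
  have nz: "1 - cnj b * w \<noteq> 0" using e by auto
  have norm_sq: "b * cnj b = of_real (cmod b) * of_real (cmod b)"
    using complex_norm_square[of b] by (simp add: power2_eq_square)
  have "blaschke_factor b w - 1 = (of_real (cmod b) * (b - w) - b * (1 - cnj b * w)) / (b * (1 - cnj b * w))"
    using b nz by (simp add: blaschke_factor_def diff_divide_distrib)
  also have "of_real (cmod b) * (b - w) - b * (1 - cnj b * w) = - (of_real (1 - cmod b) * (b + of_real (cmod b) * w))"
    using norm_sq by (simp add: algebra_simps)
  finally have "cmod (blaschke_factor b w - 1) =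
      (1 - cmod b) * cmod (b + of_real (cmod b) * w) / (cmod b * cmod (1 - cnj b * w))"
    using b by (simp only: norm_divide norm_mult norm_minus_cancel norm_of_real)
  also have "\<dots> \<le> (1 - cmod b) * (cmod b * (1 + cmod w)) / (cmod b * e)"
  proof (intro frac_le mult_left_mono)
    show "cmod (b + of_real (cmod b) * w) \<le> cmod b * (1 + cmod w)"
      using norm_triangle_ineq[of b "of_real (cmod b) * w"] by (simp add: norm_mult algebra_simps)
  qed (use b e in auto)
  also have "\<dots> = (1 + cmod w) / e * (1 - cmod b)" using b e by (simp add: field_simps)
  finally show ?thesis .
qed

locale blaschke_zeros =
  fixes N :: "nat set" and a :: "nat \<Rightarrow> complex"
  assumes zeros_in_disc: "\<And>n. n \<in> N \<Longrightarrow> a n \<noteq> 0 \<and> cmod (a n) < 1"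
    and summable_a: "summable (\<lambda>n. if n \<in> N then 1 - cmod (a n) else 0)"
begin

definition factor :: "nat \<Rightarrow> complex \<Rightarrow> complex" where
  "factor n z = (if n \<in> N then blaschke_factor (a n) z else 1)"

definition bprod :: "complex \<Rightarrow> complex" where
  "bprod z = (\<Prod>n. factor n z)"

text \<open>The points at a positive distance from the reflected zeros \<open>1 / cnj (a n)\<close>, which are the poles of the factors.\<close>
definition regular :: "complex set" where
  "regular = {z. \<exists>e>0. \<forall>n\<in>N. e \<le> cmod (1 - cnj (a n) * z)}"

lemma regular_perturb:
  assumes "\<forall>n\<in>N. e \<le> cmod (1 - cnj (a n) * z)" "dist z w \<le> e / 2" "n \<in> N"
  shows "e / 2 \<le> cmod (1 - cnj (a n) * w)"
proof -
  have "cmod (cnj (a n) * (w - z)) \<le> 1 * (e / 2)"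
    unfolding norm_mult using zeros_in_disc[OF assms(3)] assms(2)
    by (intro mult_mono) (auto simp: dist_norm norm_minus_commute)
  moreover have "cmod (1 - cnj (a n) * z) - cmod (cnj (a n) * (w - z)) \<le> cmod (1 - cnj (a n) * w)"
    using norm_triangle_ineq2[of "1 - cnj (a n) * z" "cnj (a n) * (w - z)"] by (simp add: algebra_simps)
  moreover have "e \<le> cmod (1 - cnj (a n) * z)" using assms(1,3) by blast
  ultimately show ?thesis by linarith
qed

lemma open_regular: "open regular"
  unfolding open_contains_ball
proof
  fix z assume "z \<in> regular"
  then obtain e where e: "e > 0" "\<forall>n\<in>N. e \<le> cmod (1 - cnj (a n) * z)" by (auto simp: regular_def)
  have "w \<in> regular" if "w \<in> ball z (e/2)" for w
    using regular_perturb[OF e(2), of w] that e(1) by (auto simp: regular_def intro!: exI[of _ "e/2"])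
  then show "\<exists>d>0. ball z d \<subseteq> regular" using e(1) by (intro exI[of _ "e/2"]) auto
qed

lemma disc_subset_regular: "ball 0 1 \<subseteq> regular"
proof
  fix z :: complex assume z: "z \<in> ball 0 1"
  have "1 - cmod z \<le> cmod (1 - cnj (a n) * z)" if "n \<in> N" for n
  proof -
    have "cmod (cnj (a n) * z) \<le> 1 * cmod z"
      unfolding norm_mult using zeros_in_disc[OF that] by (intro mult_right_mono) auto
    then show ?thesis using norm_triangle_ineq2[of 1 "cnj (a n) * z"] by simp
  qed
  then show "z \<in> regular" unfolding regular_def using z by (auto intro!: exI[of _ "1 - cmod z"])
qed

lemma circle_regularI:
  assumes "cmod \<zeta> = 1" "e > 0" "\<And>n. n \<in> N \<Longrightarrow> e \<le> dist (a n) \<zeta>"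
  shows "\<zeta> \<in> regular"
proof -
  have "cmod (1 - cnj (a n) * \<zeta>) = dist (a n) \<zeta>" for n
  proof -
    have "1 - cnj (a n) * \<zeta> = \<zeta> * cnj (\<zeta> - a n)"
      using complex_norm_square[of \<zeta>] assms(1) by (simp add: algebra_simps)
    then show ?thesis
      using assms(1) by (simp only: norm_mult complex_mod_cnj dist_norm norm_minus_commute mult_1)
  qed
  then show ?thesis using assms(2,3) by (auto simp: regular_def)
qed

lemma factor_minus_1_le:
  assumes "e > 0" "\<And>n. n \<in> N \<Longrightarrow> e \<le> cmod (1 - cnj (a n) * w)"
  shows "cmod (factor n w - 1) \<le> (1 + cmod w) / e * (if n \<in> N then 1 - cmod (a n) else 0)"
  using blaschke_factor_minus_1_le[of "a n" e w] assms zeros_in_disc[of n] by (simp add: factor_def)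

lemma factor_has_prod:
  assumes "z \<in> regular" shows "(\<lambda>n. factor n z) has_prod bprod z"
proof -
  obtain e where e: "e > 0" "\<And>n. n \<in> N \<Longrightarrow> e \<le> cmod (1 - cnj (a n) * z)"
    using assms by (auto simp: regular_def)
  have "summable (\<lambda>n. (1 + cmod z) / e * (if n \<in> N then 1 - cmod (a n) else 0))"
    by (intro summable_mult summable_a)
  then have "summable (\<lambda>n. norm (factor n z - 1))"
    by (rule summable_comparison_test'[of _ 0]) (use factor_minus_1_le[OF e] in simp)
  then have "convergent_prod (\<lambda>n. factor n z)"
    by (metis abs_convergent_prod_conv_summable abs_convergent_prod_imp_convergent_prod)
  then show ?thesis unfolding bprod_def by (rule convergent_prod_has_prod)
qed

lemma factor_has_prod_disc: "z \<in> ball 0 1 \<Longrightarrow> (\<lambda>n. factor n z) has_prod bprod z"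
  using factor_has_prod disc_subset_regular by blast

lemma factor_holomorphic: "factor n holomorphic_on regular"
proof (cases "n \<in> N")
  case True
  have nz: "1 - cnj (a n) * z \<noteq> 0" if "z \<in> regular" for z
    using that True by (force simp: regular_def)
  then have "(\<lambda>z. (of_real (cmod (a n)) / a n) * (a n - z) / (1 - cnj (a n) * z)) holomorphic_on regular"
    using zeros_in_disc[OF True] by (intro holomorphic_intros) auto
  then show ?thesis using True by (simp add: factor_def[abs_def] blaschke_factor_def[abs_def])
qed (simp add: factor_def[abs_def])

lemma uniform_limit_bprod:
  assumes d: "d > 0" "cball z d \<subseteq> regular" and e: "e > 0" "\<And>w n. w \<in> cball z d \<Longrightarrow> n \<in> N \<Longrightarrow> e \<le> cmod (1 - cnj (a n) * w)"
  shows "uniform_limit (cball z d) (\<lambda>n w. \<Prod>k<n. factor k w) bprod sequentially"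
proof -
  define C where "C = (1 + (cmod z + d)) / e"
  have bound: "cmod (factor n w - 1) \<le> C * (if n \<in> N then 1 - cmod (a n) else 0)" if w: "w \<in> cball z d" for n w
  proof -
    have "cmod w \<le> cmod z + d" using w norm_triangle_ineq2[of w z] by (simp add: dist_norm norm_minus_commute)
    then have "(1 + cmod w) / e \<le> C" unfolding C_def using e(1) by (intro divide_right_mono) auto
    then have "(1 + cmod w) / e * (if n \<in> N then 1 - cmod (a n) else 0) \<le> C * (if n \<in> N then 1 - cmod (a n) else 0)"
      using zeros_in_disc[of n] by (intro mult_right_mono) auto
    moreover have "cmod (factor n w - 1) \<le> (1 + cmod w) / e * (if n \<in> N then 1 - cmod (a n) else 0)"
      by (rule factor_minus_1_le[OF e(1)]) (rule e(2)[OF w])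
    ultimately show ?thesis by linarith
  qed
  have "uniformly_convergent_on (cball z d) (\<lambda>n w. \<Sum>k<n. norm (factor k w - 1))"
    by (rule Weierstrass_m_test'[where M="\<lambda>n. C * (if n \<in> N then 1 - cmod (a n) else 0)"])
       (use bound in \<open>auto intro!: summable_mult summable_a\<close>)
  then have "uniformly_convergent_on (cball z d) (\<lambda>n w. \<Prod>k<n. factor k w)"
    by (intro uniformly_convergent_on_prod' holomorphic_on_imp_continuous_on
        holomorphic_on_subset[OF factor_holomorphic d(2)]) auto
  then obtain l where l: "uniform_limit (cball z d) (\<lambda>n w. \<Prod>k<n. factor k w) l sequentially"
    by (auto simp: uniformly_convergent_on_def)
  have "l w = bprod w" if "w \<in> cball z d" for w
    using tendsto_uniform_limitI[OF l that] has_prod_imp_tendsto'[OF factor_has_prod] that d(2)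
    by (intro LIMSEQ_unique) auto
  then show ?thesis using l uniform_limit_cong' by (metis (mono_tags, lifting))
qed

lemma bprod_holomorphic: "bprod holomorphic_on regular"
proof (rule holomorphic_uniform_sequence[OF open_regular])
  show "(\<lambda>z. \<Prod>k<n. factor k z) holomorphic_on regular" for n
    by (intro holomorphic_intros factor_holomorphic)
  fix z assume z: "z \<in> regular"
  then obtain e where e: "e > 0" "\<forall>n\<in>N. e \<le> cmod (1 - cnj (a n) * z)" by (auto simp: regular_def)
  obtain d\<^sub>0 where d\<^sub>0: "d\<^sub>0 > 0" "cball z d\<^sub>0 \<subseteq> regular" using open_regular z by (meson open_contains_cball)
  define d where "d = min d\<^sub>0 (e/2)"
  have d: "d > 0" "cball z d \<subseteq> regular" using d\<^sub>0 e by (auto simp: d_def subset_iff)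
  have "uniform_limit (cball z d) (\<lambda>n w. \<Prod>k<n. factor k w) bprod sequentially"
    by (rule uniform_limit_bprod[OF d, of "e/2"]) (use e regular_perturb[OF e(2)] in \<open>auto simp: d_def\<close>)
  then show "\<exists>d>0. cball z d \<subseteq> regular \<and> uniform_limit (cball z d) (\<lambda>n w. \<Prod>k<n. factor k w) bprod sequentially"
    using d by blast
qed

lemma bprod_holomorphic_disc: "bprod holomorphic_on ball 0 1"
  by (rule holomorphic_on_subset[OF bprod_holomorphic disc_subset_regular])

lemma norm_bprod_eq_1:
  assumes "\<zeta> \<in> regular" "cmod \<zeta> = 1" shows "cmod (bprod \<zeta>) = 1"
proof -
  have "(\<lambda>n. cmod (factor n \<zeta>)) has_prod cmod (bprod \<zeta>)" by (rule has_prod_norm[OF factor_has_prod[OF assms(1)]])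
  moreover have "cmod (factor n \<zeta>) = 1" for n
    using assms zeros_in_disc[of n] by (auto simp: factor_def norm_blaschke_factor norm_moebius_eq_1)
  ultimately show ?thesis by (metis has_prod_cong has_prod_one has_prod_unique2)
qed

lemma norm_bprod_ge:
  assumes z: "z \<in> ball 0 1" and le: "\<And>F. finite F \<Longrightarrow> F \<subseteq> N \<Longrightarrow> c \<le> (\<Prod>i\<in>F. cmod (moebius (a i) z))"
  shows "c \<le> cmod (bprod z)"
proof (rule LIMSEQ_le_const)
  show "(\<lambda>n. cmod (\<Prod>k<n. factor k z)) \<longlonglongrightarrow> cmod (bprod z)"
    by (intro tendsto_norm has_prod_imp_tendsto' factor_has_prod_disc z)
  have "c \<le> cmod (\<Prod>k<n. factor k z)" for n
  proof -
    have "c \<le> (\<Prod>i\<in>{..<n} \<inter> N. cmod (moebius (a i) z))" by (rule le) auto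
    also have "\<dots> = (\<Prod>k<n. cmod (factor k z))"
      using zeros_in_disc by (subst prod.inter_restrict) (auto simp: factor_def norm_blaschke_factor intro!: prod.cong)
    finally show ?thesis by (simp add: prod_norm)
  qed
  then show "\<exists>n\<^sub>0. \<forall>n\<ge>n\<^sub>0. c \<le> cmod (\<Prod>k<n. factor k z)" by blast
qed

lemma norm_bprod_le_1:
  assumes z: "z \<in> ball 0 1" shows "cmod (bprod z) \<le> 1"
proof -
  have "cmod (factor n z) \<le> 1" for n
    using zeros_in_disc[of n] z by (auto simp: factor_def norm_blaschke_factor intro!: norm_moebius_le_1)
  then have "cmod (\<Prod>k<n. factor k z) \<le> 1" for n
    by (subst prod_norm[symmetric]) (auto intro!: prod_le_1)
  moreover have "(\<lambda>n. cmod (\<Prod>k<n. factor k z)) \<longlonglongrightarrow> cmod (bprod z)"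
    by (intro tendsto_norm has_prod_imp_tendsto' factor_has_prod_disc z)
  ultimately show ?thesis by (intro LIMSEQ_le_const2) auto
qed

lemma bprod_eq_0_iff:
  assumes "z \<in> ball 0 1" shows "bprod z = 0 \<longleftrightarrow> (\<exists>n\<in>N. a n = z)"
proof -
  have "bprod z = 0 \<longleftrightarrow> (\<exists>n. factor n z = 0)"
    unfolding has_prod_eq_0_iff[OF factor_has_prod_disc[OF assms]] by force
  also have "\<dots> \<longleftrightarrow> (\<exists>n\<in>N. a n = z)"
    using zeros_in_disc assms moebius_eq_0_iff[of _ z]
    by (auto simp: factor_def blaschke_factor_eq_moebius split: if_splits)
  finally show ?thesis .
qed

lemma blaschke_bprod: "blaschke (\<lambda>z. z ^ m * bprod z)"
  unfolding blaschke_def bprod_def factor_def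
  using zeros_in_disc summable_a by (intro exI[of _ m] exI[of _ N] exI[of _ a]) auto

end

lemma (in blaschke_zeros) bprod_remove_finite:
  assumes S: "finite S" "S \<subseteq> N"
  shows "blaschke_zeros (N - S) a"
    and "z \<in> ball 0 1 \<Longrightarrow> bprod z = (\<Prod>n\<in>S. blaschke_factor (a n) z) * blaschke_zeros.bprod (N - S) a z"
proof -
  show "blaschke_zeros (N - S) a"
  proof
    show "summable (\<lambda>n. if n \<in> N - S then 1 - cmod (a n) else 0)"
      by (rule summable_comparison_test'[OF summable_a, of 0]) (use zeros_in_disc in \<open>auto simp: less_imp_le\<close>)
  qed (use zeros_in_disc in auto)
  then interpret rest: blaschke_zeros "N - S" a .
  assume z: "z \<in> ball 0 1"
  have "(\<lambda>n. (if n \<in> S then blaschke_factor (a n) z else 1) * rest.factor n z)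
      has_prod ((\<Prod>n\<in>S. blaschke_factor (a n) z) * rest.bprod z)"
    by (intro has_prod_mult has_prod_If_finite_set rest.factor_has_prod_disc S z)
  moreover have "(if n \<in> S then blaschke_factor (a n) z else 1) * rest.factor n z = factor n z" for n
    using S by (auto simp: factor_def rest.factor_def)
  ultimately show "bprod z = (\<Prod>n\<in>S. blaschke_factor (a n) z) * rest.bprod z"
    using has_prod_unique2[OF factor_has_prod_disc[OF z]] by simp
qed

lemma (in blaschke_zeros) zorder_bprod:
  assumes w: "w \<in> ball 0 1" and fin: "finite {n\<in>N. a n = w}" and nz: "z\<^sub>0 \<in> ball 0 1" "bprod z\<^sub>0 \<noteq> 0"
  shows "zorder bprod w = int (card {n\<in>N. a n = w})"
proof -
  define S where "S = {n\<in>N. a n = w}"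
  have S: "finite S" "S \<subseteq> N" using fin by (auto simp: S_def)
  interpret rest: blaschke_zeros "N - S" a by (rule bprod_remove_finite(1)[OF S])
  define c where "c = (- (of_real (cmod w) / w)) ^ card S"
  have "(\<Prod>n\<in>S. blaschke_factor (a n) z) = (\<Prod>n\<in>S. - (of_real (cmod w) / w) * moebius w z)" for z
    by (intro prod.cong refl) (simp only: S_def mem_Collect_eq blaschke_factor_eq_moebius)
  then have bprod: "bprod z = moebius w z ^ card S * (c * rest.bprod z)" if "z \<in> ball 0 1" for z
    using bprod_remove_finite(2)[OF S that] by (simp only: prod_constant power_mult_distrib c_def mult_ac)
  have moebius_holomorphic: "moebius w holomorphic_on ball 0 1" using w by (intro Moebius_function_holomorphic) simp
  have "zorder bprod w = zorder (\<lambda>z. moebius w z ^ card S) w + zorder (\<lambda>z. c * rest.bprod z) w"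
  proof (rule zorder_disc_mult[where k=bprod])
    show "(\<lambda>z. moebius w z ^ card S) holomorphic_on ball 0 1" "(\<lambda>z. c * rest.bprod z) holomorphic_on ball 0 1"
      by (intro holomorphic_intros moebius_holomorphic rest.bprod_holomorphic_disc)+
  qed (use bprod nz w in auto)
  also have "zorder (\<lambda>z. moebius w z ^ card S) w = int (card S) * zorder (moebius w) w"
  proof (rule zorder_power)
    have moebius_analytic: "moebius w analytic_on {w}" by (rule holomorphic_disc_imp_analytic[OF moebius_holomorphic w])
    show "moebius w meromorphic_on {w}" by (rule analytic_on_imp_meromorphic_on[OF moebius_analytic])
    have "eventually (\<lambda>z. z \<in> ball 0 1 - {w}) (at w)" using w by (intro eventually_at_in_open) auto
    then have "eventually (\<lambda>z. moebius w z \<noteq> 0) (at w)"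
      by eventually_elim (use w in \<open>auto simp: moebius_eq_0_iff less_imp_le\<close>)
    then show "frequently (\<lambda>z. moebius w z \<noteq> 0) (at w)" by (intro eventually_frequently) auto
  qed
  also have "zorder (\<lambda>z. c * rest.bprod z) w = 0"
  proof (rule zorder_eq_0I)
    show "(\<lambda>z. c * rest.bprod z) analytic_on {w}"
      by (intro holomorphic_disc_imp_analytic[OF _ w] holomorphic_intros rest.bprod_holomorphic_disc)
    have "c \<noteq> 0" using zeros_in_disc S by (cases "S = {}") (auto simp: c_def S_def)
    moreover have "rest.bprod w \<noteq> 0" using rest.bprod_eq_0_iff[OF w] by (auto simp: S_def)
    ultimately show "c * rest.bprod w \<noteq> 0" by simp
  qed
  finally show ?thesis using zorder_moebius[of w w] w by (simp add: S_def)
qed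

section \<open>Riesz factorization\<close>

lemma schur_divide_zero_at_0:
  assumes "schur f" "z\<^sub>0 \<in> ball 0 1" "f z\<^sub>0 \<noteq> 0"
  obtains m g where "schur g" "g 0 \<noteq> 0" "\<And>z. z \<in> ball 0 1 \<Longrightarrow> f z = z ^ m * g z"
  using assms
proof (induction "nat (zorder f 0)" arbitrary: f thesis rule: less_induct)
  case less
  note f = schurD(1)[OF less.prems(2)] less.prems(3,4)
  show thesis
  proof (cases "f 0 = 0")
    case False
    then show ?thesis using less.prems(1)[of f 0] less.prems(2) by simp
  next
    case True
    obtain g where g: "schur g" "\<And>z. z \<in> ball 0 1 \<Longrightarrow> f z = z * g z"
      using schur_divide_moebius[OF less.prems(2), of 0] True by auto
    have "zorder f 0 = zorder (\<lambda>z. z) 0 + zorder g 0"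
      by (rule zorder_disc_mult[OF _ schurD(1)[OF g(1)] g(2) f(2,3)]) auto
    also have "zorder (\<lambda>z. z) (0::complex) = 1" using zorder_moebius[of 0 0] by simp
    finally have "nat (zorder g 0) < nat (zorder f 0)"
      using zorder_disc_cases(2)[OF f, of 0] True by simp
    moreover have "g z\<^sub>0 \<noteq> 0" using g(2) f(2,3) by auto
    ultimately obtain m k where "schur k" "k 0 \<noteq> 0" "\<And>z. z \<in> ball 0 1 \<Longrightarrow> g z = z ^ m * k z"
      using less.hyps[OF _ _ g(1) f(2)] by blast
    then show ?thesis using less.prems(1)[of k "Suc m"] g(2) by simp
  qed
qed

lemma schur_quotient:
  assumes Q: "Q holomorphic_on ball 0 1" and b: "b holomorphic_on ball 0 1" "z\<^sub>0 \<in> ball 0 1" "b z\<^sub>0 \<noteq> 0"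
    and le: "\<And>z. z \<in> ball 0 1 \<Longrightarrow> cmod (Q z * b z) \<le> cmod (b z)"
  shows "schur Q"
  unfolding schur_def
proof (intro conjI ballI Q)
  fix w :: complex assume w: "w \<in> ball 0 1"
  show "cmod (Q w) \<le> 1"
  proof (rule isCont_norm_le[of w Q])
    show "isCont Q w" by (rule holomorphic_disc_imp_isCont[OF Q w])
    show "eventually (\<lambda>z. cmod (Q z) \<le> 1) (at w)"
      using eventually_nonzero_disc[OF b w]
    proof eventually_elim
      case (elim z)
      then have "cmod (Q z) * cmod (b z) \<le> 1 * cmod (b z)" using le[of z] by (simp add: norm_mult)
      then show ?case using elim by (simp only: mult_le_cancel_right zero_less_norm_iff) auto
    qed
  qed
qed

theorem riesz_factorization:
  assumes f: "schur f" "z\<^sub>0 \<in> ball 0 1" "f z\<^sub>0 \<noteq> 0"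
  obtains N a m Q where "blaschke_zeros N a" "\<And>n. n \<in> N \<Longrightarrow> f (a n) = 0" "schur Q"
    "\<And>z. z \<in> ball 0 1 \<Longrightarrow> Q z \<noteq> 0"
    "\<And>z. z \<in> ball 0 1 \<Longrightarrow> f z = z ^ m * blaschke_zeros.bprod N a z * Q z"
proof -
  obtain m g where g: "schur g" "g 0 \<noteq> 0" "\<And>z. z \<in> ball 0 1 \<Longrightarrow> f z = z ^ m * g z"
    by (rule schur_divide_zero_at_0[OF f]) (rule that)
  obtain N a where N: "enumerates_zeros g N a" by (rule enumerates_zeros_exists[OF schurD(1)[OF g(1)] _ g(2)]) auto
  have zero_iff: "g w = 0 \<longleftrightarrow> (\<exists>n\<in>N. a n = w)" if "w \<in> ball 0 1" for w
    using enumerates_zeros_eq_0_iff[OF schurD(1)[OF g(1)] _ g(2) N that] by simp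
  interpret blaschke_zeros N a
  proof
    show "a n \<noteq> 0 \<and> cmod (a n) < 1" if "n \<in> N" for n
      using enumerates_zerosD(1)[OF N that] g(2) zero_iff[of 0] that by auto
    show "summable (\<lambda>n. if n \<in> N then 1 - cmod (a n) else 0)" by (rule blaschke_condition[OF g(1) _ g(2) N]) simp
  qed
  have g_le: "cmod (g z) \<le> cmod (bprod z)" if z: "z \<in> ball 0 1" for z
    by (rule norm_bprod_ge[OF z]) (rule schur_norm_le_prod_zeros[OF g(1) _ g(2) N _ _ z]; simp)
  have bprod_0: "bprod 0 \<noteq> 0" using g_le[of 0] g(2) by auto
  have zorder: "zorder bprod w = zorder g w" if "w \<in> ball 0 1" for w
    using zorder_bprod[OF that enumerates_zerosD(2)[OF N that] _ bprod_0] enumerates_zerosD(3)[OF N that] by simp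
  obtain Q where Q: "Q holomorphic_on ball 0 1" "\<And>z. z \<in> ball 0 1 \<Longrightarrow> Q z \<noteq> 0"
    "\<And>z. z \<in> ball 0 1 \<Longrightarrow> g z = Q z * bprod z"
    using holomorphic_zorder_factorization[OF schurD(1)[OF g(1)] open_ball connected_ball
        bprod_holomorphic_disc _ zorder] zero_iff bprod_eq_0_iff by metis
  have "schur Q"
    by (rule schur_quotient[OF Q(1) bprod_holomorphic_disc _ bprod_0]) (use g_le Q(3) in auto)
  moreover have "f (a n) = 0" if "n \<in> N" for n
    using g(3)[of "a n"] zero_iff[of "a n"] zeros_in_disc[OF that] that by auto
  ultimately show thesis
    using that[of N a Q m] blaschke_zeros_axioms Q(2,3) g(3) by (simp add: mult_ac)
qed

section \<open>Canonical factorization of inner functions\<close>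

lemma innerD:
  assumes "inner I"
  shows "I \<in> Hinf" "AE \<zeta> in circle_meas. cmod (bdry I \<zeta>) = 1"
  using assms by (auto simp: inner_def)

lemma inner_schur:
  assumes "inner I" shows "schur I"
  unfolding schur_def
proof (intro conjI ballI)
  show "I holomorphic_on ball 0 1" by (rule Hinf_holomorphic[OF innerD(1)[OF assms]])
  show "cmod (I z) \<le> 1" if "z \<in> ball 0 1" for z
    by (rule Hinf_norm_le[OF innerD(1)[OF assms] _ that]) (use innerD(2)[OF assms] in \<open>auto elim: eventually_mono\<close>)
qed

lemma inner_nonzero:
  assumes "inner I" obtains z\<^sub>0 where "z\<^sub>0 \<in> ball 0 1" "I z\<^sub>0 \<noteq> 0"
proof (rule ccontr)
  assume "\<not> thesis"
  then have "AE \<zeta> in circle_meas. cmod (bdry I \<zeta>) \<le> 0"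
    using innerD(1)[OF assms] that by (intro norm_bdry_le) auto
  with innerD(2)[OF assms] have "AE \<zeta> in circle_meas. False" by eventually_elim simp
  then show False by simp
qed

lemma (in finite_measure) null_set_carrying_singular_part:
  assumes sets: "sets L = sets M"
  obtains S where "S \<in> null_sets L" "\<And>A. A \<in> null_sets L \<Longrightarrow> A \<inter> S = {} \<Longrightarrow> emeasure M A = 0"
proof -
  define s where "s = (SUP A\<in>null_sets L. measure M A)"
  have bdd: "bdd_above (measure M ` null_sets L)"
    by (rule bdd_aboveI[of _ "measure M (space M)"]) (auto simp: bounded_measure)
  have "\<exists>A\<in>null_sets L. s - 1 / Suc n < measure M A" for n
    using less_cSUP_iff[OF _ bdd, of "s - 1 / Suc n"] by (force simp: s_def)
  then obtain A where A: "\<And>n. A n \<in> null_sets L" "\<And>n::nat. s - 1 / Suc n < measure M (A n)" by metis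
  define S where "S = (\<Union>n. A n)"
  have S: "S \<in> null_sets L" unfolding S_def using A(1) by (intro null_sets_UN) auto
  have "s - 1 / Suc n \<le> measure M S" for n
    using A(2)[of n] finite_measure_mono[of "A n" S] S sets by (force simp: S_def)
  then have "s \<le> measure M S + 1 / Suc n" for n by (simp add: diff_le_eq)
  moreover have "(\<lambda>n. measure M S + 1 / Suc n) \<longlonglongrightarrow> measure M S + 0"
    by (intro tendsto_intros) (use LIMSEQ_inverse_real_of_nat in \<open>simp add: inverse_eq_divide\<close>)
  ultimately have s_le: "s \<le> measure M S" by (intro LIMSEQ_le_const[of _ "measure M S" s]) auto
  show thesis
  proof (rule that[OF S])
    fix B assume B: "B \<in> null_sets L" "B \<inter> S = {}"
    have "measure M (B \<union> S) \<le> s" unfolding s_def by (intro cSUP_upper bdd null_sets.Un B S)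
    moreover have "measure M (B \<union> S) = measure M B + measure M S"
      using B S sets by (intro finite_measure_Union) (auto simp: null_sets_def)
    ultimately have "measure M B = 0" using s_le measure_nonneg[of M B] by linarith
    then show "emeasure M B = 0" by (simp add: emeasure_eq_measure)
  qed
qed

theorem (in finite_measure) lebesgue_decomposition:
  assumes "sigma_finite_measure L" and sets: "sets L = sets M"
  obtains S g where "S \<in> null_sets L" "integrable L g" "\<And>x. g x \<ge> 0"
    "density M (indicator (space M - S)) = density L (\<lambda>x. ennreal (g x))"
proof -
  interpret L: sigma_finite_measure L by fact
  obtain S where S: "S \<in> null_sets L" "\<And>A. A \<in> null_sets L \<Longrightarrow> A \<inter> S = {} \<Longrightarrow> emeasure M A = 0"
    using null_set_carrying_singular_part[OF sets] by blast
  define N where "N = density M (indicator (space M - S))"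
  have emeasure_N: "emeasure N A = emeasure M ((space M - S) \<inter> A)" if "A \<in> sets M" for A
    unfolding N_def using S(1) sets that by (intro emeasure_restricted) auto
  have "finite_measure N"
    by (rule finite_measureI) (use emeasure_N[of "space M"] in \<open>simp add: N_def emeasure_eq_measure\<close>)
  moreover have "absolutely_continuous L N"
    unfolding absolutely_continuous_def
  proof
    fix A assume A: "A \<in> null_sets L"
    then have "(space M - S) \<inter> A \<in> null_sets L" using S(1) sets by (intro null_set_Int1) auto
    then have "emeasure M ((space M - S) \<inter> A) = 0" by (rule S(2)) auto
    then show "A \<in> null_sets N" using emeasure_N[of A] A sets by (auto simp: null_sets_def N_def)
  qed
  moreover have "sets N = sets L" using sets by (simp add: N_def)
  ultimately obtain g where "integrable L g" "\<And>x. g x \<ge> 0" "N = density L (\<lambda>x. ennreal (g x))"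
    using L.real_density_of_absolutely_continuous by blast
  then show thesis using that S(1) by (simp add: N_def)
qed

lemma (in circle_measure) emeasure_compl_sphere: "emeasure \<mu> (- sphere 0 1) = 0"
  using AE_norm_eq_1 by (subst (asm) AE_iff_measurable[of "- sphere 0 1"]) auto

lemma singular_measure_imp_circle_measure:
  assumes "singular_measure \<mu>" shows "circle_measure \<mu>"
proof -
  interpret finite_measure \<mu> using assms by (simp add: singular_measure_def)
  show ?thesis
  proof (rule circle_measureI)
    show "AE \<zeta> in \<mu>. cmod \<zeta> = 1"
      using assms by (intro AE_I[of _ _ "- sphere 0 1"]) (auto simp: singular_measure_def)
  qed (use assms in \<open>auto simp: singular_measure_def\<close>)
qed

context circle_measure
begin

lemma norm_singular_inner:
  "cmod z < 1 \<Longrightarrow> cmod (singular_inner \<mu> z) = exp (- poisson_integral \<mu> (\<lambda>_. 1) z)"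
  using Re_herglotz_integral[of "\<lambda>_. 1" z] by (simp add: singular_inner_eq_exp_herglotz norm_exp_eq_Re)

text \<open>Radial limits in \<open>\<bar>I\<bar> \<le> \<bar>singular_inner \<mu>\<bar> \<le> exp (- poisson_integral circle_meas g)\<close>, where \<open>g\<close> is the density
  of the absolutely continuous part of \<open>\<mu>\<close>, give \<open>1 \<le> exp (- g)\<close>.\<close>
lemma singular_measure_if_inner_le:
  assumes I: "inner I" and le: "\<And>z. z \<in> ball 0 1 \<Longrightarrow> cmod (I z) \<le> cmod (singular_inner \<mu> z)"
  shows "singular_measure \<mu>"
proof -
  obtain S g where S: "S \<in> null_sets circle_meas" and g: "integrable circle_meas g" "\<And>\<zeta>. g \<zeta> \<ge> 0"
    and density: "density \<mu> (indicator (UNIV - S)) = density circle_meas (\<lambda>\<zeta>. ennreal (g \<zeta>))"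
    using lebesgue_decomposition[OF circle_meas.sigma_finite_measure_axioms] by auto
  have [measurable]: "S \<in> sets borel" using S by auto
  have I_le: "cmod (I z) \<le> exp (- poisson_integral circle_meas g z)" if "z \<in> ball 0 1" for z
  proof -
    have z: "cmod z < 1" using that by simp
    have "poisson_integral circle_meas g z = poisson_integral (density circle_meas g) (\<lambda>_. 1::real) z"
      using g by (subst poisson_integral_density) auto
    also have "\<dots> = poisson_integral \<mu> (indicator (UNIV - S)) z"
      unfolding density[symmetric] ennreal_indicator[symmetric] by (subst poisson_integral_density) auto
    also have "\<dots> \<le> poisson_integral \<mu> (\<lambda>_. 1) z"
      using z by (intro poisson_integral_mono integrable_real_indicator) (auto simp: emeasure_eq_measure indicator_def)
    finally show ?thesis using le[OF that] norm_singular_inner[OF z] by (simp add: order_trans)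
  qed
  have "AE \<zeta> in circle_meas. ennreal (g \<zeta>) = 0"
    using innerD(2)[OF I] Hinf_radial_limit[OF innerD(1)[OF I]] poisson_integral_radial_limit[OF g(1)]
      AE_circle_meas_norm
  proof eventually_elim
    case (elim \<zeta>)
    have "radial_limit (\<lambda>z. exp (- poisson_integral circle_meas g z)) \<zeta> (exp (- g \<zeta>))"
      by (intro tendsto_intros elim)
    then have "cmod (bdry I \<zeta>) \<le> exp (- g \<zeta>)"
      by (rule radial_limit_le[OF tendsto_norm[OF elim(2)] _ elim(4)]) (rule I_le)
    then show ?case using elim(1) g(2)[of \<zeta>] by simp
  qed
  then have "emeasure (density \<mu> (indicator (UNIV - S))) UNIV = 0"
    unfolding density using g(1) by (subst emeasure_density) (auto simp: nn_integral_0_iff_AE)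
  then have "emeasure \<mu> (- S) = 0" by (simp add: emeasure_density Compl_eq_Diff_UNIV)
  then show ?thesis
    unfolding singular_measure_def using finite_measure_axioms emeasure_compl_sphere S by auto
qed

end

lemma schur_zero_free_factorization:
  assumes Q: "schur Q" "\<And>z. z \<in> ball 0 1 \<Longrightarrow> Q z \<noteq> 0"
  obtains c \<mu> where "cmod c = 1" "circle_measure \<mu>" "\<And>z. z \<in> ball 0 1 \<Longrightarrow> Q z = c * singular_inner \<mu> z"
proof -
  obtain L where L: "L holomorphic_on ball 0 1" "\<And>z. z \<in> ball 0 1 \<Longrightarrow> exp (L z) = Q z"
    using holomorphic_logarithm_exists[OF convex_ball open_ball schurD(1)[OF Q(1)] Q(2), of 0] by auto
  obtain \<mu> where \<mu>: "circle_measure \<mu>" "\<And>z. z \<in> ball 0 1 \<Longrightarrow> Re (- L z) = poisson_integral \<mu> (\<lambda>_. 1) z"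
  proof (rule herglotz_representation)
    show "(\<lambda>z. - L z) holomorphic_on ball 0 1" by (intro holomorphic_intros L(1))
    show "Re (- L z) \<ge> 0" if "z \<in> ball 0 1" for z
      using schurD(2)[OF Q(1) that] L(2)[OF that] norm_exp_eq_Re[of "L z"] by simp
  qed (rule that)
  interpret \<mu>: circle_measure \<mu> by fact
  define S where "S = herglotz_integral \<mu> (\<lambda>_. 1)"
  have S: "S holomorphic_on ball 0 1" unfolding S_def by (rule \<mu>.herglotz_integral_holomorphic_disc) simp
  define D where "D z = exp (L z + S z)" for z
  have D: "D holomorphic_on ball 0 1" unfolding D_def by (intro holomorphic_intros L(1) S)
  have norm_D: "cmod (D z) = 1" if "z \<in> ball 0 1" for z
    using \<mu>.Re_herglotz_integral[of "\<lambda>_. 1" z] \<mu>(2)[OF that] that by (simp add: D_def S_def norm_exp_eq_Re)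
  have "D constant_on ball 0 1"
    by (rule maximum_modulus_principle[OF D open_ball connected_ball open_ball order_refl, of 0]) (use norm_D in auto)
  then obtain c where c: "\<And>z. z \<in> ball 0 1 \<Longrightarrow> D z = c" by (auto simp: constant_on_def)
  show thesis
  proof (rule that[OF _ \<mu>(1)])
    show "cmod c = 1" using norm_D[of 0] c[of 0] by simp
    fix z :: complex assume z: "z \<in> ball 0 1"
    have "Q z = D z * exp (- S z)" using L(2)[OF z] by (simp add: D_def flip: exp_add)
    then show "Q z = c * singular_inner \<mu> z" using c[OF z] by (simp add: S_def singular_inner_eq_exp_herglotz)
  qed
qed

theorem canonical_factorization:
  assumes I: "inner I"
  obtains c m N a \<mu> where "cmod c = 1" "blaschke_zeros N a" "\<And>n. n \<in> N \<Longrightarrow> I (a n) = 0" "singular_measure \<mu>"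
    "\<And>z. z \<in> ball 0 1 \<Longrightarrow> I z = c * (z ^ m * blaschke_zeros.bprod N a z) * singular_inner \<mu> z"
proof -
  obtain z\<^sub>0 where z\<^sub>0: "z\<^sub>0 \<in> ball 0 1" "I z\<^sub>0 \<noteq> 0" using inner_nonzero[OF I] .
  obtain N a m Q where N: "blaschke_zeros N a" "\<And>n. n \<in> N \<Longrightarrow> I (a n) = 0"
    and Q: "schur Q" "\<And>z. z \<in> ball 0 1 \<Longrightarrow> Q z \<noteq> 0"
    and I_eq: "\<And>z. z \<in> ball 0 1 \<Longrightarrow> I z = z ^ m * blaschke_zeros.bprod N a z * Q z"
    by (rule riesz_factorization[OF inner_schur[OF I] z\<^sub>0]) (rule that)
  interpret blaschke_zeros N a by fact
  obtain c \<mu> where c: "cmod c = 1" and \<mu>: "circle_measure \<mu>"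
    and Q_eq: "\<And>z. z \<in> ball 0 1 \<Longrightarrow> Q z = c * singular_inner \<mu> z"
    using schur_zero_free_factorization[OF Q(1)] Q(2) by metis
  interpret \<mu>: circle_measure \<mu> by fact
  have "cmod (I z) \<le> cmod (singular_inner \<mu> z)" if z: "z \<in> ball 0 1" for z
  proof -
    have "cmod z ^ m * cmod (bprod z) \<le> 1 * 1"
      using z norm_bprod_le_1[OF z] by (intro mult_mono power_le_one) auto
    then have "cmod (I z) \<le> 1 * cmod (Q z)"
      unfolding I_eq[OF z] norm_mult norm_power by (intro mult_right_mono) auto
    then show ?thesis using Q_eq[OF z] c by (simp add: norm_mult)
  qed
  then have "singular_measure \<mu>" by (rule \<mu>.singular_measure_if_inner_le[OF I])
  from that[OF c N this, of m] show thesis using I_eq Q_eq by (simp add: mult_ac)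
qed

section \<open>The spectrum of an inner function\<close>

lemma singular_inner_small_near_support:
  assumes \<mu>: "singular_measure \<mu>" and \<zeta>\<^sub>0: "\<zeta>\<^sub>0 \<in> measure_support \<mu>" and e: "e > 0"
  shows "\<exists>z\<in>ball 0 1. dist z \<zeta>\<^sub>0 < e \<and> cmod (singular_inner \<mu> z) < e"
proof (rule ccontr)
  assume neg: "\<not> ?thesis"
  interpret circle_measure \<mu> by (rule singular_measure_imp_circle_measure[OF \<mu>])
  obtain N where [measurable]: "N \<in> sets borel" and N: "emeasure circle_meas N = 0" "emeasure \<mu> (- N) = 0"
    using \<mu> by (auto simp: singular_measure_def)
  have le: "poisson_integral \<mu> (\<lambda>_. 1) z \<le> - ln e" if z: "z \<in> ball 0 1" "dist z \<zeta>\<^sub>0 < e" for z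
  proof -
    have "e \<le> cmod (singular_inner \<mu> z)" using neg z by (meson not_le)
    then have "ln e \<le> ln (cmod (singular_inner \<mu> z))" using e by (intro ln_mono) auto
    then show ?thesis using norm_singular_inner z by simp
  qed
  define V where "V = ball \<zeta>\<^sub>0 (e/2)"
  have [measurable]: "V \<in> sets borel" by (simp add: V_def)
  have "measure \<mu> (N \<inter> V) \<le> max 0 (- ln e) * measure circle_meas (N \<inter> V)"
  proof (rule measure_le_of_poisson_integral_le[of V "e/2"])
    fix z x assume "z \<in> ball 0 1" "x \<in> V" "dist x z < e/2"
    then show "poisson_integral \<mu> (\<lambda>_. 1) z \<le> max 0 (- ln e)"
      using le[of z] dist_triangle[of z \<zeta>\<^sub>0 x] by (auto simp: V_def dist_commute le_max_iff_disj)
  qed (use e in \<open>auto simp: V_def\<close>)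
  also have "measure circle_meas (N \<inter> V) = 0"
    using circle_meas.finite_measure_mono[of "N \<inter> V" N] N(1)
    by (simp add: circle_meas.emeasure_eq_measure measure_le_0_iff)
  finally have "measure \<mu> (N \<inter> V) = 0" by (simp add: measure_le_0_iff)
  moreover have "measure \<mu> V \<le> measure \<mu> (N \<inter> V) + measure \<mu> (- N)"
  proof -
    have "measure \<mu> V \<le> measure \<mu> ((N \<inter> V) \<union> - N)" by (intro finite_measure_mono) auto
    also have "\<dots> \<le> measure \<mu> (N \<inter> V) + measure \<mu> (- N)" by (intro measure_Un_le) auto
    finally show ?thesis .
  qed
  ultimately have "emeasure \<mu> V = 0" using N(2) by (simp add: emeasure_eq_measure measure_le_0_iff)
  then show False using \<zeta>\<^sub>0 e by (auto simp: measure_support_def V_def dest!: spec[of _ "e/2"])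
qed

lemma norm_blaschke_le_1:
  assumes "blaschke B" "z \<in> ball 0 1" shows "cmod (B z) \<le> 1"
proof -
  obtain m N a where B: "\<forall>n\<in>N. a n \<noteq> 0 \<and> cmod (a n) < 1"
    "summable (\<lambda>n. if n \<in> N then 1 - cmod (a n) else 0)"
    "\<forall>z\<in>ball 0 1. B z = z ^ m * (\<Prod>n. if n \<in> N then blaschke_factor (a n) z else 1)"
    using assms(1) unfolding blaschke_def by blast
  interpret blaschke_zeros N a by unfold_locales (use B in auto)
  have "cmod (B z) = cmod z ^ m * cmod (bprod z)"
    using B(3) assms(2) by (simp add: bprod_def factor_def norm_mult norm_power)
  also have "\<dots> \<le> 1 * 1" using assms(2) norm_bprod_le_1[OF assms(2)] by (intro mult_mono power_le_one) auto
  finally show ?thesis by simp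
qed

lemma inner_small_near_spectrum:
  assumes "\<zeta>\<^sub>0 \<in> inner_spectrum I" and e: "e > 0"
  shows "\<exists>z\<in>ball 0 1. dist z \<zeta>\<^sub>0 < e \<and> cmod (I z) < e"
  using assms(1) unfolding inner_spectrum_def
proof
  assume "\<zeta>\<^sub>0 \<in> {\<zeta>. cmod \<zeta> = 1 \<and> \<zeta> islimpt {z \<in> ball 0 1. I z = 0}}"
  then obtain z where "z \<in> {z \<in> ball 0 1. I z = 0}" "dist z \<zeta>\<^sub>0 < e" using e by (auto simp: islimpt_approachable)
  then show ?thesis using e by auto
next
  assume "\<zeta>\<^sub>0 \<in> {\<zeta>. \<exists>c B \<mu>. cmod c = 1 \<and> blaschke B \<and> singular_measure \<mu> \<and>
          (\<forall>z\<in>ball 0 1. I z = c * B z * singular_inner \<mu> z) \<and> \<zeta> \<in> measure_support \<mu>}"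
  then obtain c B \<mu> where c: "cmod c = 1" and B: "blaschke B" and \<mu>: "singular_measure \<mu>" "\<zeta>\<^sub>0 \<in> measure_support \<mu>"
    and I_eq: "\<And>z. z \<in> ball 0 1 \<Longrightarrow> I z = c * B z * singular_inner \<mu> z" by blast
  obtain z where z: "z \<in> ball 0 1" "dist z \<zeta>\<^sub>0 < e" "cmod (singular_inner \<mu> z) < e"
    using singular_inner_small_near_support[OF \<mu> e] by blast
  have "cmod (I z) = cmod (B z) * cmod (singular_inner \<mu> z)" using c I_eq[OF z(1)] by (simp add: norm_mult)
  also have "\<dots> \<le> 1 * cmod (singular_inner \<mu> z)"
    using norm_blaschke_le_1[OF B z(1)] by (intro mult_right_mono) auto
  finally show ?thesis using z by auto
qed

lemma (in blaschke_zeros) circle_regular_if_not_islimpt: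
  assumes \<zeta>: "cmod \<zeta> = 1" "\<not> \<zeta> islimpt a ` N" shows "\<zeta> \<in> regular"
proof -
  obtain e where e: "e > 0" "\<And>n. n \<in> N \<Longrightarrow> a n \<noteq> \<zeta> \<Longrightarrow> e \<le> dist (a n) \<zeta>"
    using \<zeta>(2) unfolding islimpt_approachable by (metis imageI not_less)
  moreover have "a n \<noteq> \<zeta>" if "n \<in> N" for n using zeros_in_disc[OF that] \<zeta>(1) by auto
  ultimately show ?thesis by (intro circle_regularI[OF \<zeta>(1) e(1)]) auto
qed

lemma (in blaschke_zeros) regular_off_inner_spectrum:
  assumes "\<And>n. n \<in> N \<Longrightarrow> I (a n) = 0" and \<zeta>: "\<zeta> \<in> sphere 0 1 - inner_spectrum I"
  shows "\<zeta> \<in> regular"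
proof -
  have "a ` N \<subseteq> {z\<in>ball 0 1. I z = 0}" using zeros_in_disc assms(1) by auto
  moreover have "\<not> \<zeta> islimpt {z\<in>ball 0 1. I z = 0}" using \<zeta> by (simp add: inner_spectrum_def)
  ultimately have "\<not> \<zeta> islimpt a ` N" using islimpt_subset by blast
  then show ?thesis using \<zeta> by (intro circle_regular_if_not_islimpt) auto
qed

lemma measure_support_subset_inner_spectrum:
  assumes "cmod c = 1" "blaschke B" "singular_measure \<mu>"
    and "\<And>z. z \<in> ball 0 1 \<Longrightarrow> I z = c * B z * singular_inner \<mu> z"
  shows "measure_support \<mu> \<subseteq> inner_spectrum I"
proof
  fix \<zeta> assume "\<zeta> \<in> measure_support \<mu>"
  then show "\<zeta> \<in> inner_spectrum I" unfolding inner_spectrum_def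
    by (intro UnI2 CollectI exI[of _ c] exI[of _ B] exI[of _ \<mu>] conjI ballI assms)
qed

theorem inner_extends_off_spectrum:
  assumes I: "inner I"
  obtains U J where "open U" "ball 0 1 \<subseteq> U" "sphere 0 1 - inner_spectrum I \<subseteq> U" "J holomorphic_on U"
    "\<And>z. z \<in> ball 0 1 \<Longrightarrow> J z = I z" "\<And>\<zeta>. \<zeta> \<in> sphere 0 1 - inner_spectrum I \<Longrightarrow> cmod (J \<zeta>) = 1"
proof -
  obtain c m N a \<mu> where c: "cmod c = 1" and N: "blaschke_zeros N a" "\<And>n. n \<in> N \<Longrightarrow> I (a n) = 0"
    and \<mu>: "singular_measure \<mu>"
    and I_eq: "\<And>z. z \<in> ball 0 1 \<Longrightarrow> I z = c * (z ^ m * blaschke_zeros.bprod N a z) * singular_inner \<mu> z"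
    by (rule canonical_factorization[OF I]) (rule that)
  interpret blaschke_zeros N a by fact
  interpret \<mu>: circle_measure \<mu> by (rule singular_measure_imp_circle_measure[OF \<mu>])
  define S where "S = herglotz_integral \<mu> (\<lambda>_. 1)"
  define U where "U = regular \<inter> - ess_support \<mu> (\<lambda>_. 1::real)"
  define J where "J z = c * (z ^ m * bprod z) * exp (- S z)" for z
  have "sphere 0 1 - inner_spectrum I \<subseteq> regular"
    using regular_off_inner_spectrum[where I=I, OF N(2)] by blast
  moreover have "measure_support \<mu> \<subseteq> inner_spectrum I"
    by (rule measure_support_subset_inner_spectrum[OF c blaschke_bprod \<mu>]) (rule I_eq)
  ultimately have off: "sphere 0 1 - inner_spectrum I \<subseteq> U"
    unfolding U_def \<mu>.ess_support_const_eq_measure_support by blast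
  show thesis
  proof (rule that[OF _ _ off])
    show "open U" unfolding U_def by (intro open_Int open_regular open_Compl closed_ess_support)
    show "ball 0 1 \<subseteq> U" unfolding U_def using disc_subset_regular \<mu>.disc_subset_ess_support_compl by blast
    have "S holomorphic_on U" unfolding S_def
      by (rule holomorphic_on_subset[OF \<mu>.herglotz_integral_holomorphic]) (auto simp: U_def)
    then show "J holomorphic_on U" unfolding J_def
      by (intro holomorphic_intros holomorphic_on_subset[OF bprod_holomorphic]) (auto simp: U_def)
    show "J z = I z" if "z \<in> ball 0 1" for z
      using I_eq[OF that] by (simp add: J_def S_def singular_inner_eq_exp_herglotz)
    fix \<zeta> assume \<zeta>: "\<zeta> \<in> sphere 0 1 - inner_spectrum I"
    then have "Re (S \<zeta>) = 0" unfolding S_def by (intro \<mu>.Re_herglotz_integral_circle) simp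
    moreover have "cmod (bprod \<zeta>) = 1" using norm_bprod_eq_1[of \<zeta>] off \<zeta> by (auto simp: U_def)
    ultimately show "cmod (J \<zeta>) = 1" using c \<zeta> by (simp add: J_def norm_mult norm_power norm_exp_eq_Re)
  qed
qed

section \<open>Outer functions\<close>

definition outer_of :: "(complex \<Rightarrow> real) \<Rightarrow> complex \<Rightarrow> complex" where
  "outer_of w z = exp (herglotz_integral circle_meas w z)"

lemma outerE:
  assumes "outer \<Phi>"
  obtains c w where "cmod c = 1" "integrable circle_meas w" "\<And>z. z \<in> ball 0 1 \<Longrightarrow> \<Phi> z = c * outer_of w z"
  using assms unfolding outer_def outer_of_def herglotz_integral_def by blast

lemma outer_of_holomorphic:
  "integrable circle_meas w \<Longrightarrow> outer_of w holomorphic_on - ess_support circle_meas w"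
  unfolding outer_of_def by (intro holomorphic_intros circle_meas.herglotz_integral_holomorphic)

lemma outer_of_add:
  assumes "integrable circle_meas v" "integrable circle_meas w" "z \<in> ball 0 1"
  shows "outer_of (\<lambda>\<zeta>. v \<zeta> + w \<zeta>) z = outer_of v z * outer_of w z"
  using circle_meas.herglotz_integral_add[OF assms(1,2), of z] assms(3) by (simp add: outer_of_def exp_add)

lemma norm_outer_of:
  "integrable circle_meas w \<Longrightarrow> z \<in> ball 0 1 \<Longrightarrow> cmod (outer_of w z) = exp (poisson_integral circle_meas w z)"
  using circle_meas.Re_herglotz_integral[of w z] by (simp add: outer_of_def norm_exp_eq_Re)

lemma norm_outer_of_circle: "cmod \<zeta> = 1 \<Longrightarrow> cmod (outer_of w \<zeta>) = 1"
  using circle_meas.Re_herglotz_integral_circle[of \<zeta> w] by (simp add: outer_of_def norm_exp_eq_Re)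

lemma norm_outer_of_le:
  assumes "integrable circle_meas w" "AE \<zeta> in circle_meas. w \<zeta> \<le> C" "z \<in> ball 0 1"
  shows "cmod (outer_of w z) \<le> exp C"
  using circle_meas.poisson_integral_mono[OF assms(1), of "\<lambda>_. C" z] assms by (simp add: norm_outer_of)

lemma outer_of_Hinf:
  assumes w: "integrable circle_meas w" "AE \<zeta> in circle_meas. w \<zeta> \<le> C" shows "outer_of w \<in> Hinf"
proof (rule HinfI)
  show "outer_of w holomorphic_on ball 0 1"
    by (rule holomorphic_on_subset[OF outer_of_holomorphic[OF w(1)] circle_meas.disc_subset_ess_support_compl])
qed (rule norm_outer_of_le[OF w])

lemma inner_outer_boundary_modulus:
  assumes \<phi>: "\<phi> \<in> Hinf" and I: "inner I" and w: "integrable circle_meas w"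
    and eq: "\<And>z. z \<in> ball 0 1 \<Longrightarrow> cmod (\<phi> z) = cmod (outer_of w z) * cmod (I z)"
  shows "AE \<zeta> in circle_meas. cmod (bdry \<phi> \<zeta>) = exp (w \<zeta>)"
proof -
  show ?thesis
    using poisson_integral_radial_limit[OF w] Hinf_radial_limit[OF innerD(1)[OF I]] Hinf_radial_limit[OF \<phi>]
      innerD(2)[OF I] AE_circle_meas_norm
  proof eventually_elim
    case (elim \<zeta>)
    have "radial_limit (\<lambda>z. exp (poisson_integral circle_meas w z) * cmod (I z)) \<zeta> (exp (w \<zeta>) * cmod (bdry I \<zeta>))"
      by (intro tendsto_intros elim)
    moreover have "radial_limit (\<lambda>z. exp (poisson_integral circle_meas w z) * cmod (I z)) \<zeta> L \<longleftrightarrow>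
        radial_limit (\<lambda>z. cmod (\<phi> z)) \<zeta> L" for L
      by (rule radial_limit_cong[OF elim(5)]) (simp add: eq norm_outer_of[OF w])
    ultimately have "radial_limit (\<lambda>z. cmod (\<phi> z)) \<zeta> (exp (w \<zeta>))" using elim(4) by simp
    then show ?case using tendsto_unique[OF _ tendsto_norm[OF elim(3)]] by simp
  qed
qed

section \<open>Uniform approximation by holomorphic functions\<close>

locale holomorphic_approximation =
  fixes U K :: "complex set"
  assumes compact_K: "compact K" and K_subset: "K \<subseteq> U"
begin

definition approximable :: "(complex \<Rightarrow> complex) \<Rightarrow> bool" where
  "approximable f \<longleftrightarrow> (\<forall>e>0. \<exists>g. g holomorphic_on U \<and> (\<forall>z\<in>K. dist (g z) (f z) < e))"

lemma approximable_holomorphic: "f holomorphic_on U \<Longrightarrow> approximable f"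
  unfolding approximable_def by (auto intro!: exI[of _ f])

lemma approximable_const: "approximable (\<lambda>_. c)"
  by (intro approximable_holomorphic holomorphic_on_const)

lemma approximable_ident: "approximable (\<lambda>z. z)"
  by (intro approximable_holomorphic holomorphic_on_ident)

lemma approximable_cong: "(\<And>z. z \<in> K \<Longrightarrow> f z = g z) \<Longrightarrow> approximable f \<Longrightarrow> approximable g"
  unfolding approximable_def by simp

lemma approximable_uniform_limit:
  assumes "uniform_limit K f l F" "\<And>n. approximable (f n)" "F \<noteq> bot"
  shows "approximable l"
  unfolding approximable_def
proof (intro allI impI)
  fix e :: real assume e: "e > 0"
  then have "eventually (\<lambda>n. \<forall>z\<in>K. dist (f n z) (l z) < e/2) F"
    using uniform_limitD[OF assms(1), of "e/2"] by simp
  then obtain n where n: "\<forall>z\<in>K. dist (f n z) (l z) < e/2"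
    using eventually_happens'[OF assms(3)] by blast
  obtain g where g: "g holomorphic_on U" "\<forall>z\<in>K. dist (g z) (f n z) < e/2"
    using assms(2)[of n] e unfolding approximable_def by (meson half_gt_zero)
  have "dist (g z) (l z) < e" if "z \<in> K" for z
    by (rule dist_triangle_half_r[of "f n z"]) (use n g(2) that in \<open>simp_all add: dist_commute\<close>)
  then show "\<exists>g. g holomorphic_on U \<and> (\<forall>z\<in>K. dist (g z) (l z) < e)" using g(1) by blast
qed

lemma approximableE:
  assumes "approximable f"
  obtains g where "\<And>n::nat. g n holomorphic_on U" "uniform_limit K g f sequentially"
proof -
  have "\<forall>n. \<exists>g. g holomorphic_on U \<and> (\<forall>z\<in>K. dist (g z) (f z) < inverse (real (Suc n)))"
    using assms by (simp add: approximable_def)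
  then obtain g where g: "\<And>n. g n holomorphic_on U" "\<And>n z. z \<in> K \<Longrightarrow> dist (g n z) (f z) < inverse (real (Suc n))"
    by metis
  show thesis
  proof (rule that[OF g(1)])
    show "uniform_limit K g f sequentially"
      unfolding uniform_limit_iff
    proof (intro allI impI)
      fix e :: real assume "e > 0"
      then have "eventually (\<lambda>n. inverse (real (Suc n)) < e) sequentially"
        by (rule order_tendstoD(2)[OF LIMSEQ_inverse_real_of_nat])
      then show "eventually (\<lambda>n. \<forall>z\<in>K. dist (g n z) (f z) < e) sequentially"
        by eventually_elim (use g(2) less_trans in blast)
    qed
  qed
qed

lemma approximable_add:
  assumes "approximable f" "approximable g" shows "approximable (\<lambda>z. f z + g z)"
proof -
  obtain f' where f': "\<And>n::nat. f' n holomorphic_on U" "uniform_limit K f' f sequentially"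
    by (rule approximableE[OF assms(1)]) (rule that)
  obtain g' where g': "\<And>n::nat. g' n holomorphic_on U" "uniform_limit K g' g sequentially"
    by (rule approximableE[OF assms(2)]) (rule that)
  have "uniform_limit K (\<lambda>n z. f' n z + g' n z) (\<lambda>z. f z + g z) sequentially"
    by (intro uniform_limit_add f' g')
  moreover have "approximable (\<lambda>z. f' n z + g' n z)" for n
    by (intro approximable_holomorphic holomorphic_intros f' g')
  ultimately show ?thesis by (rule approximable_uniform_limit) simp
qed

lemma uniform_limit_holomorphic_bounded:
  assumes "\<And>n::nat. g n holomorphic_on U" "uniform_limit K g f sequentially"
  shows "bounded (f ` K)"
proof -
  have "continuous_on K (g n)" for n
    by (rule continuous_on_subset[OF holomorphic_on_imp_continuous_on[OF assms(1)] K_subset])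
  then have "continuous_on K f" by (intro uniform_limit_theorem[OF _ assms(2)]) auto
  then show ?thesis by (intro compact_imp_bounded compact_continuous_image compact_K)
qed

lemma approximable_mult:
  assumes "approximable f" "approximable g" shows "approximable (\<lambda>z. f z * g z)"
proof -
  obtain f' where f': "\<And>n::nat. f' n holomorphic_on U" "uniform_limit K f' f sequentially"
    by (rule approximableE[OF assms(1)]) (rule that)
  obtain g' where g': "\<And>n::nat. g' n holomorphic_on U" "uniform_limit K g' g sequentially"
    by (rule approximableE[OF assms(2)]) (rule that)
  have "uniform_limit K (\<lambda>n z. f' n z * g' n z) (\<lambda>z. f z * g z) sequentially"
    by (intro uniform_lim_mult f' g' uniform_limit_holomorphic_bounded[OF f'] uniform_limit_holomorphic_bounded[OF g'])
  moreover have "approximable (\<lambda>z. f' n z * g' n z)" for n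
    by (intro approximable_holomorphic holomorphic_intros f' g')
  ultimately show ?thesis by (rule approximable_uniform_limit) simp
qed

lemma approximable_power: "approximable f \<Longrightarrow> approximable (\<lambda>z. f z ^ n)"
  by (induction n) (simp_all add: approximable_const approximable_mult)

lemma approximable_sum: "(\<And>i. i \<in> A \<Longrightarrow> approximable (f i)) \<Longrightarrow> approximable (\<lambda>z. \<Sum>i\<in>A. f i z)"
  by (induction A rule: infinite_finite_induct) (simp_all add: approximable_const approximable_add)

text \<open>Runge's pole pushing: expand \<open>1 / (z - q)\<close> into a geometric series in \<open>1 / (z - p)\<close>.\<close>
lemma approximable_push_pole:
  assumes p: "approximable (\<lambda>z. 1 / (z - p))"
    and d: "\<And>z. z \<in> K \<Longrightarrow> d \<le> cmod (z - p)" and q: "cmod (q - p) < d"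
  shows "approximable (\<lambda>z. 1 / (z - q))"
proof -
  define f where "f n z = (q - p) ^ n * (1 / (z - p)) ^ Suc n" for n z
  define \<rho> where "\<rho> = cmod (q - p) / d"
  have d_pos: "d > 0" using q norm_ge_zero[of "q - p"] by linarith
  have \<rho>: "0 \<le> \<rho>" "\<rho> < 1" using q d_pos by (auto simp: \<rho>_def)
  have "uniform_limit K (\<lambda>n z. \<Sum>i<n. f i z) (\<lambda>z. \<Sum>i. f i z) sequentially"
  proof (rule Weierstrass_m_test)
    show "summable (\<lambda>n. \<rho> ^ n * (1 / d))" using \<rho> by (intro summable_mult2 summable_geometric) auto
    fix n z assume z: "z \<in> K"
    have "cmod (f n z) = (cmod (q - p) / cmod (z - p)) ^ n * (1 / cmod (z - p))"
      by (simp add: f_def norm_mult norm_divide norm_power power_divide)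
    also have "\<dots> \<le> \<rho> ^ n * (1 / d)"
      unfolding \<rho>_def using d[OF z] d_pos by (intro mult_mono power_mono divide_left_mono frac_le) auto
    finally show "cmod (f n z) \<le> \<rho> ^ n * (1 / d)" .
  qed
  moreover have "(\<Sum>i. f i z) = 1 / (z - q)" if z: "z \<in> K" for z
  proof -
    define x where "x = (q - p) / (z - p)"
    have zp: "z - p \<noteq> 0" using d[OF z] d_pos by auto
    have x: "cmod x < 1" using q d[OF z] zp by (simp add: x_def norm_divide divide_less_eq)
    have "(\<Sum>i. f i z) = (\<Sum>i. 1 / (z - p) * x ^ i)" by (simp add: f_def x_def power_divide mult.commute)
    also have "\<dots> = 1 / (z - p) * (1 / (1 - x))"
      using suminf_mult[OF summable_geometric[OF x], of "1 / (z - p)"] suminf_geometric[OF x] by simp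
    also have "1 - x = (z - q) / (z - p)" using zp by (simp add: x_def field_simps)
    finally show ?thesis using zp by simp
  qed
  ultimately have "uniform_limit K (\<lambda>n z. \<Sum>i<n. f i z) (\<lambda>z. 1 / (z - q)) sequentially"
    by (subst (asm) uniform_limit_cong') auto
  moreover have "approximable (\<lambda>z. \<Sum>i<n. f i z)" for n
    unfolding f_def by (intro approximable_sum approximable_mult approximable_const approximable_power p)
  ultimately show ?thesis by (rule approximable_uniform_limit) simp
qed

lemma approximable_push_pole_connected:
  assumes S: "connected S" "p \<in> S" "q \<in> S" "S \<inter> K = {}"
    and p: "approximable (\<lambda>z. 1 / (z - p))"
  shows "approximable (\<lambda>z. 1 / (z - q))"
proof (rule connected_induction_simple[where P = "\<lambda>p. approximable (\<lambda>z. 1 / (z - p))", OF S(1-3) p])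
  fix a assume a: "a \<in> S"
  then obtain \<delta> where \<delta>: "\<delta> > 0" "\<And>z. z \<in> K \<Longrightarrow> \<delta> \<le> dist a z"
    using separate_point_closed[OF compact_imp_closed[OF compact_K], of a] S(4) by blast
  show "\<exists>T. openin (top_of_set S) T \<and> a \<in> T \<and>
      (\<forall>x\<in>T. \<forall>y\<in>T. approximable (\<lambda>z. 1 / (z - x)) \<longrightarrow> approximable (\<lambda>z. 1 / (z - y)))"
  proof (intro exI[of _ "S \<inter> ball a (\<delta>/3)"] conjI ballI impI)
    fix x y assume x: "x \<in> S \<inter> ball a (\<delta>/3)" and y: "y \<in> S \<inter> ball a (\<delta>/3)"
    assume "approximable (\<lambda>z. 1 / (z - x))"
    then show "approximable (\<lambda>z. 1 / (z - y))"
    proof (rule approximable_push_pole)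
      show "2 * \<delta> / 3 \<le> cmod (z - x)" if "z \<in> K" for z
        using \<delta>(2)[OF that] x dist_triangle[of a z x] by (simp add: dist_norm norm_minus_commute)
      show "cmod (y - x) < 2 * \<delta> / 3"
        using x y dist_triangle[of y x a] by (simp add: dist_commute flip: dist_norm)
    qed
  qed (use a \<delta>(1) in \<open>auto intro: openin_open_Int\<close>)
qed

lemma approximable_real_polynomial:
  fixes p :: "complex \<Rightarrow> real"
  assumes cnj: "approximable cnj" and p: "real_polynomial_function p"
  shows "approximable (\<lambda>z. of_real (p z))"
  using p
proof (induction rule: real_polynomial_function.induct)
  case (linear p)
  interpret bounded_linear p by fact
  have "approximable (\<lambda>z. (of_real (p 1) / 2) * (z + cnj z) + (- \<i> * of_real (p \<i>) / 2) * (z + (- 1) * cnj z))"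
    by (intro approximable_add approximable_mult approximable_const approximable_ident cnj)
  moreover have "(of_real (p 1) / 2) * (z + cnj z) + (- \<i> * of_real (p \<i>) / 2) * (z + (- 1) * cnj z) =
      of_real (p z)" for z
  proof -
    have "p z = p (Re z *\<^sub>R 1 + Im z *\<^sub>R \<i>)" by (rule arg_cong[of _ _ p]) (simp add: complex_eq_iff)
    also have "\<dots> = p 1 * Re z + p \<i> * Im z" by (simp only: add scaleR) simp
    finally show ?thesis by (simp add: complex_eq_iff)
  qed
  ultimately show ?case by simp
next
  case (const c)
  show ?case by (rule approximable_const)
next
  case (add p q)
  then show ?case by (simp add: approximable_add)
next
  case (mult p q)
  then show ?case by (simp add: approximable_mult)
qed

lemma approximable_continuous:
  assumes cnj: "approximable cnj" and f: "continuous_on K f"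
  shows "approximable f"
proof -
  obtain g where g: "uniform_limit K g f sequentially" "\<And>n. polynomial_function (g n)"
    using Stone_Weierstrass_uniform_limit[OF compact_K f] by blast
  have "approximable (g n)" for n
  proof -
    have "real_polynomial_function (Re \<circ> g n)" "real_polynomial_function (Im \<circ> g n)"
      using g(2) bounded_linear_Re bounded_linear_Im unfolding polynomial_function_def by blast+
    then have "approximable (\<lambda>z. of_real ((Re \<circ> g n) z) + \<i> * of_real ((Im \<circ> g n) z))"
      by (intro approximable_add approximable_mult approximable_const approximable_real_polynomial cnj)
    then show ?thesis by (simp flip: complex_eq)
  qed
  then show ?thesis by (rule approximable_uniform_limit[OF g(1) _ sequentially_bot])
qed

end

theorem holomorphic_approximation_proper_circle_subset:
  assumes K: "compact K" "K \<subset> sphere 0 1" and f: "continuous_on K f" and "R > 1" "e > 0"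
  obtains g where "g holomorphic_on ball 0 R" "\<And>z. z \<in> K \<Longrightarrow> dist (g z) (f z) < e"
proof -
  interpret holomorphic_approximation "ball 0 R" K
    by unfold_locales (use K \<open>R > 1\<close> in \<open>auto simp: subset_iff\<close>)
  obtain \<xi> where \<xi>: "cmod \<xi> = 1" "\<xi> \<notin> K" using psubset_imp_ex_mem[OF K(2)] by auto
  have "approximable (\<lambda>z. 1 / (z - 0))"
  proof (rule approximable_push_pole_connected)
    let ?S = "closed_segment (of_real R * \<xi>) 0"
    show "connected ?S" "of_real R * \<xi> \<in> ?S" "0 \<in> ?S" by auto
    have False if t: "0 \<le> t" "(1 - t) *\<^sub>R (of_real R * \<xi>) \<in> K" "t \<le> 1" for t
    proof -
      have "cmod ((1 - t) *\<^sub>R (of_real R * \<xi>)) = 1" using t(2) K(2) by auto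
      then have "(1 - t) * R = 1" using t \<xi>(1) \<open>R > 1\<close> by (simp add: norm_mult)
      moreover have "(1 - t) *\<^sub>R (of_real R * \<xi>) = of_real ((1 - t) * R) * \<xi>"
        by (simp only: scaleR_conv_of_real of_real_mult mult.assoc)
      ultimately have "(1 - t) *\<^sub>R (of_real R * \<xi>) = \<xi>" by simp
      then show False using t(2) \<xi>(2) by simp
    qed
    then show "?S \<inter> K = {}" by (force simp: closed_segment_def)
    show "approximable (\<lambda>z. 1 / (z - of_real R * \<xi>))"
      by (intro approximable_holomorphic holomorphic_intros) (use \<xi>(1) \<open>R > 1\<close> in \<open>auto simp: norm_mult\<close>)
  qed
  moreover have "1 / (z - 0) = cnj z" if "z \<in> K" for z
  proof -
    have "cmod z = 1" using that K(2) by auto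
    then have "z * cnj z = 1" "z \<noteq> 0" using complex_norm_square[of z] by auto
    then show ?thesis by (simp add: field_simps)
  qed
  ultimately have "approximable cnj" by (rule approximable_cong[rotated])
  then have "approximable f" using f by (rule approximable_continuous)
  then show thesis using that \<open>e > 0\<close> unfolding approximable_def by blast
qed

section \<open>Saturation\<close>

lemma circle_AE_norm_le_nonneg:
  assumes "AE \<zeta> in circle_meas. cmod (g \<zeta>) \<le> C" shows "C \<ge> 0"
proof (rule ccontr)
  assume neg: "\<not> C \<ge> 0"
  from assms have "AE \<zeta> in circle_meas. False"
    by eventually_elim (use neg norm_ge_zero order_trans in blast)
  then show False by simp
qed

lemma linf_le: "AE \<zeta> in circle_meas. cmod (g \<zeta>) \<le> C \<Longrightarrow> linf g \<le> C"
  unfolding linf_def using circle_AE_norm_le_nonneg by (intro cInf_lower) (auto intro!: bdd_belowI[of _ 0])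

lemma AE_norm_le_linf:
  assumes "AE \<zeta> in circle_meas. cmod (g \<zeta>) \<le> B" shows "AE \<zeta> in circle_meas. cmod (g \<zeta>) \<le> linf g"
proof -
  let ?X = "{C. C \<ge> 0 \<and> (AE \<zeta> in circle_meas. cmod (g \<zeta>) \<le> C)}"
  have "B \<in> ?X" using assms circle_AE_norm_le_nonneg[OF assms] by simp
  have "AE \<zeta> in circle_meas. cmod (g \<zeta>) \<le> linf g + inverse (real (Suc n))" for n
  proof -
    have "\<exists>C\<in>?X. C < linf g + inverse (real (Suc n))"
      using \<open>B \<in> ?X\<close> by (intro cInf_lessD) (auto simp: linf_def)
    then show ?thesis by (auto elim!: eventually_mono)
  qed
  then have "AE \<zeta> in circle_meas. \<forall>n. cmod (g \<zeta>) \<le> linf g + inverse (real (Suc n))"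
    by (simp add: AE_all_countable)
  then show ?thesis
  proof eventually_elim
    case (elim \<zeta>)
    have "(\<lambda>n. linf g + inverse (real (Suc n))) \<longlonglongrightarrow> linf g + 0"
      by (intro tendsto_intros LIMSEQ_inverse_real_of_nat)
    then show ?case using elim by (intro LIMSEQ_le_const[of _ "linf g"]) auto
  qed
qed

lemma linf_nonneg: "AE \<zeta> in circle_meas. cmod (g \<zeta>) \<le> B \<Longrightarrow> linf g \<ge> 0"
  using AE_norm_le_linf circle_AE_norm_le_nonneg by blast

lemma linf_eq_SUP:
  fixes h :: "complex \<Rightarrow> real"
  assumes h: "continuous_on (sphere 0 1) h" and g: "AE \<zeta> in circle_meas. cmod (g \<zeta>) = h \<zeta>"
  shows "linf g = (SUP \<zeta>\<in>sphere 0 1. h \<zeta>)"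
proof (rule antisym)
  have bdd: "bdd_above (h ` sphere 0 1)"
    by (intro bounded_imp_bdd_above compact_imp_bounded compact_continuous_image h compact_sphere)
  have le: "AE \<zeta> in circle_meas. cmod (g \<zeta>) \<le> (SUP \<zeta>\<in>sphere 0 1. h \<zeta>)"
    using g AE_circle_meas_norm by eventually_elim (auto intro: cSUP_upper[OF _ bdd])
  then show "linf g \<le> (SUP \<zeta>\<in>sphere 0 1. h \<zeta>)" by (rule linf_le)
  have "AE \<zeta> in circle_meas. h \<zeta> \<le> linf g"
    using g AE_norm_le_linf[OF le] by eventually_elim simp
  then show "(SUP \<zeta>\<in>sphere 0 1. h \<zeta>) \<le> linf g"
    by (intro cSUP_least circle_AE_le_imp_le[OF h]) auto
qed

lemma bdry_bounded:
  assumes "f \<in> Hinf" obtains B where "AE \<zeta> in circle_meas. cmod (bdry f \<zeta>) \<le> B"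
  using Hinf_boundedE[OF assms] norm_bdry_le[OF assms] by metis

lemma bdry_diff_cnj_bounded:
  assumes "\<phi> \<in> Hinf" "f \<in> Hinf"
  obtains B where "AE \<zeta> in circle_meas. cmod (bdry \<phi> \<zeta> - cnj (bdry f \<zeta>)) \<le> B"
proof -
  obtain B C where "AE \<zeta> in circle_meas. cmod (bdry \<phi> \<zeta>) \<le> B" "AE \<zeta> in circle_meas. cmod (bdry f \<zeta>) \<le> C"
    using bdry_bounded[OF assms(1)] bdry_bounded[OF assms(2)] by metis
  then have "AE \<zeta> in circle_meas. cmod (bdry \<phi> \<zeta> - cnj (bdry f \<zeta>)) \<le> B + C"
  proof eventually_elim
    case (elim \<zeta>)
    then show ?case using norm_triangle_ineq4[of "bdry \<phi> \<zeta>" "cnj (bdry f \<zeta>)"] by simp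
  qed
  then show thesis by (rule that)
qed

lemma saturated_iff:
  assumes \<phi>: "\<phi> \<in> Hinf"
  shows "saturated \<phi> \<longleftrightarrow> (\<forall>f\<in>Hinf0. linf (bdry \<phi>) \<le> linf (\<lambda>\<zeta>. bdry \<phi> \<zeta> - cnj (bdry f \<zeta>)))"
proof -
  let ?L = "\<lambda>f. linf (\<lambda>\<zeta>. bdry \<phi> \<zeta> - cnj (bdry f \<zeta>))"
  have zero: "(\<lambda>_. 0) \<in> Hinf0" by (simp add: Hinf0_def)
  have "bdry (\<lambda>_. 0) = (\<lambda>_. 0)" by (intro ext bdry_eqI) simp
  then have L_zero: "?L (\<lambda>_. 0) = linf (bdry \<phi>)" by simp
  have "?L f \<ge> 0" if "f \<in> Hinf0" for f
  proof -
    have "f \<in> Hinf" using that by (simp add: Hinf0_def)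
    then obtain B where "AE \<zeta> in circle_meas. cmod (bdry \<phi> \<zeta> - cnj (bdry f \<zeta>)) \<le> B"
      using bdry_diff_cnj_bounded[OF \<phi>] by blast
    then show ?thesis by (rule linf_nonneg)
  qed
  then have bdd: "bdd_below (?L ` Hinf0)" by (auto intro!: bdd_belowI[of _ 0])
  have "(INF f\<in>Hinf0. ?L f) \<le> linf (bdry \<phi>)" using cINF_lower[OF bdd zero] L_zero by simp
  then have "saturated \<phi> \<longleftrightarrow> linf (bdry \<phi>) \<le> (INF f\<in>Hinf0. ?L f)" by (auto simp: saturated_def)
  also have "\<dots> \<longleftrightarrow> (\<forall>f\<in>Hinf0. linf (bdry \<phi>) \<le> ?L f)" using zero by (intro le_cINF_iff bdd) auto
  finally show ?thesis .
qed

lemma cmod_diff_cnj_sq: "(cmod (a - cnj b))\<^sup>2 = (cmod a)\<^sup>2 - 2 * Re (a * b) + (cmod b)\<^sup>2"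
  unfolding cmod_power2 by (simp add: power2_eq_square algebra_simps)

lemma Re_mult_ge_if_diff_cnj_le:
  assumes "A \<le> cmod a" "0 \<le> A" "cmod (a - cnj b) \<le> C"
  shows "(A\<^sup>2 - C\<^sup>2) / 2 \<le> Re (a * b)"
proof -
  have "A\<^sup>2 \<le> (cmod a)\<^sup>2" "(cmod (a - cnj b))\<^sup>2 \<le> C\<^sup>2" using assms by (auto intro: power_mono)
  moreover have "0 \<le> (cmod b)\<^sup>2" by simp
  ultimately have "A\<^sup>2 - C\<^sup>2 \<le> 2 * Re (a * b)" using cmod_diff_cnj_sq[of a b] by linarith
  then show ?thesis by simp
qed

lemma diff_cnj_le_if_Re_mult_ge:
  assumes a: "cmod a \<le> M" and b: "cmod b \<le> B" and c: "c \<le> Re (a * b)" and \<epsilon>: "0 \<le> \<epsilon>" "\<epsilon> * B\<^sup>2 \<le> c"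
  shows "cmod (a - cnj (of_real \<epsilon> * b)) \<le> sqrt (M\<^sup>2 - \<epsilon> * c)"
proof (rule real_le_rsqrt)
  have "(cmod a)\<^sup>2 \<le> M\<^sup>2" "(cmod b)\<^sup>2 \<le> B\<^sup>2" using a b by (auto intro: power_mono)
  moreover have "\<epsilon> * (\<epsilon> * (cmod b)\<^sup>2) \<le> \<epsilon> * (\<epsilon> * B\<^sup>2)"
    using \<open>(cmod b)\<^sup>2 \<le> B\<^sup>2\<close> \<epsilon>(1) by (intro mult_left_mono)
  moreover have "\<epsilon> * (\<epsilon> * B\<^sup>2) \<le> \<epsilon> * c" "\<epsilon> * c \<le> \<epsilon> * Re (a * b)"
    using \<epsilon> c by (auto intro: mult_left_mono)
  moreover have "(cmod (a - cnj (of_real \<epsilon> * b)))\<^sup>2 = (cmod a)\<^sup>2 - 2 * (\<epsilon> * Re (a * b)) + \<epsilon> * (\<epsilon> * (cmod b)\<^sup>2)"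
    unfolding cmod_diff_cnj_sq using \<epsilon>(1) by (simp add: norm_mult power_mult_distrib power2_eq_square algebra_simps)
  ultimately show "(cmod (a - cnj (of_real \<epsilon> * b)))\<^sup>2 \<le> M\<^sup>2 - \<epsilon> * c" by linarith
qed

subsection \<open>Functions of continuous modulus\<close>

locale continuous_modulus =
  fixes \<phi> :: "complex \<Rightarrow> complex" and h :: "complex \<Rightarrow> real"
  assumes \<phi>_Hinf: "\<phi> \<in> Hinf"
    and h_continuous: "continuous_on (sphere 0 1) h"
    and norm_bdry: "AE \<zeta> in circle_meas. cmod (bdry \<phi> \<zeta>) = h \<zeta>"
begin

definition max_modulus :: real where "max_modulus = linf (bdry \<phi>)"

definition peak_set :: "complex set" where "peak_set = {\<zeta>\<in>sphere 0 1. h \<zeta> = max_modulus}"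

lemma max_modulus_eq_SUP: "max_modulus = (SUP \<zeta>\<in>sphere 0 1. h \<zeta>)"
  unfolding max_modulus_def by (rule linf_eq_SUP[OF h_continuous norm_bdry])

lemma h_le_max_modulus: "\<zeta> \<in> sphere 0 1 \<Longrightarrow> h \<zeta> \<le> max_modulus"
  unfolding max_modulus_eq_SUP
  by (intro cSUP_upper bounded_imp_bdd_above compact_imp_bounded compact_continuous_image h_continuous compact_sphere)

lemma h_nonneg: "\<zeta> \<in> sphere 0 1 \<Longrightarrow> 0 \<le> h \<zeta>"
proof -
  have "AE \<zeta> in circle_meas. - h \<zeta> \<le> 0"
    using norm_bdry by eventually_elim (metis neg_le_0_iff_le norm_ge_zero)
  then show "\<zeta> \<in> sphere 0 1 \<Longrightarrow> 0 \<le> h \<zeta>"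
    using circle_AE_le_imp_le[of "\<lambda>\<zeta>. - h \<zeta>" 0 \<zeta>] h_continuous by (auto intro: continuous_intros)
qed

lemma superlevel_eq_peak_set: "superlevel (\<lambda>\<zeta>. of_real (h \<zeta>)) 1 = peak_set"
proof -
  have "AE \<zeta> in circle_meas. cmod (complex_of_real (h \<zeta>)) = h \<zeta>"
    using AE_circle_meas_norm by eventually_elim (use h_nonneg in auto)
  then have "linf (\<lambda>\<zeta>. of_real (h \<zeta>)) = max_modulus"
    unfolding max_modulus_eq_SUP by (rule linf_eq_SUP[OF h_continuous])
  then show ?thesis
    unfolding superlevel_def peak_set_def using h_nonneg h_le_max_modulus by (auto intro: antisym)
qed

lemma peak_set_subset: "peak_set \<subseteq> sphere 0 1"
  by (auto simp: peak_set_def)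

lemma compact_peak_set: "compact peak_set"
proof -
  have "closed (sphere 0 1 \<inter> h -` {max_modulus})"
    by (intro continuous_closed_preimage h_continuous) auto
  then have "closed peak_set" by (simp add: peak_set_def vimage_def Int_def)
  then show ?thesis
    using bounded_subset[OF bounded_sphere peak_set_subset] by (simp add: compact_eq_bounded_closed)
qed

lemma modulus_gap_off_peak_set:
  assumes "open V" "peak_set \<subseteq> V"
  obtains \<eta> where "\<eta> > 0" "\<And>\<zeta>. \<zeta> \<in> sphere 0 1 - V \<Longrightarrow> h \<zeta> \<le> max_modulus - \<eta>"
proof (cases "sphere 0 1 - V = {}")
  case True
  then show thesis by (intro that[of 1]) auto
next
  case False
  have "compact (sphere 0 1 - V)" using assms(1) by (intro compact_diff) auto
  then obtain \<xi> where \<xi>: "\<xi> \<in> sphere 0 1 - V" "\<forall>\<zeta>\<in>sphere 0 1 - V. h \<zeta> \<le> h \<xi>"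
    using continuous_attains_sup[OF _ False continuous_on_subset[OF h_continuous Diff_subset]] by blast
  then have "h \<xi> \<noteq> max_modulus" using assms(2) by (auto simp: peak_set_def)
  then have "h \<xi> < max_modulus" using h_le_max_modulus[of \<xi>] \<xi>(1) by simp
  then show thesis using that[of "max_modulus - h \<xi>"] \<xi>(2) by simp
qed

lemma AE_diff_cnj_le_if_Re_mult_ge:
  assumes ge: "AE \<zeta> in circle_meas. \<zeta> \<in> V \<longrightarrow> c \<le> Re (bdry \<phi> \<zeta> * bdry F \<zeta>)"
    and gap: "\<And>\<zeta>. \<zeta> \<in> sphere 0 1 - V \<Longrightarrow> h \<zeta> \<le> max_modulus - \<eta>"
    and B: "AE \<zeta> in circle_meas. cmod (bdry F \<zeta>) \<le> B"
    and \<epsilon>: "\<epsilon> > 0" "\<epsilon> * B \<le> \<eta> / 2" "\<epsilon> * B\<^sup>2 \<le> c"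
  shows "AE \<zeta> in circle_meas. cmod (bdry \<phi> \<zeta> - cnj (of_real \<epsilon> * bdry F \<zeta>)) \<le>
    max (sqrt (max_modulus\<^sup>2 - \<epsilon> * c)) (max_modulus - \<eta> / 2)"
  using norm_bdry B ge AE_circle_meas_norm
proof eventually_elim
  case (elim \<zeta>)
  have \<zeta>: "\<zeta> \<in> sphere 0 1" using elim(4) by simp
  show ?case
  proof (cases "\<zeta> \<in> V")
    case True
    then have "cmod (bdry \<phi> \<zeta> - cnj (of_real \<epsilon> * bdry F \<zeta>)) \<le> sqrt (max_modulus\<^sup>2 - \<epsilon> * c)"
      using elim \<epsilon> h_le_max_modulus[OF \<zeta>] by (intro diff_cnj_le_if_Re_mult_ge[of _ _ _ B]) auto
    then show ?thesis by simp
  next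
    case False
    have "cmod (of_real \<epsilon> * bdry F \<zeta>) \<le> \<epsilon> * B" using elim(2) \<epsilon>(1) by (simp add: norm_mult)
    moreover have "cmod (bdry \<phi> \<zeta>) \<le> max_modulus - \<eta>" using gap[of \<zeta>] elim(1) False \<zeta> by simp
    ultimately have "cmod (bdry \<phi> \<zeta> - cnj (of_real \<epsilon> * bdry F \<zeta>)) \<le> max_modulus - \<eta> / 2"
      using norm_triangle_ineq4[of "bdry \<phi> \<zeta>" "cnj (of_real \<epsilon> * bdry F \<zeta>)"] \<epsilon>(2)
      unfolding complex_mod_cnj by linarith
    then show ?thesis by simp
  qed
qed

lemma not_saturated_if_Re_mult_ge:
  assumes F: "F \<in> Hinf0" and "c > 0" and V: "open V" "peak_set \<subseteq> V"
    and ge: "AE \<zeta> in circle_meas. \<zeta> \<in> V \<longrightarrow> c \<le> Re (bdry \<phi> \<zeta> * bdry F \<zeta>)"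
  shows "\<not> saturated \<phi>"
proof -
  have F_Hinf: "F \<in> Hinf" using F by (simp add: Hinf0_def)
  obtain \<eta> where \<eta>: "\<eta> > 0" "\<And>\<zeta>. \<zeta> \<in> sphere 0 1 - V \<Longrightarrow> h \<zeta> \<le> max_modulus - \<eta>"
    using modulus_gap_off_peak_set[OF V] by blast
  obtain B where B: "B > 0" "AE \<zeta> in circle_meas. cmod (bdry F \<zeta>) \<le> B"
  proof -
    obtain B where B: "AE \<zeta> in circle_meas. cmod (bdry F \<zeta>) \<le> B" using bdry_bounded[OF F_Hinf] .
    show thesis by (rule that[of "max 1 B"]) (use B in \<open>auto elim: eventually_mono\<close>)
  qed
  define \<epsilon> where "\<epsilon> = min (\<eta> / (2 * B)) (c / B\<^sup>2)"
  have \<epsilon>: "\<epsilon> > 0" "\<epsilon> * B \<le> \<eta> / 2" "\<epsilon> * B\<^sup>2 \<le> c"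
  proof -
    show "\<epsilon> > 0" using \<eta>(1) B(1) \<open>c > 0\<close> by (simp add: \<epsilon>_def)
    have "\<epsilon> \<le> \<eta> / (2 * B)" "\<epsilon> \<le> c / B\<^sup>2" by (simp_all add: \<epsilon>_def)
    then show "\<epsilon> * B \<le> \<eta> / 2" "\<epsilon> * B\<^sup>2 \<le> c" using B(1) by (simp_all add: field_simps)
  qed
  define f where "f = (\<lambda>z. of_real \<epsilon> * F z)"
  have f: "f \<in> Hinf0" using Hinf_mult[OF Hinf_const F_Hinf, of "of_real \<epsilon>"] F by (simp add: Hinf0_def f_def)
  define C where "C = max (sqrt (max_modulus\<^sup>2 - \<epsilon> * c)) (max_modulus - \<eta> / 2)"
  have "AE \<zeta> in circle_meas. bdry f \<zeta> = of_real \<epsilon> * bdry F \<zeta>"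
    using Hinf_radial_limit[OF F_Hinf] unfolding f_def by eventually_elim (rule bdry_eqI, rule tendsto_mult_left)
  moreover have "AE \<zeta> in circle_meas. cmod (bdry \<phi> \<zeta> - cnj (of_real \<epsilon> * bdry F \<zeta>)) \<le> C"
    unfolding C_def by (rule AE_diff_cnj_le_if_Re_mult_ge[OF ge _ B(2) \<epsilon>]) (rule \<eta>(2))
  ultimately have "AE \<zeta> in circle_meas. cmod (bdry \<phi> \<zeta> - cnj (bdry f \<zeta>)) \<le> C"
    by eventually_elim simp
  then have "linf (\<lambda>\<zeta>. bdry \<phi> \<zeta> - cnj (bdry f \<zeta>)) \<le> C" by (rule linf_le)
  also have "C < max_modulus"
  proof -
    have "max_modulus \<ge> 0" using h_nonneg[of 1] h_le_max_modulus[of 1] by simp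
    then have "sqrt (max_modulus\<^sup>2 - \<epsilon> * c) < max_modulus"
      using real_sqrt_less_mono[of "max_modulus\<^sup>2 - \<epsilon> * c" "max_modulus\<^sup>2"] \<epsilon>(1) \<open>c > 0\<close> by simp
    then show ?thesis using \<eta>(1) by (simp add: C_def)
  qed
  finally show ?thesis using f unfolding saturated_iff[OF \<phi>_Hinf] max_modulus_def by force
qed

lemma Re_mult_ge_if_not_saturated:
  assumes "\<not> saturated \<phi>"
  obtains F c V where "F \<in> Hinf0" "c > 0" "open V" "peak_set \<subseteq> V"
    "AE \<zeta> in circle_meas. \<zeta> \<in> V \<longrightarrow> c \<le> Re (bdry \<phi> \<zeta> * bdry F \<zeta>)"
proof -
  obtain F where F: "F \<in> Hinf0" "linf (\<lambda>\<zeta>. bdry \<phi> \<zeta> - cnj (bdry F \<zeta>)) < max_modulus"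
    using assms unfolding saturated_iff[OF \<phi>_Hinf] max_modulus_def by force
  define C where "C = linf (\<lambda>\<zeta>. bdry \<phi> \<zeta> - cnj (bdry F \<zeta>))"
  obtain B where "AE \<zeta> in circle_meas. cmod (bdry \<phi> \<zeta> - cnj (bdry F \<zeta>)) \<le> B"
    using bdry_diff_cnj_bounded[OF \<phi>_Hinf, of F] F(1) by (auto simp: Hinf0_def)
  then have C: "C \<ge> 0" "AE \<zeta> in circle_meas. cmod (bdry \<phi> \<zeta> - cnj (bdry F \<zeta>)) \<le> C"
    unfolding C_def by (rule linf_nonneg, rule AE_norm_le_linf)
  obtain A where A: "C < A" "A < max_modulus" using dense F(2) unfolding C_def by blast
  obtain V where V: "open V" "sphere 0 1 \<inter> h -` {A<..} = sphere 0 1 \<inter> V"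
    using continuous_openin_preimage_gen[OF h_continuous open_greaterThan, of A] unfolding openin_open by blast
  have V_iff: "\<zeta> \<in> V \<longleftrightarrow> A < h \<zeta>" if "cmod \<zeta> = 1" for \<zeta>
    using eqset_imp_iff[OF V(2), of \<zeta>] that by simp
  show thesis
  proof (rule that[OF F(1) _ V(1)])
    show "(A\<^sup>2 - C\<^sup>2) / 2 > 0" using A(1) C(1) by (simp add: power_strict_mono)
    show "peak_set \<subseteq> V" using V_iff A(2) by (auto simp: peak_set_def)
    show "AE \<zeta> in circle_meas. \<zeta> \<in> V \<longrightarrow> (A\<^sup>2 - C\<^sup>2) / 2 \<le> Re (bdry \<phi> \<zeta> * bdry F \<zeta>)"
      using norm_bdry C(2) AE_circle_meas_norm
    proof eventually_elim
      case (elim \<zeta>)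
      have "A \<le> cmod (bdry \<phi> \<zeta>)" if "\<zeta> \<in> V" using that V_iff[OF elim(3)] elim(1) by simp
      then show ?case using A(1) C(1) by (intro impI Re_mult_ge_if_diff_cnj_le elim(2)) auto
    qed
  qed
qed

end

subsection \<open>Inner-outer factorizations\<close>

lemma Hinf_Re_gt_near:
  assumes G: "G \<in> Hinf" and V: "open V" "\<zeta>\<^sub>0 \<in> V" and \<zeta>\<^sub>0: "cmod \<zeta>\<^sub>0 = 1"
    and ge: "AE \<zeta> in circle_meas. \<zeta> \<in> V \<longrightarrow> c \<le> Re (bdry G \<zeta>)" and c': "c' < c"
  obtains \<delta> where "\<delta> > 0" "\<And>z. z \<in> ball 0 1 \<Longrightarrow> dist z \<zeta>\<^sub>0 < \<delta> \<Longrightarrow> c' < Re (G z)"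
proof -
  obtain g :: "complex \<Rightarrow> complex" where g: "integrable circle_meas g"
    "\<And>z. z \<in> ball 0 1 \<Longrightarrow> G z = poisson_integral circle_meas g z" "AE \<zeta> in circle_meas. radial_limit G \<zeta> (g \<zeta>)"
    using Hinf_poisson_representation[OF G] by blast
  obtain d where d: "d > 0" "ball \<zeta>\<^sub>0 d \<subseteq> V" using V open_contains_ball by blast
  have "AE \<zeta> in circle_meas. dist \<zeta> \<zeta>\<^sub>0 < d \<longrightarrow> c \<le> Re (g \<zeta>)"
    using ge g(3) by eventually_elim (use d(2) in \<open>auto simp: bdry_eqI dist_commute subset_eq\<close>)
  then have "eventually (\<lambda>z. c' < poisson_integral circle_meas (\<lambda>\<zeta>. Re (g \<zeta>)) z) (at \<zeta>\<^sub>0 within ball 0 1)"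
    using g(1) c' by (intro eventually_poisson_integral_gt[OF _ d(1) \<zeta>\<^sub>0]) auto
  then obtain \<delta> where \<delta>: "\<delta> > 0" "\<And>z. z \<in> ball 0 1 \<Longrightarrow> z \<noteq> \<zeta>\<^sub>0 \<Longrightarrow> dist z \<zeta>\<^sub>0 < \<delta> \<Longrightarrow>
      c' < poisson_integral circle_meas (\<lambda>\<zeta>. Re (g \<zeta>)) z"
    unfolding eventually_at by blast
  show thesis
  proof (rule that[OF \<delta>(1)])
    fix z assume z: "z \<in> ball 0 1" "dist z \<zeta>\<^sub>0 < \<delta>"
    then have "z \<noteq> \<zeta>\<^sub>0" using \<zeta>\<^sub>0 by auto
    then show "c' < Re (G z)"
      using \<delta>(2)[OF z(1) _ z(2)] z(1) g(2)[OF z(1)] circle_meas.Re_poisson_integral[OF g(1), of z] by simp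
  qed
qed

lemma holomorphic_on_larger_ball_Hinf:
  assumes "f holomorphic_on ball 0 R" "R > 1" shows "f \<in> Hinf"
proof -
  have "continuous_on (cball 0 1) f"
    using assms by (intro holomorphic_on_imp_continuous_on holomorphic_on_subset[OF assms(1)]) auto
  then obtain B where "\<And>z. z \<in> cball 0 1 \<Longrightarrow> cmod (f z) \<le> B"
    using compact_continuous_bounded[OF compact_cball] by metis
  then show ?thesis using assms by (intro HinfI[of f B] holomorphic_on_subset[OF assms(1)]) auto
qed

lemma bdry_eq_extension:
  assumes "isCont G \<zeta>" "cmod \<zeta> = 1" "\<And>z. z \<in> ball 0 1 \<Longrightarrow> f z = G z"
  shows "bdry f \<zeta> = G \<zeta>"
proof (rule bdry_eqI)
  show "radial_limit f \<zeta> (G \<zeta>)"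
    using isCont_radial_limit[OF assms(1)] by (subst radial_limit_cong[OF assms(2,3)])
qed

text \<open>Approximate \<open>cnj (W z) / z\<close> by \<open>q\<close> and take \<open>p z = z * q z\<close>.\<close>
lemma Re_mult_holomorphic_gt_half:
  assumes K: "compact K" "K \<subset> sphere 0 1" and W: "continuous_on K W" "\<And>\<zeta>. \<zeta> \<in> K \<Longrightarrow> cmod (W \<zeta>) = 1"
  obtains p where "p holomorphic_on ball 0 2" "p 0 = 0" "\<And>\<zeta>. \<zeta> \<in> K \<Longrightarrow> 1/2 < Re (W \<zeta> * p \<zeta>)"
proof -
  have "continuous_on K (\<lambda>z. cnj (W z) / z)"
    using K(2) by (intro continuous_intros W(1)) auto
  moreover have "(1::real) < 2" "0 < (1/2::real)" by auto
  ultimately obtain q where q: "q holomorphic_on ball 0 2" "\<And>z. z \<in> K \<Longrightarrow> dist (q z) (cnj (W z) / z) < 1/2"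
    using holomorphic_approximation_proper_circle_subset[OF K] by blast
  show thesis
  proof (rule that[of "\<lambda>z. z * q z"])
    show "(\<lambda>z. z * q z) holomorphic_on ball 0 2" by (intro holomorphic_intros q)
    fix \<zeta> assume \<zeta>: "\<zeta> \<in> K"
    then have norm: "cmod \<zeta> = 1" "\<zeta> \<noteq> 0" using K(2) by auto
    have "\<zeta> * q \<zeta> - cnj (W \<zeta>) = \<zeta> * (q \<zeta> - cnj (W \<zeta>) / \<zeta>)" using norm by (simp add: algebra_simps)
    then have "cmod (W \<zeta> * (\<zeta> * q \<zeta> - cnj (W \<zeta>))) < 1/2"
      using q(2)[OF \<zeta>] W(2)[OF \<zeta>] norm by (simp add: norm_mult dist_norm)
    moreover have "W \<zeta> * (\<zeta> * q \<zeta>) = 1 + W \<zeta> * (\<zeta> * q \<zeta> - cnj (W \<zeta>))"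
      using W(2)[OF \<zeta>] complex_norm_square[of "W \<zeta>"] by (simp add: algebra_simps)
    ultimately show "1/2 < Re (W \<zeta> * (\<zeta> * q \<zeta>))"
      using abs_Re_le_cmod[of "W \<zeta> * (\<zeta> * q \<zeta> - cnj (W \<zeta>))"] by simp
  qed simp
qed

locale inner_outer_factorization = continuous_modulus +
  fixes I :: "complex \<Rightarrow> complex" and c :: complex and w :: "complex \<Rightarrow> real"
  assumes inner_I: "inner I" and norm_c: "cmod c = 1" and integrable_w: "integrable circle_meas w"
    and factorization: "z \<in> ball 0 1 \<Longrightarrow> \<phi> z = c * outer_of w z * I z"
begin

lemma AE_exp_w: "AE \<zeta> in circle_meas. exp (w \<zeta>) = h \<zeta>"
proof -
  have "AE \<zeta> in circle_meas. cmod (bdry \<phi> \<zeta>) = exp (w \<zeta>)"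
    by (rule inner_outer_boundary_modulus[OF \<phi>_Hinf inner_I integrable_w])
      (simp add: factorization norm_c norm_mult)
  then show ?thesis using norm_bdry by eventually_elim simp
qed

lemma AE_exp_w_le: "AE \<zeta> in circle_meas. exp (w \<zeta>) \<le> max_modulus"
  using AE_exp_w AE_circle_meas_norm by eventually_elim (simp add: h_le_max_modulus)

lemma max_modulus_pos: "max_modulus > 0"
proof (rule ccontr)
  assume neg: "\<not> max_modulus > 0"
  from AE_exp_w_le have "AE \<zeta> in circle_meas. False"
    by eventually_elim (use neg exp_gt_zero less_le_trans in blast)
  then show False by simp
qed

lemma norm_\<phi>_le: "z \<in> ball 0 1 \<Longrightarrow> cmod (\<phi> z) \<le> max_modulus * cmod (I z)"
proof -
  assume z: "z \<in> ball 0 1"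
  have "AE \<zeta> in circle_meas. w \<zeta> \<le> ln max_modulus"
    using AE_exp_w_le by eventually_elim (simp add: ln_ge_iff max_modulus_pos)
  then have "cmod (outer_of w z) \<le> max_modulus"
    using norm_outer_of_le[OF integrable_w _ z] max_modulus_pos by fastforce
  then show ?thesis by (simp add: factorization[OF z] norm_mult norm_c mult_right_mono)
qed

theorem saturated_if_peak_set_meets_spectrum:
  assumes "\<zeta>\<^sub>0 \<in> peak_set" "\<zeta>\<^sub>0 \<in> inner_spectrum I"
  shows "saturated \<phi>"
proof (rule ccontr)
  assume "\<not> ?thesis"
  then obtain F e V where F: "F \<in> Hinf0" and "e > 0" and V: "open V" "peak_set \<subseteq> V"
    and ge: "AE \<zeta> in circle_meas. \<zeta> \<in> V \<longrightarrow> e \<le> Re (bdry \<phi> \<zeta> * bdry F \<zeta>)"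
    by (rule Re_mult_ge_if_not_saturated) (rule that)
  have F_Hinf: "F \<in> Hinf" using F by (simp add: Hinf0_def)
  obtain B where B: "B \<ge> 0" "\<And>z. z \<in> ball 0 1 \<Longrightarrow> cmod (F z) \<le> B"
    by (rule Hinf_boundedE[OF F_Hinf]) (rule that)
  have \<zeta>\<^sub>0: "\<zeta>\<^sub>0 \<in> V" "cmod \<zeta>\<^sub>0 = 1" using assms(1) V(2) peak_set_subset by auto
  have "AE \<zeta> in circle_meas. \<zeta> \<in> V \<longrightarrow> e \<le> Re (bdry (\<lambda>z. \<phi> z * F z) \<zeta>)"
    using ge bdry_mult[OF \<phi>_Hinf F_Hinf] by eventually_elim simp
  moreover have "e / 2 < e" using \<open>e > 0\<close> by simp
  ultimately obtain \<delta> where \<delta>: "\<delta> > 0" "\<And>z. z \<in> ball 0 1 \<Longrightarrow> dist z \<zeta>\<^sub>0 < \<delta> \<Longrightarrow> e / 2 < Re (\<phi> z * F z)"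
    by (rule Hinf_Re_gt_near[OF Hinf_mult[OF \<phi>_Hinf F_Hinf] V(1) \<zeta>\<^sub>0]) (rule that)
  define \<epsilon> where "\<epsilon> = min \<delta> (e / (2 * (max_modulus * B + 1)))"
  have MB: "max_modulus * B \<ge> 0" using max_modulus_pos B(1) by simp
  then have "\<epsilon> > 0" using \<delta>(1) \<open>e > 0\<close> by (simp add: \<epsilon>_def)
  then obtain z where z: "z \<in> ball 0 1" "dist z \<zeta>\<^sub>0 < \<epsilon>" "cmod (I z) < \<epsilon>"
    using inner_small_near_spectrum[OF assms(2)] by blast
  have "cmod (\<phi> z * F z) \<le> (max_modulus * cmod (I z)) * B"
    unfolding norm_mult using norm_\<phi>_le[OF z(1)] B(2)[OF z(1)] max_modulus_pos by (intro mult_mono) auto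
  also have "\<dots> \<le> (max_modulus * B) * \<epsilon>" using mult_left_mono[OF less_imp_le[OF z(3)] MB] by (simp add: mult_ac)
  also have "\<dots> \<le> (max_modulus * B + 1) * (e / (2 * (max_modulus * B + 1)))"
    using MB \<open>\<epsilon> > 0\<close> by (intro mult_mono) (auto simp: \<epsilon>_def)
  also have "\<dots> = e / 2" using MB by (simp add: field_simps)
  finally show False using \<delta>(2)[OF z(1)] z(2) complex_Re_le_cmod[of "\<phi> z * F z"] by (simp add: \<epsilon>_def)
qed

lemma peak_set_off_ess_support:
  "peak_set \<inter> ess_support circle_meas (\<lambda>\<zeta>. w \<zeta> - max (w \<zeta>) (ln (max_modulus / 2))) = {}"
proof -
  have "\<exists>d>0. AE \<xi> in circle_meas. dist \<xi> \<zeta> < d \<longrightarrow> w \<xi> - max (w \<xi>) (ln (max_modulus / 2)) = 0"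
    if \<zeta>: "\<zeta> \<in> sphere 0 1" "h \<zeta> = max_modulus" for \<zeta>
  proof -
    have "max_modulus / 2 > 0" using max_modulus_pos by simp
    then obtain d where d: "d > 0" "\<And>\<xi>. \<xi> \<in> sphere 0 1 \<Longrightarrow> dist \<xi> \<zeta> < d \<Longrightarrow> dist (h \<xi>) (h \<zeta>) < max_modulus / 2"
      using h_continuous \<zeta>(1) unfolding continuous_on_iff by blast
    have "AE \<xi> in circle_meas. dist \<xi> \<zeta> < d \<longrightarrow> w \<xi> - max (w \<xi>) (ln (max_modulus / 2)) = 0"
      using AE_exp_w AE_circle_meas_norm
    proof eventually_elim
      case (elim \<xi>)
      have "ln (max_modulus / 2) \<le> w \<xi>" if "dist \<xi> \<zeta> < d"
      proof -
        have "max_modulus / 2 \<le> exp (w \<xi>)"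
          using d(2)[OF _ that] elim \<zeta>(2) unfolding dist_real_def abs_less_iff by simp
        then show ?thesis using max_modulus_pos ln_mono[of "max_modulus / 2" "exp (w \<xi>)"] by simp
      qed
      then show ?case by simp
    qed
    then show ?thesis using d(1) by blast
  qed
  then show ?thesis by (auto simp: peak_set_def ess_support_def)
qed

text \<open>The multiplier \<open>\<Psi>\<close> is outer of modulus \<open>1 / max h (max_modulus / 2)\<close>.\<close>
lemma multiple_extends_across_peak_set:
  assumes off: "peak_set \<inter> inner_spectrum I = {}"
  obtains \<Psi> U W where "\<Psi> \<in> Hinf" "open U" "peak_set \<subseteq> U" "W holomorphic_on U"
    "\<And>z. z \<in> ball 0 1 \<Longrightarrow> \<phi> z * \<Psi> z = W z" "\<And>\<zeta>. \<zeta> \<in> peak_set \<Longrightarrow> cmod (W \<zeta>) = 1"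
proof -
  obtain U J where U: "open U" "ball 0 1 \<subseteq> U" "sphere 0 1 - inner_spectrum I \<subseteq> U" and J: "J holomorphic_on U"
    "\<And>z. z \<in> ball 0 1 \<Longrightarrow> J z = I z" "\<And>\<zeta>. \<zeta> \<in> sphere 0 1 - inner_spectrum I \<Longrightarrow> cmod (J \<zeta>) = 1"
    by (rule inner_extends_off_spectrum[OF inner_I]) (rule that)
  have peak: "peak_set \<subseteq> sphere 0 1 - inner_spectrum I" using off peak_set_subset by blast
  define v where "v = (\<lambda>\<zeta>. - max (w \<zeta>) (ln (max_modulus / 2)))"
  define u where "u = (\<lambda>\<zeta>. w \<zeta> + v \<zeta>)"
  have v: "integrable circle_meas v" unfolding v_def using integrable_w by (intro integrable_minus integrable_max) auto
  then have u: "integrable circle_meas u" unfolding u_def using integrable_w by auto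
  define W where "W z = c * outer_of u z * J z" for z
  show thesis
  proof (rule that[of "outer_of v" "U \<inter> - ess_support circle_meas u" W])
    show "outer_of v \<in> Hinf" by (rule outer_of_Hinf[OF v, of "- ln (max_modulus / 2)"]) (simp add: v_def)
    show "open (U \<inter> - ess_support circle_meas u)" by (intro open_Int U open_Compl closed_ess_support)
    show "peak_set \<subseteq> U \<inter> - ess_support circle_meas u"
      using peak_set_off_ess_support peak U(3) by (auto simp: u_def v_def)
    show "W holomorphic_on U \<inter> - ess_support circle_meas u" unfolding W_def
      by (intro holomorphic_intros holomorphic_on_subset[OF J(1)] holomorphic_on_subset[OF outer_of_holomorphic[OF u]])
         auto
    show "\<phi> z * outer_of v z = W z" if z: "z \<in> ball 0 1" for z
      by (simp add: W_def u_def factorization[OF z] outer_of_add[OF integrable_w v z] J(2)[OF z] mult_ac)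
    fix \<zeta> assume "\<zeta> \<in> peak_set"
    then have "cmod \<zeta> = 1" "cmod (J \<zeta>) = 1" using peak_set_subset peak J(3) by auto
    then show "cmod (W \<zeta>) = 1" by (simp add: W_def norm_mult norm_c norm_outer_of_circle)
  qed
qed

theorem not_saturated_if_peak_set_misses_spectrum:
  assumes off: "peak_set \<inter> inner_spectrum I = {}" and proper: "peak_set \<noteq> sphere 0 1"
  shows "\<not> saturated \<phi>"
proof -
  obtain \<Psi> U W where \<Psi>: "\<Psi> \<in> Hinf" and U: "open U" "peak_set \<subseteq> U" and W: "W holomorphic_on U"
    "\<And>z. z \<in> ball 0 1 \<Longrightarrow> \<phi> z * \<Psi> z = W z" "\<And>\<zeta>. \<zeta> \<in> peak_set \<Longrightarrow> cmod (W \<zeta>) = 1"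
    by (rule multiple_extends_across_peak_set[OF off]) (rule that)
  have cont_W: "continuous_on U W" by (rule holomorphic_on_imp_continuous_on[OF W(1)])
  have "peak_set \<subset> sphere 0 1" using peak_set_subset proper by blast
  then obtain p where p: "p holomorphic_on ball 0 2" "p 0 = 0" "\<And>\<zeta>. \<zeta> \<in> peak_set \<Longrightarrow> 1/2 < Re (W \<zeta> * p \<zeta>)"
    using Re_mult_holomorphic_gt_half[OF compact_peak_set _ continuous_on_subset[OF cont_W U(2)] W(3)] by blast
  define F where "F z = \<Psi> z * p z" for z
  have F_Hinf: "F \<in> Hinf" unfolding F_def by (intro Hinf_mult \<Psi> holomorphic_on_larger_ball_Hinf[OF p(1)]) simp
  define V where "V = (U \<inter> ball 0 2) \<inter> (\<lambda>z. Re (W z * p z)) -` {1/2<..}"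
  have cont: "continuous_on (U \<inter> ball 0 2) (\<lambda>z. W z * p z)"
    by (intro continuous_on_mult continuous_on_subset[OF cont_W] holomorphic_on_imp_continuous_on
        holomorphic_on_subset[OF p(1)]) auto
  show ?thesis
  proof (rule not_saturated_if_Re_mult_ge[of F "1/2" V])
    show "F \<in> Hinf0" using F_Hinf p(2) by (simp add: Hinf0_def F_def)
    show "open V" unfolding V_def
      by (intro continuous_open_preimage continuous_on_Re cont open_Int U open_ball open_greaterThan)
    show "peak_set \<subseteq> V" using p(3) U(2) peak_set_subset by (force simp: V_def)
    show "AE \<zeta> in circle_meas. \<zeta> \<in> V \<longrightarrow> 1/2 \<le> Re (bdry \<phi> \<zeta> * bdry F \<zeta>)"
      using bdry_mult[OF \<phi>_Hinf F_Hinf] AE_circle_meas_norm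
    proof eventually_elim
      case (elim \<zeta>)
      have "bdry (\<lambda>z. \<phi> z * F z) \<zeta> = W \<zeta> * p \<zeta>" if "\<zeta> \<in> V"
      proof (rule bdry_eq_extension[OF _ elim(2)])
        show "isCont (\<lambda>z. W z * p z) \<zeta>"
          using cont that U(1) by (auto simp: V_def continuous_on_eq_continuous_at open_Int)
        show "\<phi> z * F z = W z * p z" if "z \<in> ball 0 1" for z
          using W(2)[OF that] by (simp add: F_def flip: mult.assoc)
      qed
      then show ?case using elim(1) by (auto simp: V_def)
    qed
  qed simp
qed

end

theorem theorem3:
  fixes \<phi> \<Phi> I :: "complex \<Rightarrow> complex" and h :: "complex \<Rightarrow> real"
  assumes "\<phi> \<in> Hinf"
    and "inner I" and "outer \<Phi>"
    and "\<forall>z\<in>ball 0 1. \<phi> z = \<Phi> z * I z"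
    and "continuous_on (sphere 0 1) h"
    and "AE \<zeta> in circle_meas. cmod (bdry \<phi> \<zeta>) = h \<zeta>"
    and "\<not> (\<exists>c. \<forall>\<zeta>\<in>sphere 0 1. h \<zeta> = c)"
  shows "saturated \<phi> \<longleftrightarrow> superlevel (\<lambda>\<zeta>. of_real (h \<zeta>)) 1 \<inter> inner_spectrum I \<noteq> {}"
proof -
  obtain c w where "cmod c = 1" "integrable circle_meas w" "\<And>z. z \<in> ball 0 1 \<Longrightarrow> \<Phi> z = c * outer_of w z"
    by (rule outerE[OF assms(3)]) (rule that)
  then interpret inner_outer_factorization \<phi> h I c w
    using assms by unfold_locales auto
  have "peak_set \<noteq> sphere 0 1" using assms(7) by (auto simp: peak_set_def)
  then show ?thesis
    using saturated_if_peak_set_meets_spectrum not_saturated_if_peak_set_misses_spectrum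
    unfolding superlevel_eq_peak_set by blast
qed

end
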